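(* Consider Algorithm IPALM($\mathcal A$) (described in the context) with parameters satisfying $\eta<\rho$. Suppose there are constants $\varsigma\ge 0$, $\omega>0$, $\ell>0$ such that the inner-solver constants satisfy $$K_s\le \frac{\omega}{\beta_s^{\ell}}+\varsigma,\qquad \forall s\ge 1 .$$ Let $0<\epsilon\le\epsilon_0$. Then to obtain a solution $x^s$ such that $$\left|\mathbb E[F(x^s)-F^\star]\right|\le\epsilon,\qquad \mathbb E[\operatorname{dist}(p_2(x^s),\mathcal K)]\le \epsilon,$$ the total expected number of inner solver iterations is bounded as follows: there is an $s$ with $\left|\mathbb E[F(x^s)-F^\star]\right|\le\epsilon$, $\mathbb E[\operatorname{dist}(p_2(x^s),\mathcal K)]\le \epsilon$ and $$\sum_{t=0}^s\mathbb E[m_t]\le m_0+\frac{c_3}{\epsilon^{\ell}}\ln\frac{c_1}{\epsilon\rho},$$ where $$c_0:=2\left(\|(x^{-1},\lambda^0)-(x^\star,\lambda^\star)\|+\frac{2\sqrt{\epsilon_0/\beta_0}}{1-\sqrt{\eta/\rho}}\right)^2+2\|\lambda^\star\|^2+2\|x^\star\|^2,$$ $$c_1:=\max\left(\epsilon_0+2L_{h_1}^2\beta_0+c_0\beta_0,\ \beta_0\|\lambda_2^\star\|\sqrt{c_0},\ \beta_0\sqrt{c_0}\right),$$ $$c_2:=\log_2\left(\frac4\eta+\frac{2\beta_0\left((11+2\rho^{-2})(L_{h_1}^2+4c_0)+4(2\rho-1)^{-1}c_0\right)}{\epsilon_0\eta}\right)+1,$$ $$c_3:=\frac{1+\log_2(\rho/\eta)+c_2}{\ln(1/\rho)}\left(\frac{\varsigma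 c_1^\ell}{\rho^\ell\,\ell\ln(1/\rho)}+\frac{\omega c_1^\ell}{\beta_0^\ell(1-\rho^\ell)}\right).$$
   Context: Setting. Let $d=d_1+d_2$; for $\lambda\in\mathbb R^d$ write $\lambda=(\lambda_1;\lambda_2)$ with $\lambda_i\in\mathbb R^{d_i}$. $\|\cdot\|$ is the Euclidean norm. $g:\mathbb R^n\to\mathbb R\cup\{+\infty\}$ and $h_1:\mathbb R^{d_1}\to\mathbb R$ are proper, convex, closed; $h_2$ is the indicator function of a nonempty closed convex set $\mathcal K\subset\mathbb R^{d_2}$; $f:\mathbb R^n\to\mathbb R\cup\{+\infty\}$ is convex and differentiable on an open set containing $\operatorname{dom}(g)$; $p_1:\mathbb R^n\to\mathbb R^{d_1}$, $p_2:\mathbb R^n\to\mathbb R^{d_2}$ are differentiable. Put $p(x)=(p_1(x);p_2(x))$, $h(u)=h_1(u_1)+h_2(u_2)$, $h^*$ the Fenchel conjugate, $F(x)=f(x)+g(x)+h_1(p_1(x))$. The primal problem is $\min_x f(x)+g(x)+h(p(x))$, with optimal value $F^\star$; the Lagrangian is $L(x;\lambda)=f(x)+g(x)+\langle\lambda,p(x)\rangle-h^*(\lambda)$, and the dual problem is $\max_\lambda D(\lambda)$, $D(\lambda)=\inf_xL(x;\lambda)$. Standing assumptions: (a) $h_1$ is $L_{h_1}$-Lipschitz. (b) For all $x,y\in\mathbb R^n$, $u_1,v_1\in\mathbb R^{d_1}$, $\alpha\in(0,1)$: $h_1(p_1(\alpha x+(1-\alpha)y)-\alpha u_1-(1-\alpha)v_1)\le\alpha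 h_1(p_1(x)-u_1)+(1-\alpha)h_1(p_1(y)-v_1)$. (c) For all $x,y\in\mathbb R^n$, $u_2,v_2\in\mathbb R^{d_2}$, $\alpha\in(0,1)$ with $p_2(x)-u_2\in\mathcal K$, $p_2(y)-v_2\in\mathcal K$: $p_2(\alpha x+(1-\alpha)y)-\alpha u_2-(1-\alpha)v_2\in\mathcal K$. (d) Primal and dual have optimal solutions and strong duality holds: there are $x^\star\in\operatorname{dom}(g)$, $\lambda^\star\in\operatorname{dom}(h^* )$ with $p_2(x^\star)\in\mathcal K$ and $F(x^\star)=L(x^\star;\lambda^\star)=D(\lambda^\star)$. Below $x^\star,\lambda^\star$ are arbitrary primal and dual optimal solutions. Smoothing. For $u,\lambda\in\mathbb R^d$, $\beta>0$: $h(u;\lambda,\beta)=\max_v\{\langle v,u\rangle-h^*(v)-\frac\beta2\|v-\lambda\|^2\}$, $\Lambda(u;\lambda,\beta)$ is its unique maximizer, and $L(x;y,\lambda,\beta)=f(x)+g(x)+h(p(x);\lambda,\beta)+\frac\beta2\|x-y\|^2$. Algorithm IPALM($\mathcal A$). Parameters $\beta_0>0$, $\rho\in(1/2,1)$, $\eta\in(0,1)$, positive integer $m_0$; initial (deterministic) $x^{-1}\in\operatorname{dom}(g)$, $\lambda^0\in\operatorname{dom}(h^* )$. Write $H_s(x)=L(x;x^{s-1},\lambda^s,\beta_s)$, $H_s^\star=\min_xH_s(x)$, $\beta_s=\beta_0\rho^s$, $\epsilon_s=\epsilon_0\eta^s$. Set $x^0=\mathcal A(x^{-1},m_0,H_0)$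 and let $\epsilon_0>0$ be a constant with $\epsilon_0\ge H_0(x^0)-H_0^\star$. For $s=0,1,2,\dots$: $\lambda^{s+1}=\Lambda(p(x^s);\lambda^s,\beta_s)$; $m_{s+1}$ is the smallest positive integer such that $2\epsilon_s+M_s\le 2^{\lfloor m_{s+1}/K_{s+1}\rfloor}\epsilon_{s+1}/2$; $x^{s+1}=\mathcal A(x^s,m_{s+1},H_{s+1})$. Here $$M_s=\beta_s\|\lambda^{s+1}-\lambda^s\|^2+\tfrac{\beta_s-\beta_{s+1}}2\|\Lambda(p(x^s);\lambda^{s+1},\beta_{s+1})-\lambda^{s+1}\|^2+\tfrac{\beta_s^2}{2\beta_{s+1}-\beta_s}\|x^{s-1}-x^s\|^2$$ $$\qquad+\|\lambda^{s+1}-\lambda^s\|\sqrt{\left((\beta_s+\beta_{s+1})L_{h_1}+\|\beta_s\lambda_1^s-\beta_{s+1}\lambda_1^{s+1}\|\right)^2+\|\beta_s\lambda_2^s-\beta_{s+1}\lambda_2^{s+1}\|^2}.$$ Inner solver. $\mathcal A(x,k,H_s)$ denotes the (possibly random) output of $k$ iterations of algorithm $\mathcal A$ on $\min H_s$ started at $x$. With $\mathcal F_s$ the $\sigma$-algebra generated by $\{x^t,\lambda^t:t\le s\}$, it is assumed that for every $s\ge0$ there is a (deterministic) $K_s\ge1$ such that for every $x\in\operatorname{dom}(g)$ and every number of iterations $k$ (both possibly $\mathcal F_{s-1}$-measurable), $\mathbb E[H_s(\mathcal A(x,k,H_s))-H_s^\star\mid\mathcal F_{s-1}]\le2^{-\lfloor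 k/K_s\rfloor}(H_s(x)-H_s^\star)$. *)

theory Defs
  imports "HOL-Probability.Probability"
begin

definition edom :: "('a \<Rightarrow> ereal) \<Rightarrow> 'a set" where
  "edom f = {x. f x < \<infinity>}"

definition eproper :: "('a \<Rightarrow> ereal) \<Rightarrow> bool" where
  "eproper f \<longleftrightarrow> edom f \<noteq> {} \<and> (\<forall>x. f x \<noteq> -\<infinity>)"

definition eepi :: "('a \<Rightarrow> ereal) \<Rightarrow> ('a \<times> real) set" where
  "eepi f = {(x, r). f x \<le> ereal r}"

definition econvex :: "('a::real_vector \<Rightarrow> ereal) \<Rightarrow> bool" where
  "econvex f \<longleftrightarrow> convex (eepi f)"

definition eclosed :: "('a::topological_space \<Rightarrow> ereal) \<Rightarrow> bool" where
  "eclosed f \<longleftrightarrow> closed (eepi f)"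

definition convex_indicator :: "'a set \<Rightarrow> 'a \<Rightarrow> ereal" where
  "convex_indicator K u = (if u \<in> K then 0 else \<infinity>)"

definition fenchel_conj :: "('a::real_inner \<Rightarrow> ereal) \<Rightarrow> 'a \<Rightarrow> ereal" where
  "fenchel_conj h l = (SUP u. ereal (l \<bullet> u) - h u)"

text \<open>The space of multipliers is a product type, whose norm and inner product are the Euclidean
  ones. All sums below are free of \<open>\<infinity> - \<infinity>\<close> as long as \<open>f\<close>, \<open>g\<close>, \<open>h\<close> avoid \<open>-\<infinity>\<close> and
  \<open>h\<close> is proper, with one exception: in \<open>lagrangian\<close>, for \<open>x\<close> with \<open>f x + g x = \<infinity>\<close> and
  \<open>l \<notin> edom (fenchel_conj h)\<close>, the value is \<open>\<infinity>\<close>; this does not influence \<open>dual_obj\<close>, which is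
  \<open>-\<infinity>\<close> at such \<open>l\<close> whenever some \<open>x\<close> has \<open>f x + g x < \<infinity>\<close>.\<close>

definition sep_fun :: "('a \<Rightarrow> real) \<Rightarrow> 'b set \<Rightarrow> 'a \<times> 'b \<Rightarrow> ereal" where
  "sep_fun h1 K u = ereal (h1 (fst u)) + convex_indicator K (snd u)"

definition primal_obj ::
  "('n \<Rightarrow> ereal) \<Rightarrow> ('n \<Rightarrow> ereal) \<Rightarrow> ('d \<Rightarrow> ereal) \<Rightarrow> ('n \<Rightarrow> 'd) \<Rightarrow> 'n \<Rightarrow> ereal" where
  "primal_obj f g h p x = f x + g x + h (p x)"

definition lagrangian ::
  "('n \<Rightarrow> ereal) \<Rightarrow> ('n \<Rightarrow> ereal) \<Rightarrow> ('d::real_inner \<Rightarrow> ereal) \<Rightarrow> ('n \<Rightarrow> 'd) \<Rightarrow> 'n \<Rightarrow> 'd \<Rightarrow> ereal" where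
  "lagrangian f g h p x l = f x + g x + ereal (l \<bullet> p x) - fenchel_conj h l"

definition dual_obj ::
  "('n \<Rightarrow> ereal) \<Rightarrow> ('n \<Rightarrow> ereal) \<Rightarrow> ('d::real_inner \<Rightarrow> ereal) \<Rightarrow> ('n \<Rightarrow> 'd) \<Rightarrow> 'd \<Rightarrow> ereal" where
  "dual_obj f g h p l = (INF x. lagrangian f g h p x l)"

definition primal_solution ::
  "('n \<Rightarrow> ereal) \<Rightarrow> ('n \<Rightarrow> ereal) \<Rightarrow> ('d \<Rightarrow> ereal) \<Rightarrow> ('n \<Rightarrow> 'd) \<Rightarrow> 'n \<Rightarrow> bool" where
  "primal_solution f g h p x \<longleftrightarrow> (\<forall>y. primal_obj f g h p x \<le> primal_obj f g h p y)"

definition dual_solution ::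
  "('n \<Rightarrow> ereal) \<Rightarrow> ('n \<Rightarrow> ereal) \<Rightarrow> ('d::real_inner \<Rightarrow> ereal) \<Rightarrow> ('n \<Rightarrow> 'd) \<Rightarrow> 'd \<Rightarrow> bool" where
  "dual_solution f g h p l \<longleftrightarrow> (\<forall>l'. dual_obj f g h p l' \<le> dual_obj f g h p l)"

definition smooth_obj ::
  "('d::real_inner \<Rightarrow> ereal) \<Rightarrow> 'd \<Rightarrow> 'd \<Rightarrow> real \<Rightarrow> 'd \<Rightarrow> ereal" where
  "smooth_obj h u l b v = ereal (v \<bullet> u) - fenchel_conj h v - ereal (b / 2 * (norm (v - l))\<^sup>2)"

definition smoothed :: "('d::real_inner \<Rightarrow> ereal) \<Rightarrow> 'd \<Rightarrow> 'd \<Rightarrow> real \<Rightarrow> ereal" where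
  "smoothed h u l b = (SUP v. smooth_obj h u l b v)"

definition smooth_argmax :: "('d::real_inner \<Rightarrow> ereal) \<Rightarrow> 'd \<Rightarrow> 'd \<Rightarrow> real \<Rightarrow> 'd" where
  "smooth_argmax h u l b = (THE v. \<forall>w. smooth_obj h u l b w \<le> smooth_obj h u l b v)"

definition aug_lagrangian ::
  "('n::real_normed_vector \<Rightarrow> ereal) \<Rightarrow> ('n \<Rightarrow> ereal) \<Rightarrow> ('d::real_inner \<Rightarrow> ereal) \<Rightarrow> ('n \<Rightarrow> 'd)
    \<Rightarrow> 'n \<Rightarrow> 'n \<Rightarrow> 'd \<Rightarrow> real \<Rightarrow> ereal" where
  "aug_lagrangian f g h p x y l b =
     f x + g x + smoothed h (p x) l b + ereal (b / 2 * (norm (x - y))\<^sup>2)"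

text \<open>The iterates are \<open>x s\<close>, \<open>s \<ge> 0\<close>, and the deterministic \<open>xinit\<close>, which plays the
  role of the iterate with index \<open>-1\<close>.\<close>

definition prev_iter :: "'n \<Rightarrow> (nat \<Rightarrow> 'w \<Rightarrow> 'n) \<Rightarrow> nat \<Rightarrow> 'w \<Rightarrow> 'n" where
  "prev_iter xinit x s \<omega> = (case s of 0 \<Rightarrow> xinit | Suc t \<Rightarrow> x t \<omega>)"

text \<open>The subproblem objective of stage \<open>s\<close>; it depends on \<open>\<omega>\<close> through the previous iterate and
  the current multiplier.\<close>

definition sub_obj ::
  "('n::real_normed_vector \<Rightarrow> ereal) \<Rightarrow> ('n \<Rightarrow> ereal) \<Rightarrow> ('d::real_inner \<Rightarrow> ereal) \<Rightarrow> ('n \<Rightarrow> 'd)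
    \<Rightarrow> (nat \<Rightarrow> real) \<Rightarrow> 'n \<Rightarrow> (nat \<Rightarrow> 'w \<Rightarrow> 'n) \<Rightarrow> (nat \<Rightarrow> 'w \<Rightarrow> 'd) \<Rightarrow> nat \<Rightarrow> 'w \<Rightarrow> 'n \<Rightarrow> ereal" where
  "sub_obj f g h p \<beta> xinit x lam s \<omega> =
     (\<lambda>z. aug_lagrangian f g h p z (prev_iter xinit x s \<omega>) (lam s \<omega>) (\<beta> s))"

definition ipalm_M ::
  "real \<Rightarrow> ('d1::euclidean_space \<times> 'd2::euclidean_space \<Rightarrow> ereal)
    \<Rightarrow> ('n::real_normed_vector \<Rightarrow> 'd1 \<times> 'd2) \<Rightarrow> (nat \<Rightarrow> real) \<Rightarrow> 'n \<Rightarrow> (nat \<Rightarrow> 'w \<Rightarrow> 'n)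
    \<Rightarrow> (nat \<Rightarrow> 'w \<Rightarrow> 'd1 \<times> 'd2) \<Rightarrow> nat \<Rightarrow> 'w \<Rightarrow> real" where
  "ipalm_M Lh h p \<beta> xinit x lam s \<omega> =
     (let l = lam s \<omega>; l' = lam (Suc s) \<omega>; b = \<beta> s; b' = \<beta> (Suc s) in
        b * (norm (l' - l))\<^sup>2
      + (b - b') / 2 * (norm (smooth_argmax h (p (x s \<omega>)) l' b' - l'))\<^sup>2
      + b\<^sup>2 / (2 * b' - b) * (norm (prev_iter xinit x s \<omega> - x s \<omega>))\<^sup>2
      + norm (l' - l) *
          sqrt (((b + b') * Lh + norm (b *\<^sub>R fst l - b' *\<^sub>R fst l'))\<^sup>2
                + (norm (b *\<^sub>R snd l - b' *\<^sub>R snd l'))\<^sup>2))"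

text \<open>The \<open>\<sigma>\<close>-algebra generated by the iterates and multipliers with index strictly below \<open>s\<close>,
  that is, index at most \<open>s - 1\<close>. It is trivial for \<open>s = 0\<close>.\<close>

definition past_algebra ::
  "'w measure \<Rightarrow> (nat \<Rightarrow> 'w \<Rightarrow> 'n::topological_space) \<Rightarrow> (nat \<Rightarrow> 'w \<Rightarrow> 'd::topological_space)
    \<Rightarrow> nat \<Rightarrow> 'w measure" where
  "past_algebra M x lam s = sigma (space M)
     ({x t -` B \<inter> space M | t B. t < s \<and> B \<in> sets borel}
      \<union> {lam t -` B \<inter> space M | t B. t < s \<and> B \<in> sets borel})"

text \<open>The rate assumption on the inner solver at one stage, with objective \<open>H \<omega>\<close>, information
  \<open>F\<close> and constant \<open>k0\<close>. The term \<open>Alg z k H \<omega>\<close> is the random output of \<open>k\<close> iterations on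
  \<open>H\<close> started at \<open>z\<close>. The optimality gap is nonnegative and may be infinite, so its conditional
  expectation is the one of extended nonnegative functions. As that is by convention \<open>0\<close> on
  nonmeasurable functions, it is required that the output is a random variable. The starting
  point is only required to lie in \<open>S\<close> almost surely, since the bound itself yields no more than
  that for the output, which is the next starting point.\<close>

definition gap :: "('n \<Rightarrow> ereal) \<Rightarrow> 'n \<Rightarrow> ereal" where
  "gap H z = H z - (INF y. H y)"

definition inner_rate ::
  "'w measure \<Rightarrow> 'w measure \<Rightarrow> 'n::euclidean_space set \<Rightarrow> ('w \<Rightarrow> 'n \<Rightarrow> ereal) \<Rightarrow> real
    \<Rightarrow> ('n \<Rightarrow> nat \<Rightarrow> ('n \<Rightarrow> ereal) \<Rightarrow> 'w \<Rightarrow> 'n) \<Rightarrow> bool" where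
  "inner_rate M F S H k0 Alg \<longleftrightarrow>
     (\<forall>X k. X \<in> borel_measurable F \<longrightarrow> (AE \<omega> in M. X \<omega> \<in> S) \<longrightarrow> k \<in> measurable F (count_space UNIV) \<longrightarrow>
        (\<lambda>\<omega>. Alg (X \<omega>) (k \<omega>) (H \<omega>) \<omega>) \<in> borel_measurable M \<and>
        (AE \<omega> in M.
           nn_cond_exp M F (\<lambda>\<omega>'. e2ennreal (gap (H \<omega>') (Alg (X \<omega>') (k \<omega>') (H \<omega>') \<omega>'))) \<omega>
           \<le> ennreal (2 powi (- \<lfloor>real (k \<omega>) / k0\<rfloor>)) * e2ennreal (gap (H \<omega>) (X \<omega>))))"

text \<open>An extended-real-valued random variable with a finite expectation, which is then
  \<open>\<integral>\<omega>. real_of_ereal (Y \<omega>) \<partial>M\<close>.\<close>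

definition ereal_integrable :: "'w measure \<Rightarrow> ('w \<Rightarrow> ereal) \<Rightarrow> bool" where
  "ereal_integrable M Y \<longleftrightarrow>
     (AE \<omega> in M. \<bar>Y \<omega>\<bar> \<noteq> \<infinity>) \<and> integrable M (\<lambda>\<omega>. real_of_ereal (Y \<omega>))"

end

theory Submission
  imports Defs
begin

text \<open>Write \<open>G x z = f x + g x + h (p x - z)\<close>. By the two convexity assumptions on \<open>h1\<close>, \<open>p1\<close> and on
\<open>K\<close>, \<open>p2\<close> this perturbation function is jointly convex, and strong duality says that
\<open>G x z + l\<^sup>* \<bullet> z\<close> is bounded below by the optimal value. Moreau duality
(\<open>smoothing_duality\<close>) turns the smoothed function into an infimal convolution, so that the objective
of stage \<open>s\<close> is the partial minimum over \<open>z\<close> of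
\<open>G x z + l \<bullet> z + |z|\<^sup>2 / (2 \<beta>) + \<beta> / 2 * |x - y|\<^sup>2\<close>. With \<open>z = \<beta> (\<mu> - l)\<close> this is a convex function of
\<open>(x, \<mu>)\<close> plus \<open>\<beta> / 2\<close> times a squared distance, the minimising \<open>\<mu>\<close> for given \<open>x\<close> is the multiplier
update, and the minimising pair is the resolvent (proximal point) of the saddle operator at the
current pair \<open>w = (y, l)\<close>. Hence the algorithm is an inexact proximal point method in the
primal-dual space: the resolvent is firmly nonexpansive towards the solution \<open>(x\<^sup>*, l\<^sup>*)\<close>
(\<open>res_fejer\<close>), and a stage with optimality gap \<open>\<delta>\<close> ends within \<open>sqrt (2 \<delta> / \<beta>)\<close> of it
(\<open>step_near_res\<close>).

The quantity \<open>M\<^sub>s\<close> bounds what is lost by changing the centre, the multiplier and the parameter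
between two stages (\<open>next_stage_gap\<close>). The number of inner iterations is chosen so that the
contraction factor turns \<open>2 \<epsilon>\<^sub>s + M\<^sub>s\<close> into \<open>\<epsilon>\<^sub>s\<^sub>+\<^sub>1 / 2\<close>; replacing the
expectation bound \<open>\<epsilon>\<^sub>s\<close> by the random gap costs another \<open>\<epsilon>\<^sub>s\<^sub>+\<^sub>1 / 2\<close> in expectation, so the
expected gaps stay below \<open>\<epsilon>\<^sub>s\<close> (\<open>expected_gap_induction\<close>). The errors \<open>sqrt (2 \<epsilon>\<^sub>s / \<beta>\<^sub>s)\<close> form a
geometric series because \<open>\<eta> < \<rho>\<close>, and the triangle inequality in \<open>L\<^sup>2\<close> keeps all iterates
within a fixed mean square distance of the solution. This controls the expected infeasibility, the
expected objective error and the expectation of \<open>M\<^sub>s\<close>, each by a constant times \<open>\<beta>\<^sub>s\<close>.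

In the iteration bound the part that stems from the growth of the constants \<open>K\<^sub>s\<close> has no factor
\<open>\<rho> powr (- l)\<close>. It is therefore not enough to know that both errors at stage \<open>s\<close> are at most \<open>c1 * \<rho> ^ s\<close>; they
have to be at most \<open>c1 * \<rho> ^ Suc s\<close> (\<open>accuracy\<close>), so that the least sufficient \<open>s\<close> satisfies
\<open>\<rho> ^ s > \<epsilon> / c1\<close>. The additional factor \<open>\<rho>\<close> comes, for the infeasibility, from looking at two
consecutive resolvent steps (\<open>res_two_steps\<close>) and, for the objective, from the strong
convexity of the lifted stage problem (\<open>objective_upper\<close>). The rest is counting: each
\<open>m\<^sub>s\<close> is about \<open>K\<^sub>s\<close> times a binary logarithm, whose expectation is bounded by concavity, and
the constants \<open>K\<^sub>s\<close> grow geometrically (\<open>iteration_count_sum\<close>).\<close>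

section \<open>Strongly convex minimisation without attainment\<close>

lemma norm_sq_convex_combination:
  fixes a a' c :: "'a::real_inner"
  shows "(norm (t *\<^sub>R a + (1 - t) *\<^sub>R a' - c))\<^sup>2
    = t * (norm (a - c))\<^sup>2 + (1 - t) * (norm (a' - c))\<^sup>2 - t * (1 - t) * (norm (a - a'))\<^sup>2"
  by (simp add: power2_norm_eq_inner inner_simps inner_commute algebra_simps)

lemma convex_plus_square_strongly_convex:
  fixes \<phi> :: "'a::real_inner \<Rightarrow> real"
  assumes "convex_on S \<phi>" "a \<in> S" "a' \<in> S" "0 < t" "t < 1"
  shows "\<phi> (t *\<^sub>R a + (1 - t) *\<^sub>R a') + b / 2 * (norm (t *\<^sub>R a + (1 - t) *\<^sub>R a' - c))\<^sup>2
    \<le> t * (\<phi> a + b / 2 * (norm (a - c))\<^sup>2) + (1 - t) * (\<phi> a' + b / 2 * (norm (a' - c))\<^sup>2)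
        - b / 2 * t * (1 - t) * (norm (a - a'))\<^sup>2"
proof -
  have "\<phi> ((1 - t) *\<^sub>R a' + t *\<^sub>R a) \<le> (1 - t) * \<phi> a' + t * \<phi> a"
    using convex_onD[OF assms(1), of t a' a] assms by auto
  then show ?thesis
    unfolding norm_sq_convex_combination
    by (simp add: add.commute algebra_simps add_divide_distrib diff_divide_distrib)
qed

text \<open>A minimising sequence of a strongly convex function is Cauchy, since midpoints cannot fall below
the infimum. Its limit behaves like a minimiser as far as quadratic growth is concerned, although
without lower semicontinuity the function need not attain its infimum there. Working with the limit
and the sequence avoids all closedness questions about \<open>f + g\<close>.\<close>

lemma proximal_limit_point:
  fixes \<phi> :: "'a::{real_inner,complete_space} \<Rightarrow> real" and c :: 'a
  assumes cv: "convex_on S \<phi>" and ne: "S \<noteq> {}" and b: "0 < b"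
    and bd: "\<And>a. a \<in> S \<Longrightarrow> B \<le> \<phi> a + b / 2 * (norm (a - c))\<^sup>2"
  defines "\<Phi> \<equiv> \<lambda>a. \<phi> a + b / 2 * (norm (a - c))\<^sup>2"
  defines "V \<equiv> INF a\<in>S. \<Phi> a"
  obtains z and A :: "nat \<Rightarrow> 'a"
  where "\<And>a. a \<in> S \<Longrightarrow> V + b / 2 * (norm (a - z))\<^sup>2 \<le> \<Phi> a"
    and "\<And>n. A n \<in> S" and "A \<longlonglongrightarrow> z" and "(\<lambda>n. \<Phi> (A n)) \<longlonglongrightarrow> V"
proof -
  have bdd: "bdd_below (\<Phi> ` S)"
    using bd by (auto simp: \<Phi>_def intro!: bdd_belowI)
  have Vle: "V \<le> \<Phi> a" if "a \<in> S" for a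
    unfolding V_def using bdd that by (rule cINF_lower)
  have sc: "V \<le> t * \<Phi> a + (1 - t) * \<Phi> a' - b / 2 * t * (1 - t) * (norm (a - a'))\<^sup>2"
    if "a \<in> S" "a' \<in> S" "0 < t" "t < 1" for a a' t
  proof -
    have "t *\<^sub>R a + (1 - t) *\<^sub>R a' \<in> S"
      using convex_on_imp_convex[OF cv] that by (intro convexD) auto
    then show ?thesis
      using Vle convex_plus_square_strongly_convex[OF cv that, of b c] unfolding \<Phi>_def
      by fastforce
  qed
  have "\<exists>a\<in>S. \<Phi> a < V + 1 / real (Suc n)" for n
    using cINF_less_iff[OF ne bdd, of "V + 1 / real (Suc n)"] unfolding V_def by auto
  then obtain A where A: "\<And>n. A n \<in> S" "\<And>n. \<Phi> (A n) < V + 1 / real (Suc n)"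
    by metis
  have lim: "(\<lambda>n. \<Phi> (A n)) \<longlonglongrightarrow> V"
  proof (rule tendsto_sandwich)
    show "eventually (\<lambda>n. V \<le> \<Phi> (A n)) sequentially" using Vle A by auto
    show "eventually (\<lambda>n. \<Phi> (A n) \<le> V + 1 / real (Suc n)) sequentially"
      using A(2) by (auto simp: less_imp_le)
    show "(\<lambda>n. V + 1 / real (Suc n)) \<longlonglongrightarrow> V"
      using tendsto_add[OF tendsto_const LIMSEQ_inverse_real_of_nat, of V]
      by (simp add: inverse_eq_divide)
  qed simp
  have dist: "(norm (A n - A k))\<^sup>2 \<le> 4 / b * (1 / real (Suc n) + 1 / real (Suc k))" for n k
  proof -
    have "V \<le> 1/2 * \<Phi> (A n) + 1/2 * \<Phi> (A k) - b / 8 * (norm (A n - A k))\<^sup>2"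
      using sc[OF A(1)[of n] A(1)[of k], of "1/2"] by simp
    then have "b / 8 * (norm (A n - A k))\<^sup>2 \<le> 1/2 * (1 / real (Suc n) + 1 / real (Suc k))"
      using A(2)[of n] A(2)[of k] by argo
    then have "8 / b * (b / 8 * (norm (A n - A k))\<^sup>2) \<le> 8 / b * (1/2 * (1 / real (Suc n) + 1 / real (Suc k)))"
      using b by (intro mult_left_mono) auto
    moreover have "8 / b * (b / 8 * X) = X" "8 / b * (1/2 * X) = 4 / b * X" for X
      using b by auto
    ultimately show ?thesis by (simp only:)
  qed
  have "Cauchy A"
  proof (rule metric_CauchyI)
    fix e :: real assume e: "0 < e"
    obtain N where N: "8 / (b * e\<^sup>2) < real N" using reals_Archimedean2 by blast
    have "dist (A m) (A n) < e" if "m \<ge> N" "n \<ge> N" for m n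
    proof -
      have "1 / real (Suc m) \<le> 1 / real (Suc N)" "1 / real (Suc n) \<le> 1 / real (Suc N)"
        using that by (auto simp: frac_le)
      then have "1 / real (Suc m) + 1 / real (Suc n) \<le> 2 / real (Suc N)" by simp
      then have "4 / b * (1 / real (Suc m) + 1 / real (Suc n)) \<le> 4 / b * (2 / real (Suc N))"
        using b by (intro mult_left_mono) auto
      also have "\<dots> < e\<^sup>2"
      proof -
        have "8 / (b * e\<^sup>2) < real (Suc N)" using N by simp
        then have "8 / b / real (Suc N) < e\<^sup>2"
          using b e by (simp add: divide_less_eq mult.commute mult.left_commute)
        then show ?thesis by simp
      qed
      finally have "(norm (A m - A n))\<^sup>2 < e\<^sup>2" using dist[of m n] by linarith
      then show ?thesis using e power_less_imp_less_base[of "norm (A m - A n)" 2 e] by (simp add: dist_norm)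
    qed
    then show "\<exists>M. \<forall>m\<ge>M. \<forall>n\<ge>M. dist (A m) (A n) < e" by blast
  qed
  then obtain z where z: "A \<longlonglongrightarrow> z"
    using Cauchy_convergent_iff convergent_def by blast
  have "V + b / 2 * (norm (a - z))\<^sup>2 \<le> \<Phi> a" if a: "a \<in> S" for a
  proof -
    have *: "V + b / 2 * (1 - t) * (norm (a - z))\<^sup>2 \<le> \<Phi> a" if t: "0 < t" "t < 1" for t
    proof -
      have "(\<lambda>n. t * \<Phi> a + (1 - t) * \<Phi> (A n) - b / 2 * t * (1 - t) * (norm (a - A n))\<^sup>2)
         \<longlonglongrightarrow> t * \<Phi> a + (1 - t) * V - b / 2 * t * (1 - t) * (norm (a - z))\<^sup>2"
        by (intro tendsto_intros lim z)
      then have "V \<le> t * \<Phi> a + (1 - t) * V - b / 2 * t * (1 - t) * (norm (a - z))\<^sup>2"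
        by (rule LIMSEQ_le_const) (use sc[OF a A(1)] t in blast)
      then have "t * (V + b / 2 * (1 - t) * (norm (a - z))\<^sup>2) \<le> t * \<Phi> a"
        by (simp add: algebra_simps)
      then show ?thesis using t by simp
    qed
    have "((\<lambda>t. V + b / 2 * (1 - t) * (norm (a - z))\<^sup>2) \<longlongrightarrow> V + b / 2 * (1 - 0) * (norm (a - z))\<^sup>2) (at_right 0)"
      by (intro tendsto_intros)
    then have "V + b / 2 * (1 - 0) * (norm (a - z))\<^sup>2 \<le> \<Phi> a"
      by (rule tendsto_upperbound)
        (use * in \<open>auto intro!: eventually_at_rightI[of 0 1]\<close>)
    then show ?thesis by simp
  qed
  then show ?thesis using that A(1) z lim by blast
qed

section \<open>Moreau smoothing of the separable outer function\<close>

lemma norm_fst_le_norm: "norm (fst p) \<le> norm p"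
  by (cases p) (simp add: norm_fst_le)

lemma norm_snd_le_norm: "norm (snd p) \<le> norm p"
  by (cases p) (simp add: norm_snd_le)

lemma norm_sq_le_twice: "(norm a)\<^sup>2 \<le> 2 * (norm (a - c))\<^sup>2 + 2 * (norm c)\<^sup>2"
  for a c :: "'a::real_inner"
proof -
  have "2 * (norm (a - c))\<^sup>2 + 2 * (norm c)\<^sup>2 - (norm a)\<^sup>2 = (norm (a - c - c))\<^sup>2"
    by (simp add: power2_norm_eq_inner inner_simps inner_commute field_simps)
  then show ?thesis by (metis diff_ge_0_iff_ge zero_le_power2)
qed

locale separable_outer =
  fixes h1 :: "'d1::euclidean_space \<Rightarrow> real" and K :: "'d2::euclidean_space set" and Lh :: real
  assumes h1_convex: "convex_on UNIV h1" and K_nonempty: "K \<noteq> {}"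
    and K_closed: "closed K" and K_convex: "convex K"
    and h1_lipschitz: "Lh-lipschitz_on UNIV h1"
begin

abbreviation h :: "'d1 \<times> 'd2 \<Rightarrow> ereal" where "h \<equiv> sep_fun h1 K"

abbreviation argm :: "'d1 \<times> 'd2 \<Rightarrow> 'd1 \<times> 'd2 \<Rightarrow> real \<Rightarrow> 'd1 \<times> 'd2" where
  "argm \<equiv> smooth_argmax h"

text \<open>The infimal convolution that represents the smoothed function, with the shift written as
\<open>b *\<^sub>R (v - l)\<close>. In this parametrisation the minimiser is the multiplier that maximises the dual form.\<close>

definition split_val :: "'d1 \<times> 'd2 \<Rightarrow> 'd1 \<times> 'd2 \<Rightarrow> real \<Rightarrow> 'd1 \<times> 'd2 \<Rightarrow> real" where
  "split_val u l b v = h1 (fst (u - b *\<^sub>R (v - l))) + b / 2 * ((norm v)\<^sup>2 - (norm l)\<^sup>2)"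

definition split_dom :: "'d1 \<times> 'd2 \<Rightarrow> 'd1 \<times> 'd2 \<Rightarrow> real \<Rightarrow> ('d1 \<times> 'd2) set" where
  "split_dom u l b = {v. snd (u - b *\<^sub>R (v - l)) \<in> K}"

lemma Lh_nonneg: "0 \<le> Lh"
  using h1_lipschitz by (rule lipschitz_on_nonneg)

lemma h1_diff_le: "h1 a - h1 c \<le> Lh * norm (a - c)"
  using lipschitz_onD[OF h1_lipschitz, of a c] by (auto simp: dist_norm)

lemma h1_continuous: "continuous_on UNIV h1"
  using h1_lipschitz by (rule lipschitz_on_continuous_on)

lemma fenchel_young: "snd u \<in> K \<Longrightarrow> ereal (l \<bullet> u - h1 (fst u)) \<le> fenchel_conj h l"
  unfolding fenchel_conj_def
  by (rule SUP_upper2[of u]) (auto simp: sep_fun_def convex_indicator_def)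

lemma fenchel_conj_leI:
  assumes "\<And>u. snd u \<in> K \<Longrightarrow> l \<bullet> u - h1 (fst u) \<le> c"
  shows "fenchel_conj h l \<le> ereal c"
  unfolding fenchel_conj_def
  using assms by (intro SUP_least) (auto simp: sep_fun_def convex_indicator_def)

lemma fenchel_conj_not_minus_infinity: "fenchel_conj h l \<noteq> - \<infinity>"
proof -
  obtain k where "k \<in> K" using K_nonempty by auto
  then show ?thesis using fenchel_young[of "(0, k)" l] by auto
qed

definition conj_val :: "'d1 \<times> 'd2 \<Rightarrow> real" where "conj_val l = real_of_ereal (fenchel_conj h l)"

lemma fenchel_conj_real: "l \<in> edom (fenchel_conj h) \<Longrightarrow> fenchel_conj h l = ereal (conj_val l)"
  using fenchel_conj_not_minus_infinity[of l]
  by (auto simp: conj_val_def edom_def ereal_real)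

text \<open>Weak duality between the maximisation and the infimal convolution, with the quadratic slack that
completing the square leaves over; the slack yields both uniqueness of the maximiser and strong
concavity.\<close>

lemma smooth_obj_le:
  assumes v: "v \<in> split_dom u l b"
  shows "smooth_obj h u l b w \<le> ereal (split_val u l b v - b / 2 * (norm (w - v))\<^sup>2)"
proof (cases "fenchel_conj h w = \<infinity>")
  case True
  then show ?thesis by (simp add: smooth_obj_def)
next
  case False
  then have fin: "fenchel_conj h w = ereal (conj_val w)"
    by (intro fenchel_conj_real) (simp add: edom_def)
  let ?z = "b *\<^sub>R (v - l)"
  have "w \<bullet> (u - ?z) - h1 (fst (u - ?z)) \<le> conj_val w"
    using fenchel_young[of "u - ?z" w] v unfolding fin split_dom_def by simp
  moreover have "w \<bullet> ?z - b / 2 * (norm (w - l))\<^sup>2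
      = b / 2 * ((norm v)\<^sup>2 - (norm l)\<^sup>2) - b / 2 * (norm (w - v))\<^sup>2"
    by (simp add: power2_norm_eq_inner inner_simps inner_commute field_simps)
  ultimately show ?thesis
    by (simp add: smooth_obj_def fin split_val_def inner_diff_right)
qed

text \<open>Here the infimum is attained, because \<open>h1\<close> is continuous and \<open>K\<close> is closed.\<close>

lemma split_minimiser:
  assumes b: "0 < b"
  obtains v where "v \<in> split_dom u l b"
    and "\<And>w. w \<in> split_dom u l b \<Longrightarrow> split_val u l b v + b / 2 * (norm (w - v))\<^sup>2 \<le> split_val u l b w"
proof -
  let ?S = "split_dom u l b"
  define \<phi> where "\<phi> = (\<lambda>v. h1 (fst (u - b *\<^sub>R (v - l))))"
  let ?\<Phi> = "\<lambda>a. \<phi> a + b / 2 * (norm (a - 0))\<^sup>2"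
  let ?V = "INF a\<in>?S. ?\<Phi> a"
  have conv: "convex ?S"
  proof (rule convexI)
    fix v w :: "'d1 \<times> 'd2" and s t :: real
    assume *: "v \<in> ?S" "w \<in> ?S" "0 \<le> s" "0 \<le> t" "s + t = 1"
    then have t: "t = 1 - s" by simp
    have "snd (u - b *\<^sub>R (s *\<^sub>R v + t *\<^sub>R w - l))
        = s *\<^sub>R snd (u - b *\<^sub>R (v - l)) + t *\<^sub>R snd (u - b *\<^sub>R (w - l))"
      unfolding t by (simp add: algebra_simps)
    then show "s *\<^sub>R v + t *\<^sub>R w \<in> ?S"
      using * convexD[OF K_convex] by (auto simp: split_dom_def)
  qed
  have cv: "convex_on ?S \<phi>"
  proof (rule convex_onI[OF _ conv])
    fix t :: real and v w assume t: "0 < t" "t < 1"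
    have "fst (u - b *\<^sub>R ((1 - t) *\<^sub>R v + t *\<^sub>R w - l))
       = (1 - t) *\<^sub>R fst (u - b *\<^sub>R (v - l)) + t *\<^sub>R fst (u - b *\<^sub>R (w - l))"
      by (simp add: algebra_simps)
    then show "\<phi> ((1 - t) *\<^sub>R v + t *\<^sub>R w) \<le> (1 - t) * \<phi> v + t * \<phi> w"
      unfolding \<phi>_def using convex_onD[OF h1_convex, of t] t by simp
  qed
  obtain k where k: "k \<in> K" using K_nonempty by auto
  have "(0, snd l + (1 / b) *\<^sub>R (snd u - k)) \<in> ?S"
    using b k by (simp add: split_dom_def)
  then have ne: "?S \<noteq> {}" by auto
  have bd: "h1 (fst u) - b * Lh * norm l - b / 2 * Lh\<^sup>2 \<le> ?\<Phi> v" for v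
  proof -
    have "h1 (fst u) - \<phi> v \<le> Lh * norm (fst (b *\<^sub>R (v - l)))"
      unfolding \<phi>_def using h1_diff_le[of "fst u" "fst (u - b *\<^sub>R (v - l))"] by simp
    also have "\<dots> \<le> Lh * (b * (norm v + norm l))"
      using b Lh_nonneg order_trans[OF norm_fst_le_norm norm_triangle_ineq4, of v l]
      by (intro mult_left_mono) auto
    finally have "h1 (fst u) - \<phi> v \<le> b * (Lh * norm v) + b * (Lh * norm l)"
      by (simp add: algebra_simps)
    moreover have "b * (Lh * norm v) \<le> b * (1/2 * Lh\<^sup>2 + 1/2 * (norm v)\<^sup>2)"
      using b sum_squares_bound[of Lh "norm v"] by (intro mult_left_mono) auto
    ultimately show ?thesis by (simp add: algebra_simps)
  qed
  obtain v A where v: "\<And>a. a \<in> ?S \<Longrightarrow> ?V + b / 2 * (norm (a - v))\<^sup>2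
        \<le> ?\<Phi> a"
    and A: "\<And>n. A n \<in> ?S" "A \<longlonglongrightarrow> v"
    "(\<lambda>n. ?\<Phi> (A n)) \<longlonglongrightarrow> ?V"
    by (rule proximal_limit_point[OF cv ne b bd]) (rule that)
  have "continuous_on UNIV (\<lambda>v. snd (u - b *\<^sub>R (v - l)))"
    by (intro continuous_intros)
  then have "closed ((\<lambda>v. snd (u - b *\<^sub>R (v - l))) -` K)"
    using K_closed continuous_closed_vimage continuous_on_eq_continuous_at by blast
  then have "closed ?S" by (simp add: split_dom_def vimage_def)
  then have vS: "v \<in> ?S" using A closed_sequentially by blast
  have "continuous_on UNIV (\<lambda>v. ?\<Phi> v)"
    unfolding \<phi>_def by (intro continuous_intros continuous_on_compose2[OF h1_continuous]) auto
  then have "(\<lambda>n. ?\<Phi> (A n)) \<longlonglongrightarrow> ?\<Phi> v"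
    by (rule continuous_on_tendsto_compose[OF _ A(2)]) auto
  then have eq: "?V = ?\<Phi> v"
    using A(3) LIMSEQ_unique by blast
  show ?thesis
  proof (rule that[OF vS])
    fix w assume "w \<in> ?S"
    from v[OF this] show "split_val u l b v + b / 2 * (norm (w - v))\<^sup>2 \<le> split_val u l b w"
      unfolding eq by (simp add: split_val_def \<phi>_def algebra_simps)
  qed
qed

text \<open>Strong duality. Quadratic growth at the minimiser \<open>v\<close> of the infimal convolution is exactly the
statement that \<open>u - b *\<^sub>R (v - l)\<close> attains the supremum in the conjugate at \<open>v\<close>. So the
conjugate is known at \<open>v\<close>, the weak duality gap closes there, and \<open>v\<close> is the maximiser.\<close>

lemma smoothing_duality:
  assumes b: "0 < b"
  shows argm_split_dom: "argm u l b \<in> split_dom u l b"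
    and smoothed_eq: "smoothed h u l b = ereal (split_val u l b (argm u l b))"
    and argm_edom: "argm u l b \<in> edom (fenchel_conj h)"
    and argm_min: "\<And>w. w \<in> split_dom u l b \<Longrightarrow> 
      split_val u l b (argm u l b) + b / 2 * (norm (w - argm u l b))\<^sup>2 \<le> split_val u l b w"
    and split_val_argm: "split_val u l b (argm u l b)
      = argm u l b \<bullet> u - conj_val (argm u l b) - b / 2 * (norm (argm u l b - l))\<^sup>2"
proof -
  obtain v where v: "v \<in> split_dom u l b"
    and vmin: "\<And>w. w \<in> split_dom u l b \<Longrightarrow> split_val u l b v + b / 2 * (norm (w - v))\<^sup>2 \<le> split_val u l b w"
    using split_minimiser[OF b] by blast
  let ?z = "b *\<^sub>R (v - l)"
  have "fenchel_conj h v \<le> ereal (v \<bullet> (u - ?z) - h1 (fst (u - ?z)))"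
  proof (rule fenchel_conj_leI)
    fix u' :: "'d1 \<times> 'd2" assume u': "snd u' \<in> K"
    define w where "w = l + (1 / b) *\<^sub>R (u - u')"
    have uw: "u' = u - b *\<^sub>R (w - l)" using b by (simp add: w_def)
    then have "w \<in> split_dom u l b" using u' by (simp add: split_dom_def)
    from vmin[OF this]
    have "h1 (fst (u - ?z)) + b / 2 * ((norm v)\<^sup>2 + (norm (w - v))\<^sup>2 - (norm w)\<^sup>2) \<le> h1 (fst u')"
      unfolding split_val_def uw[symmetric] by (simp add: algebra_simps)
    moreover have "b / 2 * ((norm v)\<^sup>2 + (norm (w - v))\<^sup>2 - (norm w)\<^sup>2) = v \<bullet> u' - v \<bullet> (u - ?z)"
      unfolding uw by (simp add: power2_norm_eq_inner inner_simps inner_commute field_simps)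
    ultimately show "v \<bullet> u' - h1 (fst u') \<le> v \<bullet> (u - ?z) - h1 (fst (u - ?z))"
      by argo
  qed
  moreover have "ereal (v \<bullet> (u - ?z) - h1 (fst (u - ?z))) \<le> fenchel_conj h v"
    using fenchel_young[of "u - ?z" v] v by (simp add: split_dom_def)
  ultimately have cj: "fenchel_conj h v = ereal (v \<bullet> (u - ?z) - h1 (fst (u - ?z)))"
    by (rule antisym)
  have "v \<bullet> ?z - b / 2 * (norm (v - l))\<^sup>2 = b / 2 * ((norm v)\<^sup>2 - (norm l)\<^sup>2)"
    by (simp add: power2_norm_eq_inner inner_simps inner_commute field_simps)
  then have objv: "smooth_obj h u l b v = ereal (split_val u l b v)"
    by (simp add: smooth_obj_def cj split_val_def inner_diff_right)
  have le: "smooth_obj h u l b w \<le> ereal (split_val u l b v - b / 2 * (norm (w - v))\<^sup>2)" for w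
    using smooth_obj_le[OF v] .
  have le': "smooth_obj h u l b w \<le> smooth_obj h u l b v" for w
  proof -
    have "ereal (split_val u l b v - b / 2 * (norm (w - v))\<^sup>2) \<le> ereal (split_val u l b v)"
      using b by simp
    with le[of w] show ?thesis unfolding objv by (rule order_trans)
  qed
  have "argm u l b = v"
    unfolding smooth_argmax_def
  proof (rule the_equality)
    fix w assume "\<forall>w'. smooth_obj h u l b w' \<le> smooth_obj h u l b w"
    then have "ereal (split_val u l b v) \<le> smooth_obj h u l b w"
      unfolding objv[symmetric] by blast
    from order_trans[OF this le[of w]] have "b / 2 * (norm (w - v))\<^sup>2 \<le> 0" by simp
    then show "w = v" using b by (simp add: mult_le_0_iff)
  qed (use le' in blast)
  moreover have "smoothed h u l b = smooth_obj h u l b v"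
    unfolding smoothed_def using le' by (intro antisym SUP_least SUP_upper) auto
  moreover have "split_val u l b v = v \<bullet> u - conj_val v - b / 2 * (norm (v - l))\<^sup>2"
    using objv fenchel_conj_real[of v] cj by (simp add: smooth_obj_def edom_def)
  ultimately show "argm u l b \<in> split_dom u l b"
    "smoothed h u l b = ereal (split_val u l b (argm u l b))"
    "argm u l b \<in> edom (fenchel_conj h)"
    "\<And>w. w \<in> split_dom u l b \<Longrightarrow> 
      split_val u l b (argm u l b) + b / 2 * (norm (w - argm u l b))\<^sup>2 \<le> split_val u l b w"
    "split_val u l b (argm u l b)
      = argm u l b \<bullet> u - conj_val (argm u l b) - b / 2 * (norm (argm u l b - l))\<^sup>2"
    using v vmin objv cj by (auto simp: edom_def)
qed

definition smooth_val :: "'d1 \<times> 'd2 \<Rightarrow> 'd1 \<times> 'd2 \<Rightarrow> real \<Rightarrow> real" where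
  "smooth_val u l b = split_val u l b (argm u l b)"

lemma smooth_val_strongly_concave:
  assumes b: "0 < b" and w: "w \<in> edom (fenchel_conj h)"
  shows "w \<bullet> u - conj_val w - b / 2 * (norm (w - l))\<^sup>2 \<le> smooth_val u l b - b / 2 * (norm (w - argm u l b))\<^sup>2"
  using smooth_obj_le[OF argm_split_dom[OF b], of u l w] fenchel_conj_real[OF w]
  by (simp add: smooth_obj_def smooth_val_def)

lemma smooth_val_eq:
  assumes b: "0 < b"
  shows "smooth_val u l b = argm u l b \<bullet> u - conj_val (argm u l b) - b / 2 * (norm (argm u l b - l))\<^sup>2"
  unfolding smooth_val_def by (rule split_val_argm[OF b])

text \<open>Both maximisers are compared by strong concavity in both problems; the unknown conjugates cancel.
This is used for measurability only, through continuity.\<close>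

lemma argm_lipschitz:
  assumes b: "0 < b"
  shows "norm (argm u l b - argm u' l' b) \<le> norm (u - u') / b + norm (l - l')"
proof -
  let ?v = "argm u l b" and ?v' = "argm u' l' b"
  have 1: "?v' \<bullet> u - conj_val ?v' - b / 2 * (norm (?v' - l))\<^sup>2 \<le> smooth_val u l b - b / 2 * (norm (?v' - ?v))\<^sup>2"
    and 2: "?v \<bullet> u' - conj_val ?v - b / 2 * (norm (?v - l'))\<^sup>2 \<le> smooth_val u' l' b - b / 2 * (norm (?v - ?v'))\<^sup>2"
    using smooth_val_strongly_concave[OF b] argm_edom[OF b] by auto
  have nn: "norm (?v' - ?v) = norm (?v - ?v')" by (rule norm_minus_commute)
  have "b / 2 * ((norm (?v' - l))\<^sup>2 - (norm (?v - l))\<^sup>2 + (norm (?v - l'))\<^sup>2 - (norm (?v' - l'))\<^sup>2)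
     = b * ((?v - ?v') \<bullet> (l - l'))"
    by (simp add: power2_norm_eq_inner inner_simps inner_commute field_simps)
  moreover have "?v \<bullet> u - ?v' \<bullet> u + ?v' \<bullet> u' - ?v \<bullet> u' = (?v - ?v') \<bullet> (u - u')"
    by (simp add: inner_simps)
  ultimately have "b * (norm (?v - ?v'))\<^sup>2 \<le> (?v - ?v') \<bullet> (u - u') + b * ((?v - ?v') \<bullet> (l - l'))"
    using 1 2 unfolding smooth_val_eq[OF b] nn by (simp add: algebra_simps)
  also have "\<dots> \<le> norm (?v - ?v') * norm (u - u') + b * (norm (?v - ?v') * norm (l - l'))"
    using b by (intro add_mono mult_left_mono norm_cauchy_schwarz) auto
  finally have "norm (?v - ?v') * (b * norm (?v - ?v')) \<le> norm (?v - ?v') * (norm (u - u') + b * norm (l - l'))"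
    by (simp add: power2_eq_square algebra_simps)
  then have "norm (?v - ?v') = 0 \<or> b * norm (?v - ?v') \<le> norm (u - u') + b * norm (l - l')"
    by (cases "norm (?v - ?v') = 0") (simp_all add: mult_le_cancel_left_pos)
  then show ?thesis
  proof
    assume "b * norm (?v - ?v') \<le> norm (u - u') + b * norm (l - l')"
    then show ?thesis using b by (simp add: field_simps)
  qed (use b in simp)
qed

lemma continuous_argm:
  assumes b: "0 < b"
  shows "continuous_on UNIV (\<lambda>p. argm (fst p) (snd p) b)"
proof (rule lipschitz_on_continuous_on, rule lipschitz_onI)
  fix p q :: "('d1 \<times> 'd2) \<times> 'd1 \<times> 'd2"
  have "dist (argm (fst p) (snd p) b) (argm (fst q) (snd q) b)
     \<le> norm (fst (p - q)) / b + norm (snd (p - q))"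
    using argm_lipschitz[OF b, of "fst p" "snd p" "fst q" "snd q"] by (simp add: dist_norm)
  also have "\<dots> \<le> norm (p - q) / b + norm (p - q)"
    using b by (intro add_mono divide_right_mono norm_fst_le_norm norm_snd_le_norm less_imp_le)
  finally show "dist (argm (fst p) (snd p) b) (argm (fst q) (snd q) b) \<le> (1 / b + 1) * dist p q"
    by (simp add: dist_norm algebra_simps)
qed (use b in auto)

lemma continuous_smooth_val:
  assumes b: "0 < b"
  shows "continuous_on UNIV (\<lambda>p. smooth_val (fst p) (snd p) b)"
  unfolding smooth_val_def split_val_def
  by (intro continuous_intros continuous_on_compose2[OF h1_continuous] continuous_argm[OF b]) auto

text \<open>Monotonicity of the subdifferential of the conjugate, in the form of two strong concavity
inequalities: repeating the multiplier update from the new multiplier with parameter \<open>b'\<close> moves it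
by at most \<open>b / b'\<close> times the first step.\<close>

lemma argm_step_le:
  fixes u l :: "'d1 \<times> 'd2" and b b' :: real
  assumes b: "0 < b" "0 < b'"
  defines "l' \<equiv> argm u l b"
  shows "b' * norm (argm u l' b' - l') \<le> b * norm (l' - l)"
proof -
  let ?v = "argm u l' b'" and ?q = "norm (argm u l' b' - l')"
  have 1: "?v \<bullet> u - conj_val ?v - b / 2 * (norm (?v - l))\<^sup>2 \<le> smooth_val u l b - b / 2 * ?q\<^sup>2"
    using smooth_val_strongly_concave[OF b(1) argm_edom[OF b(2)]] unfolding l'_def .
  have "l' \<bullet> u - conj_val l' - b' / 2 * (norm (l' - l'))\<^sup>2 \<le> smooth_val u l' b' - b' / 2 * (norm (l' - ?v))\<^sup>2"
    using smooth_val_strongly_concave[OF b(2), of l' u l'] argm_edom[OF b(1)] by (simp add: l'_def)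
  then have 2: "l' \<bullet> u - conj_val l' \<le> smooth_val u l' b' - b' / 2 * ?q\<^sup>2"
    by (simp add: norm_minus_commute)
  have 3: "smooth_val u l b = l' \<bullet> u - conj_val l' - b / 2 * (norm (l' - l))\<^sup>2"
    "smooth_val u l' b' = ?v \<bullet> u - conj_val ?v - b' / 2 * ?q\<^sup>2"
    unfolding l'_def by (rule smooth_val_eq, fact)+
  have "b / 2 * (norm (?v - l))\<^sup>2 = b / 2 * (norm (l' - l))\<^sup>2 + b / 2 * ?q\<^sup>2 + b * ((l' - l) \<bullet> (?v - l'))"
    by (simp add: power2_norm_eq_inner inner_simps inner_commute field_simps)
  then have "b' * ?q\<^sup>2 \<le> b * ((l' - l) \<bullet> (?v - l'))"
    using 1 2 3 by argo
  also have "\<dots> \<le> b * (norm (l' - l) * ?q)"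
    using b by (intro mult_left_mono norm_cauchy_schwarz) auto
  finally have "?q * (b' * ?q) \<le> ?q * (b * norm (l' - l))"
    by (simp add: power2_eq_square algebra_simps)
  then have "?q = 0 \<or> b' * ?q \<le> b * norm (l' - l)"
    by (cases "?q = 0") (simp_all only: mult_le_cancel_left_pos zero_less_norm_iff norm_eq_zero simp_thms)
  then show ?thesis using b by auto
qed

text \<open>The change of the smoothed function at a fixed point accounts for the first two terms of \<open>M\<^sub>s\<close>.\<close>

lemma smooth_val_update_le:
  fixes u l :: "'d1 \<times> 'd2" and b b' :: real
  assumes b: "0 < b" "0 < b'"
  defines "l' \<equiv> argm u l b"
  shows "smooth_val u l' b' \<le> smooth_val u l b + b * (norm (l' - l))\<^sup>2
           + (b - b') / 2 * (norm (argm u l' b' - l'))\<^sup>2"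
proof -
  let ?v = "argm u l' b'"
  have 1: "?v \<bullet> u - conj_val ?v - b / 2 * (norm (?v - l))\<^sup>2 \<le> smooth_val u l b - b / 2 * (norm (?v - l'))\<^sup>2"
    using smooth_val_strongly_concave[OF b(1) argm_edom[OF b(2)]] unfolding l'_def .
  have 2: "smooth_val u l' b' = ?v \<bullet> u - conj_val ?v - b' / 2 * (norm (?v - l'))\<^sup>2"
    by (rule smooth_val_eq, fact)
  have "(norm (?v - l))\<^sup>2 \<le> 2 * (norm (?v - l'))\<^sup>2 + 2 * (norm (l' - l))\<^sup>2"
    using norm_sq_le_twice[of "?v - l" "l' - l"] by simp
  then have "b / 2 * (norm (?v - l))\<^sup>2 \<le> b / 2 * (2 * (norm (?v - l'))\<^sup>2 + 2 * (norm (l' - l))\<^sup>2)"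
    using b by (intro mult_left_mono) auto
  then show ?thesis using 1 2 by (simp add: algebra_simps diff_divide_distrib) 
qed

end

section \<open>The inexact proximal point step\<close>

text \<open>The deterministic problem with the extended real parts removed: \<open>A\<close> is the domain of \<open>g\<close> and
\<open>q\<close> the real function \<open>f + g\<close> on it. The assumption \<open>saddle\<close> is what strong duality says about the
dual solution \<open>ls\<close>, with the conjugate eliminated.\<close>

locale composite_saddle = separable_outer h1 K Lh
  for h1 :: "'d1::euclidean_space \<Rightarrow> real" and K :: "'d2::euclidean_space set" and Lh :: real +
  fixes A :: "'n::euclidean_space set" and q :: "'n \<Rightarrow> real"
    and p1 :: "'n \<Rightarrow> 'd1" and p2 :: "'n \<Rightarrow> 'd2" and xs :: 'n and ls :: "'d1 \<times> 'd2"
  assumes q_convex: "convex_on A q"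
    and p1_convex: "\<And>x y u v t. 0 < t \<Longrightarrow> t < 1 \<Longrightarrow>
           h1 (p1 (t *\<^sub>R x + (1 - t) *\<^sub>R y) - t *\<^sub>R u - (1 - t) *\<^sub>R v)
           \<le> t * h1 (p1 x - u) + (1 - t) * h1 (p1 y - v)"
    and p2_convex: "\<And>x y u v t. 0 < t \<Longrightarrow> t < 1 \<Longrightarrow> p2 x - u \<in> K \<Longrightarrow> p2 y - v \<in> K \<Longrightarrow>
           p2 (t *\<^sub>R x + (1 - t) *\<^sub>R y) - t *\<^sub>R u - (1 - t) *\<^sub>R v \<in> K"
    and xs_in: "xs \<in> A" and xs_feasible: "p2 xs \<in> K"
    and saddle: "\<And>x z. x \<in> A \<Longrightarrow> p2 x - snd z \<in> K \<Longrightarrow>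
           q xs + h1 (p1 xs) \<le> q x + h1 (p1 x - fst z) + ls \<bullet> z"
begin

definition p :: "'n \<Rightarrow> 'd1 \<times> 'd2" where "p x = (p1 x, p2 x)"

definition Fs :: real where "Fs = q xs + h1 (p1 xs)"

definition ws :: "'n \<times> 'd1 \<times> 'd2" where "ws = (xs, ls)"

text \<open>A stage is lifted to the pairs \<open>(x, \<mu>)\<close> in which \<open>\<mu>\<close> is a candidate for the new multiplier;
\<open>w = (y, l)\<close> is the proximal centre.\<close>

definition stage_dom :: "real \<Rightarrow> 'n \<times> 'd1 \<times> 'd2 \<Rightarrow> ('n \<times> 'd1 \<times> 'd2) set" where
  "stage_dom b w = {a. fst a \<in> A \<and> snd a \<in> split_dom (p (fst a)) (snd w) b}"

definition lift :: "real \<Rightarrow> 'n \<times> 'd1 \<times> 'd2 \<Rightarrow> 'n \<times> 'd1 \<times> 'd2 \<Rightarrow> real" where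
  "lift b w a = q (fst a) + split_val (p (fst a)) (snd w) b (snd a) + b / 2 * (norm (fst a - fst w))\<^sup>2"

definition opt :: "real \<Rightarrow> 'n \<times> 'd1 \<times> 'd2 \<Rightarrow> real" where
  "opt b w = (INF a\<in>stage_dom b w. lift b w a)"

lemma norm_prod_sq: "(norm a)\<^sup>2 = (norm (fst a))\<^sup>2 + (norm (snd a))\<^sup>2"
  for a :: "'a::real_inner \<times> 'b::real_inner"
  by (simp add: norm_prod_def)

lemma stage_dom_xs: "(xs, l) \<in> stage_dom b (y, l)"
  by (simp add: stage_dom_def split_dom_def p_def xs_in xs_feasible)

lemma lift_xs: "lift b (y, l) (xs, l) = Fs + b / 2 * (norm (xs - y))\<^sup>2"
  by (simp add: lift_def split_val_def p_def Fs_def)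

text \<open>The saddle inequality at \<open>z = b *\<^sub>R (\<mu> - l)\<close>, where the linear term is rewritten as a difference of
squared distances to \<open>ls\<close>.\<close>

lemma lift_lower:
  assumes "a \<in> stage_dom b w"
  shows "Fs + b / 2 * (norm (snd a - ls))\<^sup>2 - b / 2 * (norm (snd w - ls))\<^sup>2
           + b / 2 * (norm (fst a - fst w))\<^sup>2 \<le> lift b w a"
proof -
  let ?z = "b *\<^sub>R (snd a - snd w)"
  have "Fs \<le> q (fst a) + h1 (p1 (fst a) - fst ?z) + ls \<bullet> ?z"
    using saddle[of "fst a" ?z] assms unfolding stage_dom_def split_dom_def p_def Fs_def
    by (simp add: snd_diff snd_scaleR del: inner_scaleR_right)
  moreover have "ls \<bullet> ?z = b / 2 * ((norm (snd a))\<^sup>2 - (norm (snd w))\<^sup>2)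
      - b / 2 * (norm (snd a - ls))\<^sup>2 + b / 2 * (norm (snd w - ls))\<^sup>2"
    by (simp add: power2_norm_eq_inner inner_simps inner_commute field_simps)
  ultimately show ?thesis
    unfolding lift_def split_val_def p_def fst_diff fst_conv by argo
qed

text \<open>The resolvent of the saddle operator, described by quadratic growth around it and by a minimising
sequence that converges to it.\<close>

definition is_res :: "real \<Rightarrow> 'n \<times> 'd1 \<times> 'd2 \<Rightarrow> 'n \<times> 'd1 \<times> 'd2 \<Rightarrow> bool" where
  "is_res b w r \<longleftrightarrow> (\<forall>a\<in>stage_dom b w. opt b w + b / 2 * (norm (a - r))\<^sup>2 \<le> lift b w a)
     \<and> (\<exists>S. (\<forall>n. S n \<in> stage_dom b w) \<and> S \<longlonglongrightarrow> r \<and> (\<lambda>n. lift b w (S n)) \<longlonglongrightarrow> opt b w)"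

definition res :: "real \<Rightarrow> 'n \<times> 'd1 \<times> 'd2 \<Rightarrow> 'n \<times> 'd1 \<times> 'd2" where
  "res b w = (SOME r. is_res b w r)"

lemma stage_convex: 
  "convex_on (stage_dom b w) (\<lambda>a. q (fst a) + h1 (fst (p (fst a) - b *\<^sub>R (snd a - snd w))))"
proof -
  let ?S = "stage_dom b w"
  have split: "b *\<^sub>R ((1 - t) *\<^sub>R snd a + t *\<^sub>R snd a' - snd w)
      = t *\<^sub>R (b *\<^sub>R (snd a' - snd w)) + (1 - t) *\<^sub>R (b *\<^sub>R (snd a - snd w))" for t and a a' :: "'n \<times> 'd1 \<times> 'd2"
    by (simp add: algebra_simps)
  have A: "convex A" using q_convex by (rule convex_on_imp_convex)
  have conv: "convex ?S"
  proof (rule convexI)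
    fix a a' :: "'n \<times> 'd1 \<times> 'd2" and s t :: real
    assume *: "a \<in> ?S" "a' \<in> ?S" "0 \<le> s" "0 \<le> t" "s + t = 1"
    then have s: "s = 1 - t" by simp
    show "s *\<^sub>R a + t *\<^sub>R a' \<in> ?S"
    proof (cases "t = 0 \<or> t = 1")
      case True
      then show ?thesis using * s by auto
    next
      case False
      then have t: "0 < t" "t < 1" using * by auto
      have m: "p2 (fst a') - snd (b *\<^sub>R (snd a' - snd w)) \<in> K" "p2 (fst a) - snd (b *\<^sub>R (snd a - snd w)) \<in> K"
        "fst a \<in> A" "fst a' \<in> A"
        using * by (auto simp: stage_dom_def split_dom_def p_def)
      have "p2 (t *\<^sub>R fst a' + (1 - t) *\<^sub>R fst a) - snd (b *\<^sub>R ((1 - t) *\<^sub>R snd a + t *\<^sub>R snd a' - snd w)) \<in> K"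
        using p2_convex[OF t m(1,2)] unfolding split by (simp add: algebra_simps)
      moreover have "s *\<^sub>R fst a + t *\<^sub>R fst a' \<in> A"
        using A m * by (simp add: convexD)
      ultimately show ?thesis
        unfolding stage_dom_def split_dom_def p_def s by (simp add: add.commute)
    qed
  qed
  show ?thesis
  proof (rule convex_onI[OF _ conv])
    fix t :: real and a a' assume t: "0 < t" "t < 1" and a: "a \<in> ?S" "a' \<in> ?S"
    have "q ((1 - t) *\<^sub>R fst a + t *\<^sub>R fst a') \<le> (1 - t) * q (fst a) + t * q (fst a')"
      using convex_onD[OF q_convex, of t "fst a" "fst a'"] a t by (auto simp: stage_dom_def)
    moreover have "h1 (p1 ((1 - t) *\<^sub>R fst a + t *\<^sub>R fst a') - fst (b *\<^sub>R ((1 - t) *\<^sub>R snd a + t *\<^sub>R snd a' - snd w)))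
      \<le> t * h1 (p1 (fst a') - fst (b *\<^sub>R (snd a' - snd w))) + (1 - t) * h1 (p1 (fst a) - fst (b *\<^sub>R (snd a - snd w)))"
      using p1_convex[OF t, of "fst a'" "fst a" "fst (b *\<^sub>R (snd a' - snd w))" "fst (b *\<^sub>R (snd a - snd w))"]
      unfolding split fst_add fst_scaleR by (simp add: add.commute algebra_simps)
    ultimately show "q (fst ((1 - t) *\<^sub>R a + t *\<^sub>R a')) 
        + h1 (fst (p (fst ((1 - t) *\<^sub>R a + t *\<^sub>R a')) - b *\<^sub>R (snd ((1 - t) *\<^sub>R a + t *\<^sub>R a') - snd w)))
      \<le> (1 - t) * (q (fst a) + h1 (fst (p (fst a) - b *\<^sub>R (snd a - snd w))))
         + t * (q (fst a') + h1 (fst (p (fst a') - b *\<^sub>R (snd a' - snd w))))"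
      unfolding p_def fst_add snd_add fst_scaleR snd_scaleR fst_diff fst_conv by (simp add: distrib_left)
  qed
qed

text \<open>Up to a constant the lifted objective is a convex function plus \<open>b / 2\<close> times the squared distance
to \<open>(y, 0)\<close>, which is why \<open>proximal_limit_point\<close> applies in the variables \<open>(x, \<mu>)\<close>.\<close>

lemma lift_as_square: "lift b w a = (q (fst a) + h1 (fst (p (fst a) - b *\<^sub>R (snd a - snd w))))
    + b / 2 * (norm (a - (fst w, 0)))\<^sup>2 - b / 2 * (norm (snd w))\<^sup>2"
  unfolding lift_def split_val_def norm_prod_sq[of "a - (fst w, 0)"] by (simp add: algebra_simps)

lemma bdd_below_lift:
  assumes "0 < b"
  shows "bdd_below (lift b w ` stage_dom b w)"
proof (rule bdd_belowI)
  fix v assume "v \<in> lift b w ` stage_dom b w"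
  then obtain a where a: "a \<in> stage_dom b w" "v = lift b w a" by auto
  have "0 \<le> b / 2 * (norm (snd a - ls))\<^sup>2 + b / 2 * (norm (fst a - fst w))\<^sup>2"
    using assms by simp
  then show "Fs - b / 2 * (norm (snd w - ls))\<^sup>2 \<le> v"
    using lift_lower[OF a(1)] unfolding a(2) by linarith
qed

lemma opt_le: "0 < b \<Longrightarrow> a \<in> stage_dom b w \<Longrightarrow> opt b w \<le> lift b w a"
  unfolding opt_def by (rule cINF_lower[OF bdd_below_lift])

lemma stage_dom_nonempty: "stage_dom b w \<noteq> {}"
  using stage_dom_xs[of "snd w" b "fst w"] by auto

lemma is_res:
  assumes b: "0 < b"
  shows "is_res b w (res b w)"
proof -
  let ?S = "stage_dom b w" and ?c = "(fst w, 0) :: 'n \<times> 'd1 \<times> 'd2"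
  define \<phi> where "\<phi> = (\<lambda>a. q (fst a) + h1 (fst (p (fst a) - b *\<^sub>R (snd a - snd w))))"
  let ?\<Phi> = "\<lambda>a. \<phi> a + b / 2 * (norm (a - ?c))\<^sup>2"
  let ?V = "INF a\<in>?S. ?\<Phi> a" and ?k = "b / 2 * (norm (snd w))\<^sup>2"
  have lift: "?\<Phi> a = lift b w a + ?k" for a
    using lift_as_square[of b w a] unfolding \<phi>_def by simp
  have opt: "?V = opt b w + ?k"
  proof (rule antisym)
    have le: "opt b w + ?k \<le> lift b w a + ?k" if "a \<in> ?S" for a
      using opt_le[OF b that] by simp
    then have bdd: "bdd_below ((\<lambda>a. lift b w a + ?k) ` ?S)"
      by (intro bdd_belowI) blast
    show "opt b w + ?k \<le> ?V"
      unfolding lift by (intro cINF_greatest stage_dom_nonempty le)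
    have "(INF a\<in>?S. lift b w a + ?k) - ?k \<le> opt b w"
      unfolding opt_def using cINF_lower[OF bdd]
      by (intro cINF_greatest stage_dom_nonempty) (simp add: diff_le_eq)
    then show "?V \<le> opt b w + ?k"
      unfolding lift by simp
  qed
  have bd: "opt b w + ?k \<le> ?\<Phi> a" if "a \<in> ?S" for a
    unfolding lift using opt_le[OF b that] by simp
  obtain r S where r: "\<And>a. a \<in> ?S \<Longrightarrow> ?V + b / 2 * (norm (a - r))\<^sup>2
        \<le> ?\<Phi> a"
    and S: "\<And>n. S n \<in> ?S" "S \<longlonglongrightarrow> r"
    "(\<lambda>n. ?\<Phi> (S n)) \<longlonglongrightarrow> ?V"
    by (rule proximal_limit_point[OF stage_convex[of b w, folded \<phi>_def] stage_dom_nonempty b bd, where thesis = thesis])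
      (assumption, rule that)
  have "(\<lambda>n. lift b w (S n) + ?k - ?k)
      \<longlonglongrightarrow> opt b w + ?k - ?k"
    using S(3)[unfolded opt, unfolded lift] by (intro tendsto_diff tendsto_const)
  then have "(\<lambda>n. lift b w (S n)) \<longlonglongrightarrow> opt b w" by simp
  moreover have "opt b w + b / 2 * (norm (a - r))\<^sup>2 \<le> lift b w a" if "a \<in> ?S" for a
    using r[OF that, unfolded opt, unfolded lift] by simp
  ultimately have "is_res b w r"
    unfolding is_res_def using S by blast
  then show ?thesis unfolding res_def by (rule someI)
qed

lemma res_growth:
  "0 < b \<Longrightarrow> a \<in> stage_dom b w \<Longrightarrow> opt b w + b / 2 * (norm (a - res b w))\<^sup>2 \<le> lift b w a"
  using is_res[of b w] by (simp add: is_res_def)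

lemma res_approx:
  assumes "0 < b"
  obtains S where "\<And>n. S n \<in> stage_dom b w" "S \<longlonglongrightarrow> res b w" "(\<lambda>n. lift b w (S n)) \<longlonglongrightarrow> opt b w"
  using is_res[OF assms, of w] by (auto simp: is_res_def)

lemma opt_lower:
  assumes b: "0 < b"
  shows "Fs + b / 2 * (norm (snd (res b w) - ls))\<^sup>2 - b / 2 * (norm (snd w - ls))\<^sup>2
           + b / 2 * (norm (fst (res b w) - fst w))\<^sup>2 \<le> opt b w"
proof -
  obtain S where S: "\<And>n. S n \<in> stage_dom b w" "S \<longlonglongrightarrow> res b w" "(\<lambda>n. lift b w (S n)) \<longlonglongrightarrow> opt b w"
    by (rule res_approx[OF b]) (rule that)
  have "(\<lambda>n. Fs + b / 2 * (norm (snd (S n) - ls))\<^sup>2 - b / 2 * (norm (snd w - ls))\<^sup>2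
           + b / 2 * (norm (fst (S n) - fst w))\<^sup>2) \<longlonglongrightarrow> Fs + b / 2 * (norm (snd (res b w) - ls))\<^sup>2 - b / 2 * (norm (snd w - ls))\<^sup>2
           + b / 2 * (norm (fst (res b w) - fst w))\<^sup>2"
    by (intro tendsto_intros S)
  then show ?thesis
    by (rule LIMSEQ_le[OF _ S(3)]) (use lift_lower[OF S(1)] in blast)
qed

lemma opt_upper:
  assumes b: "0 < b"
  shows "opt b w + b / 2 * (norm (xs - fst (res b w)))\<^sup>2 + b / 2 * (norm (snd w - snd (res b w)))\<^sup>2
    \<le> Fs + b / 2 * (norm (xs - fst w))\<^sup>2"
  using res_growth[OF b stage_dom_xs, of "fst w" "snd w"]
  unfolding lift_xs norm_prod_sq[of "(xs, snd w) - res b (fst w, snd w)"]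
  by (simp add: distrib_left)

text \<open>The growth inequality at the solution \<open>(xs, l)\<close>, whose lifted value is known exactly, is combined with
the lower bound that the saddle inequality gives for the optimal value.\<close>

lemma res_fejer:
  assumes b: "0 < b"
  shows "(norm (res b w - ws))\<^sup>2 + (norm (w - res b w))\<^sup>2 \<le> (norm (w - ws))\<^sup>2"
proof -
  have "b / 2 * ((norm (res b w - ws))\<^sup>2 + (norm (w - res b w))\<^sup>2) \<le> b / 2 * (norm (w - ws))\<^sup>2"
    unfolding norm_prod_sq[of "res b w - ws"] norm_prod_sq[of "w - res b w"] norm_prod_sq[of "w - ws"]
    using opt_upper[OF b, of w] opt_lower[OF b, of w]
    by (simp add: ws_def distrib_left norm_minus_commute)
  then show ?thesis using b by (simp only: mult_le_cancel_left_pos half_gt_zero_iff)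
qed

text \<open>The vectors \<open>b *\<^sub>R (w - res b w)\<close> are values of a monotone operator at \<open>res b w\<close>. Since the resolvent need
not belong to the domain, the minimising sequence of one stage is inserted into the growth inequality
of the other one. The map \<open>T\<close> transports a point between the two stages in such a way that the
perturbation \<open>z\<close> stays the same, hence the two lifted values differ by an explicit quadratic.\<close>

lemma res_monotone:
  fixes w1 w2 :: "'n \<times> 'd1 \<times> 'd2"
  assumes b1: "0 < b1" and b2: "0 < b2"
  defines "r1 \<equiv> res b1 w1" and "r2 \<equiv> res b2 w2"
  shows "0 \<le> (b1 *\<^sub>R (w1 - r1) - b2 *\<^sub>R (w2 - r2)) \<bullet> (r1 - r2)"
proof -
  define T where "T b w b' w' a = (fst a, snd w + (b' / b) *\<^sub>R (snd a - snd w'))"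
    for b b' and w w' a :: "'n \<times> 'd1 \<times> 'd2"
  define Q where "Q b w b' w' a = b / 2 * ((norm (snd (T b w b' w' a)))\<^sup>2 - (norm (snd w))\<^sup>2)
      - b' / 2 * ((norm (snd a))\<^sup>2 - (norm (snd w'))\<^sup>2)
      + b / 2 * (norm (fst a - fst w))\<^sup>2 - b' / 2 * (norm (fst a - fst w'))\<^sup>2"
    for b b' w w' a
  have *: "opt b w + b / 2 * (norm (T b w b' w' (res b' w') - res b w))\<^sup>2 \<le> opt b' w' + Q b w b' w' (res b' w')"
    if b: "0 < b" "0 < b'" for b b' w w'
  proof -
    obtain S where S: "\<And>n. S n \<in> stage_dom b' w'" "S \<longlonglongrightarrow> res b' w'" "(\<lambda>n. lift b' w' (S n)) \<longlonglongrightarrow> opt b' w'"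
      by (rule res_approx[OF b(2)]) (rule that)
    have le: "opt b w + b / 2 * (norm (T b w b' w' a - res b w))\<^sup>2 \<le> lift b' w' a + Q b w b' w' a"
      if a: "a \<in> stage_dom b' w'" for a
    proof -
      have z: "b *\<^sub>R (snd (T b w b' w' a) - snd w) = b' *\<^sub>R (snd a - snd w')"
        using b by (simp add: T_def)
      have f: "fst (T b w b' w' a) = fst a" by (simp add: T_def)
      have "T b w b' w' a \<in> stage_dom b w"
        using a unfolding stage_dom_def split_dom_def mem_Collect_eq z f .
      from res_growth[OF b(1) this] show ?thesis
        unfolding lift_def split_val_def z f Q_def by argo
    qed
    have "(\<lambda>n. opt b w + b / 2 * (norm (T b w b' w' (S n) - res b w))\<^sup>2)
      \<longlonglongrightarrow> opt b w + b / 2 * (norm (T b w b' w' (res b' w') - res b w))\<^sup>2"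
      unfolding T_def by (intro tendsto_intros S)
    moreover have "(\<lambda>n. lift b' w' (S n) + Q b w b' w' (S n)) \<longlonglongrightarrow> opt b' w' + Q b w b' w' (res b' w')"
      unfolding Q_def T_def by (intro tendsto_intros S)
    ultimately show ?thesis
      by (rule LIMSEQ_le) (use le[OF S(1)] in blast)
  qed
  have "b1 / 2 * (norm (T b1 w1 b2 w2 r2 - r1))\<^sup>2 + b2 / 2 * (norm (T b2 w2 b1 w1 r1 - r2))\<^sup>2
      \<le> Q b1 w1 b2 w2 r2 + Q b2 w2 b1 w1 r1"
    using *[OF b1 b2, of w1 w2] *[OF b2 b1, of w2 w1] unfolding r1_def r2_def by linarith
  moreover have "Q b1 w1 b2 w2 r2 + Q b2 w2 b1 w1 r1
      - (b1 / 2 * (norm (T b1 w1 b2 w2 r2 - r1))\<^sup>2 + b2 / 2 * (norm (T b2 w2 b1 w1 r1 - r2))\<^sup>2)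
     = (b1 *\<^sub>R (w1 - r1) - b2 *\<^sub>R (w2 - r2)) \<bullet> (r1 - r2)"
  proof -
    define l1 l2 m1 m2 where "l1 = snd w1" and "l2 = snd w2" and "m1 = snd r1" and "m2 = snd r2"
    define y1 y2 x1 x2 where "y1 = fst w1" and "y2 = fst w2" and "x1 = fst r1" and "x2 = fst r2"
    note D = l1_def l2_def m1_def m2_def y1_def y2_def x1_def x2_def
    have Ml: "b1 / 2 * ((norm (l1 + (b2 / b1) *\<^sub>R (m2 - l2)))\<^sup>2 - (norm l1)\<^sup>2) - b2 / 2 * ((norm m2)\<^sup>2 - (norm l2)\<^sup>2)
       + (b2 / 2 * ((norm (l2 + (b1 / b2) *\<^sub>R (m1 - l1)))\<^sup>2 - (norm l2)\<^sup>2) - b1 / 2 * ((norm m1)\<^sup>2 - (norm l1)\<^sup>2))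
       - b1 / 2 * (norm (l1 + (b2 / b1) *\<^sub>R (m2 - l2) - m1))\<^sup>2 - b2 / 2 * (norm (l2 + (b1 / b2) *\<^sub>R (m1 - l1) - m2))\<^sup>2
       = (b1 *\<^sub>R (l1 - m1) - b2 *\<^sub>R (l2 - m2)) \<bullet> (m1 - m2)"
      using b1 b2 by (simp add: power2_norm_eq_inner inner_simps inner_commute field_simps)
    have Mx: "b1 / 2 * (norm (x2 - y1))\<^sup>2 - b2 / 2 * (norm (x2 - y2))\<^sup>2
       + (b2 / 2 * (norm (x1 - y2))\<^sup>2 - b1 / 2 * (norm (x1 - y1))\<^sup>2)
       - b1 / 2 * (norm (x2 - x1))\<^sup>2 - b2 / 2 * (norm (x1 - x2))\<^sup>2
       = (b1 *\<^sub>R (y1 - x1) - b2 *\<^sub>R (y2 - x2)) \<bullet> (x1 - x2)"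
      by (simp add: power2_norm_eq_inner inner_simps inner_commute field_simps)
    have "(b1 *\<^sub>R (w1 - r1) - b2 *\<^sub>R (w2 - r2)) \<bullet> (r1 - r2)
      = (b1 *\<^sub>R (y1 - x1) - b2 *\<^sub>R (y2 - x2)) \<bullet> (x1 - x2) + (b1 *\<^sub>R (l1 - m1) - b2 *\<^sub>R (l2 - m2)) \<bullet> (m1 - m2)"
      by (simp add: inner_prod_def D)
    moreover have "(norm (T b1 w1 b2 w2 r2 - r1))\<^sup>2 = (norm (x2 - x1))\<^sup>2 + (norm (l1 + (b2 / b1) *\<^sub>R (m2 - l2) - m1))\<^sup>2"
      "(norm (T b2 w2 b1 w1 r1 - r2))\<^sup>2 = (norm (x1 - x2))\<^sup>2 + (norm (l2 + (b1 / b2) *\<^sub>R (m1 - l1) - m2))\<^sup>2"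
      using norm_prod_sq[of "T b1 w1 b2 w2 r2 - r1"] norm_prod_sq[of "T b2 w2 b1 w1 r1 - r2"]
      by (simp_all add: T_def D)
    ultimately show ?thesis
      unfolding Ml[symmetric] Mx[symmetric] Q_def by (simp add: T_def D distrib_left)
  qed
  ultimately show ?thesis by linarith
qed

text \<open>For two exact steps, with \<open>y\<close> the operator value of the second one, monotonicity bounds the inner product of
\<open>y\<close> with the first step from below by \<open>y \<bullet> y / b\<close>; so \<open>w - ws\<close> has a component of size
\<open>|y| (1 / b + 1 / b')\<close> along \<open>y\<close>. An inexact starting point \<open>w'\<close> of the second step
contributes its error only once, because \<open>w - res b' w\<close> is a nonexpansive function of \<open>w\<close>.\<close>

lemma res_two_steps:
  assumes b: "0 < b" "0 < b'"
  shows "norm (w' - res b' w') \<le> norm (w - ws) / (1 + b' / b) + norm (w' - res b w)"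
proof -
  let ?r = "res b w"
  let ?r2 = "res b' ?r"
  have first: "norm (?r - ?r2) \<le> norm (w - ws) / (1 + b' / b)"
  proof -
    define y where "y = b' *\<^sub>R (?r - ?r2)"
    have ry: "?r - ?r2 = (1 / b') *\<^sub>R y" using b by (simp add: y_def)
    have "0 \<le> (b *\<^sub>R (w - ?r) - y) \<bullet> (?r - ?r2)"
      unfolding y_def by (rule res_monotone[OF b])
    then have "0 \<le> (1 / b') * ((b *\<^sub>R (w - ?r) - y) \<bullet> y)"
      unfolding ry by simp
    then have "y \<bullet> y \<le> b * ((w - ?r) \<bullet> y)"
      using b by (simp add: zero_le_mult_iff zero_le_divide_iff inner_diff_left)
    then have 1: "y \<bullet> y / b \<le> (w - ?r) \<bullet> y" using b by (simp add: field_simps)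
    have "2 * ((?r - ?r2) \<bullet> (?r2 - ws)) = (norm (?r - ws))\<^sup>2 - (norm (?r2 - ws))\<^sup>2 - (norm (?r - ?r2))\<^sup>2"
      by (simp add: power2_norm_eq_inner inner_simps inner_commute field_simps)
    then have "0 \<le> (?r - ?r2) \<bullet> (?r2 - ws)"
      using res_fejer[OF b(2), of ?r] by linarith
    then have "0 \<le> b' * ((?r - ?r2) \<bullet> (?r2 - ws))" using b by simp
    then have 2: "0 \<le> (?r2 - ws) \<bullet> y" by (simp add: y_def inner_commute)
    have 3: "(?r - ?r2) \<bullet> y = y \<bullet> y / b'" unfolding ry by simp
    have "y \<bullet> y / b + y \<bullet> y / b' \<le> (w - ?r) \<bullet> y + (?r - ?r2) \<bullet> y + (?r2 - ws) \<bullet> y"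
      using 1 2 3 by linarith
    also have "\<dots> = (w - ws) \<bullet> y" by (simp add: inner_simps)
    also have "\<dots> \<le> norm (w - ws) * norm y" by (rule norm_cauchy_schwarz)
    finally have "norm y * (norm y * (1 / b + 1 / b')) \<le> norm y * norm (w - ws)"
      by (simp add: power2_norm_eq_inner[symmetric] power2_eq_square algebra_simps)
    then have "norm y * (1 / b + 1 / b') \<le> norm (w - ws)"
    proof (cases "y = 0")
      case False
      then have "0 < norm y" by simp
      then show ?thesis
        using \<open>norm y * (norm y * (1 / b + 1 / b')) \<le> norm y * norm (w - ws)\<close> mult_left_le_imp_le by blast
    qed simp
    moreover have "norm y * (1 / b + 1 / b') = norm (?r - ?r2) * (1 + b' / b)"
    proof -
      have "norm y = b' * norm (?r - ?r2)" using b unfolding y_def norm_scaleR by simp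
      then show ?thesis using b by (simp add: field_simps)
    qed
    moreover have "0 < 1 + b' / b" using b by (simp add: add_pos_pos)
    ultimately show ?thesis by (simp add: pos_le_divide_eq)
  qed
  have second: "norm ((w' - res b' w') - (?r - ?r2)) \<le> norm (w' - ?r)"
  proof -
    define j where "j = res b' w' - ?r2"
    define i where "i = (w' - res b' w') - (?r - ?r2)"
    have "0 \<le> b' * (i \<bullet> j)"
      using res_monotone[OF b(2,2), of w' ?r] by (simp add: i_def j_def inner_simps algebra_simps)
    then have "0 \<le> i \<bullet> j" using b by (simp add: zero_le_mult_iff)
    moreover have "(norm (i + j))\<^sup>2 = (norm i)\<^sup>2 + (norm j)\<^sup>2 + 2 * (i \<bullet> j)"
      by (simp add: power2_norm_eq_inner inner_simps inner_commute)
    moreover have "0 \<le> (norm j)\<^sup>2" by simp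
    ultimately have "(norm i)\<^sup>2 \<le> (norm (i + j))\<^sup>2" by linarith
    then have "norm i \<le> norm (i + j)" by (rule power2_le_imp_le) simp
    then show ?thesis by (simp add: i_def j_def)
  qed
  have "norm (w' - res b' w') \<le> norm ((w' - res b' w') - (?r - ?r2)) + norm (?r - ?r2)"
    using norm_triangle_ineq[of "(w' - res b' w') - (?r - ?r2)" "?r - ?r2"] by simp
  then show ?thesis using first second by linarith
qed

definition step :: "real \<Rightarrow> 'n \<times> 'd1 \<times> 'd2 \<Rightarrow> 'n \<Rightarrow> 'n \<times> 'd1 \<times> 'd2" where
  "step b w x = (x, argm (p x) (snd w) b)"

definition stage_obj :: "real \<Rightarrow> 'n \<times> 'd1 \<times> 'd2 \<Rightarrow> 'n \<Rightarrow> real" where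
  "stage_obj b w x = q x + smooth_val (p x) (snd w) b + b / 2 * (norm (x - fst w))\<^sup>2"

definition stage_gap :: "real \<Rightarrow> 'n \<times> 'd1 \<times> 'd2 \<Rightarrow> 'n \<Rightarrow> real" where
  "stage_gap b w x = stage_obj b w x - opt b w"

lemma stage_obj_eq: "stage_obj b w x = lift b w (step b w x)"
  by (simp add: stage_obj_def lift_def step_def smooth_val_def)

lemma step_in: "0 < b \<Longrightarrow> x \<in> A \<Longrightarrow> step b w x \<in> stage_dom b w"
  by (simp add: stage_dom_def step_def argm_split_dom)

lemma stage_obj_le_lift:
  assumes "0 < b" "a \<in> stage_dom b w"
  shows "stage_obj b w (fst a) \<le> lift b w a"
proof -
  have "0 \<le> b / 2 * (norm (snd a - argm (p (fst a)) (snd w) b))\<^sup>2" using assms by simp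
  then show ?thesis
    using argm_min[OF assms(1), of "snd a" "p (fst a)" "snd w"] assms(2)
    unfolding stage_obj_def lift_def smooth_val_def stage_dom_def by auto
qed

lemma opt_le_stage_obj: "0 < b \<Longrightarrow> x \<in> A \<Longrightarrow> opt b w \<le> stage_obj b w x"
  unfolding stage_obj_eq by (rule opt_le[OF _ step_in])

lemma stage_gap_nonneg: "0 < b \<Longrightarrow> x \<in> A \<Longrightarrow> 0 \<le> stage_gap b w x"
  unfolding stage_gap_def using opt_le_stage_obj by fastforce

lemma opt_eq_INF_stage_obj:
  assumes "0 < b"
  shows "opt b w = (INF x\<in>A. stage_obj b w x)"
proof (rule antisym)
  show "opt b w \<le> (INF x\<in>A. stage_obj b w x)"
    using xs_in by (intro cINF_greatest opt_le_stage_obj assms) auto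
  have bdd: "bdd_below (stage_obj b w ` A)"
    using opt_le_stage_obj[OF assms] by (intro bdd_belowI) blast
  show "(INF x\<in>A. stage_obj b w x) \<le> opt b w"
    unfolding opt_def
  proof (rule cINF_greatest[OF stage_dom_nonempty])
    fix a assume a: "a \<in> stage_dom b w"
    then have "fst a \<in> A" by (simp add: stage_dom_def)
    then show "(INF x\<in>A. stage_obj b w x) \<le> lift b w a"
      using cINF_lower[OF bdd, of "fst a"] stage_obj_le_lift[OF assms a] by linarith
  qed
qed

text \<open>Passing to the multiplier update is a minimisation in \<open>\<mu>\<close>, so the gap of the subproblem is also the gap of the
lifted problem and controls primal and dual errors together.\<close>

lemma step_near_res:
  assumes "0 < b" "x \<in> A"
  shows "b / 2 * (norm (step b w x - res b w))\<^sup>2 \<le> stage_gap b w x"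
  using res_growth[OF assms(1) step_in[OF assms], of w] unfolding stage_gap_def stage_obj_eq by linarith

text \<open>The lower bound for the next optimal value uses the quadratic growth of the old stage in both
variables: growth in \<open>x\<close> compensates for the change of the centre at the price of the third term,
and growth in \<open>\<mu>\<close> compensates for the change of multiplier and parameter, where the resulting
quadratic is a sum of squares up to the distance of the step to the resolvent. That distance is again bounded by
the gap, which is why the gap appears twice.\<close>

lemma next_stage_gap:
  fixes w :: "'n \<times> 'd1 \<times> 'd2" and x :: 'n and b b' :: real
  assumes b: "0 < b'" "b' \<le> b" "b < 2 * b'" and x: "x \<in> A"
  defines "w' \<equiv> step b w x"
  shows "stage_gap b' w' x \<le> 2 * stage_gap b w x + b * (norm (snd w' - snd w))\<^sup>2
     + (b - b') / 2 * (norm (argm (p x) (snd w') b' - snd w'))\<^sup>2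
     + b\<^sup>2 / (2 * b' - b) * (norm (fst w - x))\<^sup>2"
proof -
  have bpos: "0 < b" using b by linarith
  let ?r = "res b w"
  let ?T = "b\<^sup>2 / (2 * b' - b) * (norm (fst w - x))\<^sup>2"
  have near: "b / 2 * (norm (x - fst ?r))\<^sup>2 + b / 2 * (norm (snd w' - snd ?r))\<^sup>2 \<le> stage_gap b w x"
    using step_near_res[OF bpos x, of w] norm_prod_sq[of "step b w x - ?r"]
    unfolding w'_def by (simp add: step_def distrib_left)
  have lower: "opt b w - stage_gap b w x - ?T - b / 2 * (norm (fst w - x))\<^sup>2 \<le> lift b' w' a'"
    if a': "a' \<in> stage_dom b' w'" for a'
  proof -
    \<comment> \<open>The point of the old stage with the same \<open>x\<close> and the same perturbation \<open>z\<close>.\<close>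
    define a where "a = (fst a', snd w + (b' / b) *\<^sub>R (snd a' - snd w'))"
    have z: "b *\<^sub>R (snd a - snd w) = b' *\<^sub>R (snd a' - snd w')"
      using bpos by (simp add: a_def)
    have f: "fst a = fst a'" by (simp add: a_def)
    have "a \<in> stage_dom b w"
      using a' unfolding stage_dom_def split_dom_def mem_Collect_eq z f .
    from res_growth[OF bpos this]
    have 1: "opt b w + b / 2 * (norm (fst a' - fst ?r))\<^sup>2 + b / 2 * (norm (snd a - snd ?r))\<^sup>2
       + b' / 2 * ((norm (snd a'))\<^sup>2 - (norm (snd w'))\<^sup>2) - b / 2 * ((norm (snd a))\<^sup>2 - (norm (snd w))\<^sup>2)
       + b' / 2 * (norm (fst a' - x))\<^sup>2 - b / 2 * (norm (fst a' - fst w))\<^sup>2 \<le> lift b' w' a'"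
      unfolding norm_prod_sq[of "a - ?r"] lift_def split_val_def z f fst_diff snd_diff
      by (simp add: w'_def step_def distrib_left)
    have "b / 2 * (norm (snd a - snd ?r))\<^sup>2
       + b' / 2 * ((norm (snd a'))\<^sup>2 - (norm (snd w'))\<^sup>2) - b / 2 * ((norm (snd a))\<^sup>2 - (norm (snd w))\<^sup>2)
       + b / 2 * (norm (snd w' - snd ?r))\<^sup>2
       = b' / 2 * (norm (snd a' - snd ?r))\<^sup>2 + b / 2 * (norm (snd ?r - snd w))\<^sup>2
          + (b - b') / 2 * (norm (snd ?r - snd w'))\<^sup>2"
      unfolding a_def snd_conv
      using bpos by (simp add: power2_norm_eq_inner inner_simps inner_commute field_simps)
    moreover have "0 \<le> b' / 2 * (norm (snd a' - snd ?r))\<^sup>2 + b / 2 * (norm (snd ?r - snd w))\<^sup>2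
          + (b - b') / 2 * (norm (snd ?r - snd w'))\<^sup>2"
      using b bpos by (intro add_nonneg_nonneg mult_nonneg_nonneg) auto
    ultimately have 2: "- (b / 2 * (norm (snd w' - snd ?r))\<^sup>2) \<le> b / 2 * (norm (snd a - snd ?r))\<^sup>2
       + b' / 2 * ((norm (snd a'))\<^sup>2 - (norm (snd w'))\<^sup>2) - b / 2 * ((norm (snd a))\<^sup>2 - (norm (snd w))\<^sup>2)"
      by linarith
    \<comment> \<open>Writing \<open>b' = (b + k) / 2\<close> splits the quadratic in \<open>X\<close> into two perfect squares, one against \<open>e\<close> and one against \<open>d\<close>.\<close>
    define k where "k = 2 * b' - b"
    have k: "0 < k" "b' = (b + k) / 2" using b by (auto simp: k_def)
    define X e d where "X = fst a' - x" and "e = fst ?r - x" and "d = x - fst w"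
    have eqs: "fst a' - fst ?r = X - e" "fst a' - x = X" "fst a' - fst w = X + d"
      by (auto simp: X_def e_def d_def)
    have eqs2: "norm (x - fst ?r) = norm e" "norm (fst w - x) = norm d"
      by (simp_all add: e_def d_def norm_minus_commute)
    have "b / 2 * (norm (X - e))\<^sup>2 + b' / 2 * (norm X)\<^sup>2 - b / 2 * (norm (X + d))\<^sup>2
        + b / 2 * (norm e)\<^sup>2 + b\<^sup>2 / k * (norm d)\<^sup>2 + b / 2 * (norm d)\<^sup>2
       = b * (norm ((1/2) *\<^sub>R X - e))\<^sup>2 + 1 / k * (norm ((k / 2) *\<^sub>R X - b *\<^sub>R d))\<^sup>2"
      unfolding k(2) power2_norm_eq_inner using k(1)
      by (simp add: inner_simps inner_commute field_simps power2_eq_square)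
    moreover have "0 \<le> b * (norm ((1/2) *\<^sub>R X - e))\<^sup>2 + 1 / k * (norm ((k / 2) *\<^sub>R X - b *\<^sub>R d))\<^sup>2"
      using bpos k by (intro add_nonneg_nonneg mult_nonneg_nonneg) auto
    ultimately have 3: "- (b / 2 * (norm (x - fst ?r))\<^sup>2) - ?T - b / 2 * (norm (fst w - x))\<^sup>2
      \<le> b / 2 * (norm (fst a' - fst ?r))\<^sup>2 + b' / 2 * (norm (fst a' - x))\<^sup>2 - b / 2 * (norm (fst a' - fst w))\<^sup>2"
      unfolding eqs eqs2 k_def[symmetric] by linarith
    show ?thesis using 1 2 3 near by linarith
  qed
  have opt': "opt b w - stage_gap b w x - ?T - b / 2 * (norm (fst w - x))\<^sup>2 \<le> opt b' w'"
    unfolding opt_def[of b' w'] by (rule cINF_greatest[OF stage_dom_nonempty lower])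
  have "stage_obj b' w' x = q x + smooth_val (p x) (snd w') b'"
    by (simp add: stage_obj_def w'_def step_def)
  also have "\<dots> \<le> q x + (smooth_val (p x) (snd w) b + b * (norm (snd w' - snd w))\<^sup>2
           + (b - b') / 2 * (norm (argm (p x) (snd w') b' - snd w'))\<^sup>2)"
    using smooth_val_update_le[OF bpos b(1), of "p x" "snd w"] by (simp add: w'_def step_def)
  finally have "stage_obj b' w' x \<le> stage_obj b w x - b / 2 * (norm (fst w - x))\<^sup>2 + b * (norm (snd w' - snd w))\<^sup>2
           + (b - b') / 2 * (norm (argm (p x) (snd w') b' - snd w'))\<^sup>2"
    unfolding stage_obj_def[of b w] norm_minus_commute[of x "fst w"] by linarith
  then show ?thesis
    using opt' unfolding stage_gap_def[of b' w'] stage_gap_def[of b w x] by argo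
qed

lemma infdist_step_le:
  assumes "0 < b" "x \<in> A"
  shows "infdist (p2 x) K \<le> b * norm (step b w x - w)"
proof -
  let ?l = "argm (p x) (snd w) b"
  have "p2 x - b *\<^sub>R (snd ?l - snd (snd w)) \<in> K"
    using argm_split_dom[OF assms(1), of "p x" "snd w"] by (simp add: split_dom_def p_def)
  then have "infdist (p2 x) K \<le> dist (p2 x) (p2 x - b *\<^sub>R (snd ?l - snd (snd w)))"
    by (rule infdist_le)
  also have "\<dots> = b * norm (snd (snd (step b w x - w)))"
    using assms by (simp add: dist_norm step_def)
  also have "\<dots> \<le> b * norm (step b w x - w)"
    using assms by (intro mult_left_mono order_trans[OF norm_snd_le_norm norm_snd_le_norm]) auto
  finally show ?thesis .
qed

text \<open>The saddle inequality for the smallest perturbation that makes \<open>x\<close> feasible.\<close>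

lemma objective_lower:
  assumes "x \<in> A"
  shows "- (norm (snd ls) * infdist (p2 x) K) \<le> q x + h1 (p1 x) - Fs"
proof -
  obtain k where k: "k \<in> K" "infdist (p2 x) K = dist (p2 x) k"
    using infdist_attains_inf[OF K_closed K_nonempty] by blast
  have "Fs \<le> q x + h1 (p1 x - fst (0 :: 'd1, p2 x - k)) + ls \<bullet> (0, p2 x - k)"
    unfolding Fs_def by (rule saddle) (use assms k in auto)
  moreover have "ls \<bullet> (0, p2 x - k) \<le> norm (snd ls) * norm (p2 x - k)"
    by (simp add: inner_prod_def norm_cauchy_schwarz)
  ultimately show ?thesis using k by (simp add: dist_norm)
qed

text \<open>The term with \<open>Lh\<close> comes from removing the shift inside \<open>h1\<close>. It is absorbed by the decrease
\<open>b / 2 * |l - \<mu>|\<^sup>2\<close>, for \<open>\<mu>\<close> the dual part of the resolvent, that the growth inequality at the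
solution offers; keeping this decrease makes the constant small enough for the gain of a
factor \<open>\<rho>\<close> later on.\<close>

lemma objective_upper:
  assumes b: "0 < b" and x: "x \<in> A"
  shows "q x + h1 (p1 x) - Fs \<le> 2 * stage_gap b w x + b * (Lh\<^sup>2 + (norm (w - ws))\<^sup>2 + (norm ls)\<^sup>2)"
proof -
  let ?l = "snd w" and ?l' = "argm (p x) (snd w) b" and ?m = "snd (res b w)"
  let ?e = "norm (?l' - ?m)" and ?s = "norm (?l - ?m)"
  have obj: "stage_obj b w x = q x + h1 (p1 x - b *\<^sub>R (fst ?l' - fst ?l))
      + b / 2 * (norm ?l')\<^sup>2 - b / 2 * (norm ?l)\<^sup>2 + b / 2 * (norm (x - fst w))\<^sup>2"
    by (simp add: stage_obj_def smooth_val_def split_val_def p_def right_diff_distrib)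
  have "h1 (p1 x) - h1 (p1 x - b *\<^sub>R (fst ?l' - fst ?l)) \<le> Lh * norm (b *\<^sub>R (fst ?l' - fst ?l))"
    using h1_diff_le[of "p1 x" "p1 x - b *\<^sub>R (fst ?l' - fst ?l)"] by simp
  also have "\<dots> = b * (Lh * norm (fst (?l' - ?l)))"
    using b by simp
  also have "\<dots> \<le> b * (Lh * (?e + ?s))"
  proof -
    have "norm (fst (?l' - ?l)) \<le> norm (?l' - ?l)" by (rule norm_fst_le_norm)
    also have "\<dots> \<le> ?e + ?s"
      using norm_triangle_ineq[of "?l' - ?m" "?m - ?l"] by (simp add: norm_minus_commute)
    finally show ?thesis using b Lh_nonneg by (intro mult_left_mono) auto
  qed
  also have "\<dots> \<le> b * (Lh\<^sup>2 + 1/2 * ?e\<^sup>2 + 1/2 * ?s\<^sup>2)"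
    using b sum_squares_bound[of Lh ?e] sum_squares_bound[of Lh ?s]
    by (intro mult_left_mono) (auto simp: algebra_simps)
  finally have h1: "h1 (p1 x) \<le> h1 (p1 x - b *\<^sub>R (fst ?l' - fst ?l)) + b * Lh\<^sup>2 + b / 2 * ?e\<^sup>2 + b / 2 * ?s\<^sup>2"
    by (simp add: algebra_simps)
  have "b / 2 * ?e\<^sup>2 \<le> b / 2 * (norm (step b w x - res b w))\<^sup>2"
    using b norm_snd_le_norm[of "step b w x - res b w"]
    by (intro mult_left_mono power_mono) (auto simp: step_def)
  then have e: "b / 2 * ?e\<^sup>2 \<le> stage_gap b w x"
    using step_near_res[OF b x, of w] by linarith
  have opt: "opt b w + b / 2 * ?s\<^sup>2 \<le> Fs + b / 2 * (norm (xs - fst w))\<^sup>2"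
  proof -
    have "0 \<le> b / 2 * (norm (xs - fst (res b w)))\<^sup>2" using b by simp
    then show ?thesis using opt_upper[OF b, of w] by linarith
  qed
  have "(norm ?l)\<^sup>2 \<le> 2 * (norm (?l - ls))\<^sup>2 + 2 * (norm ls)\<^sup>2"
    by (rule norm_sq_le_twice)
  moreover have "(norm (w - ws))\<^sup>2 = (norm (xs - fst w))\<^sup>2 + (norm (?l - ls))\<^sup>2"
    unfolding norm_prod_sq[of "w - ws"] by (simp add: ws_def norm_minus_commute)
  moreover have "0 \<le> (norm (xs - fst w))\<^sup>2" by simp
  ultimately have "(norm (xs - fst w))\<^sup>2 + (norm ?l)\<^sup>2 \<le> 2 * (norm (w - ws))\<^sup>2 + 2 * (norm ls)\<^sup>2"
    by linarith
  then have "b / 2 * ((norm (xs - fst w))\<^sup>2 + (norm ?l)\<^sup>2) \<le> b / 2 * (2 * (norm (w - ws))\<^sup>2 + 2 * (norm ls)\<^sup>2)"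
    using b by (intro mult_left_mono) auto
  then have "b / 2 * (norm (xs - fst w))\<^sup>2 + b / 2 * (norm ?l)\<^sup>2 \<le> b * (norm (w - ws))\<^sup>2 + b * (norm ls)\<^sup>2"
    by (simp add: algebra_simps)
  moreover have "0 \<le> b / 2 * (norm ?l')\<^sup>2" "0 \<le> b / 2 * (norm (x - fst w))\<^sup>2" using b by auto
  ultimately show ?thesis
    using h1 e opt obj unfolding stage_gap_def distrib_left by argo
qed

lemma step_error:
  assumes b: "0 < b" and x: "x \<in> A"
  shows "norm (step b w x - ws) \<le> norm (w - ws) + sqrt (2 * stage_gap b w x / b)"
    and "norm (step b w x - w) \<le> norm (w - res b w) + sqrt (2 * stage_gap b w x / b)"
    and "norm (step b w x - res b w) \<le> sqrt (2 * stage_gap b w x / b)"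
    and "norm (w - res b w) \<le> norm (w - ws)"
proof -
  show near: "norm (step b w x - res b w) \<le> sqrt (2 * stage_gap b w x / b)"
    using step_near_res[OF b x, of w] b by (intro real_le_rsqrt) (simp add: field_simps)
  have "(norm (res b w - ws))\<^sup>2 \<le> (norm (w - ws))\<^sup>2" "(norm (w - res b w))\<^sup>2 \<le> (norm (w - ws))\<^sup>2"
    using res_fejer[OF b, of w] zero_le_power2[of "norm (w - res b w)"] zero_le_power2[of "norm (res b w - ws)"]
    by linarith+
  then have 1: "norm (res b w - ws) \<le> norm (w - ws)" and 2: "norm (w - res b w) \<le> norm (w - ws)"
    by (auto intro: power2_le_imp_le)
  show "norm (w - res b w) \<le> norm (w - ws)" by (rule 2)
  show "norm (step b w x - ws) \<le> norm (w - ws) + sqrt (2 * stage_gap b w x / b)"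
    using norm_triangle_ineq[of "step b w x - res b w" "res b w - ws"] near 1 by simp
  show "norm (step b w x - w) \<le> norm (w - res b w) + sqrt (2 * stage_gap b w x / b)"
    using norm_triangle_ineq[of "step b w x - res b w" "res b w - w"] near
    by (simp add: norm_minus_commute[of "res b w" w])
qed

end

section \<open>Expected optimality gaps\<close>

lemma borel_measurable_compose_continuous:
  assumes "continuous_on UNIV \<phi>" "X \<in> borel_measurable N"
  shows "(\<lambda>\<omega>. \<phi> (X \<omega>)) \<in> borel_measurable N"
  by (rule measurable_compose[OF assms(2) borel_measurable_continuous_onI[OF assms(1)]])

text \<open>Closure of Borel functions under the operations that occur in \<open>M\<^sub>s\<close>.\<close>

lemmas borel_measurable_primitives =
  borel_measurable_add borel_measurable_times borel_measurable_power borel_measurable_const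
  borel_measurable_diff borel_measurable_scaleR
  borel_measurable_compose_continuous[where \<phi> = norm, OF continuous_on_norm[OF continuous_on_id]]
  borel_measurable_compose_continuous[where \<phi> = fst, OF continuous_on_fst[OF continuous_on_id]]
  borel_measurable_compose_continuous[where \<phi> = snd, OF continuous_on_snd[OF continuous_on_id]]
  borel_measurable_compose_continuous[where \<phi> = sqrt, OF continuous_on_real_sqrt[OF continuous_on_id]]

locale stage_problem = composite_saddle h1 K Lh A q p1 p2 xs ls
  for h1 :: "'d1::euclidean_space \<Rightarrow> real" and K :: "'d2::euclidean_space set" and Lh :: real
    and A :: "'n::euclidean_space set" and q :: "'n \<Rightarrow> real"
    and p1 :: "'n \<Rightarrow> 'd1" and p2 :: "'n \<Rightarrow> 'd2" and xs :: 'n and ls :: "'d1 \<times> 'd2" +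
  fixes f g :: "'n \<Rightarrow> ereal"
  assumes fg_in: "x \<in> A \<Longrightarrow> f x + g x = ereal (q x)"
    and fg_out: "x \<notin> A \<Longrightarrow> f x + g x = \<infinity>"
    and A_borel [measurable]: "A \<in> sets borel"
    and q_measurable: "(\<lambda>x. indicator A x * q x) \<in> borel_measurable borel"
    and p1_continuous: "continuous_on UNIV p1" and p2_continuous: "continuous_on UNIV p2"
begin

lemma p_eq: "(\<lambda>z. (p1 z, p2 z)) = p"
  by (simp add: fun_eq_iff p_def)

lemma p_continuous: "continuous_on UNIV p"
  unfolding p_eq[symmetric] by (intro continuous_on_Pair p1_continuous p2_continuous)

lemma aug_lagrangian_eq:
  assumes "0 < b"
  shows "aug_lagrangian f g h p x y l b = (if x \<in> A then ereal (stage_obj b (y, l) x) else \<infinity>)"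
  by (simp add: aug_lagrangian_def fg_in fg_out smoothed_eq[OF assms] stage_obj_def smooth_val_def)

lemma INF_aug_lagrangian:
  assumes b: "0 < b"
  shows "(INF x. aug_lagrangian f g h p x y l b) = ereal (opt b (y, l))"
proof (rule antisym)
  show "ereal (opt b (y, l)) \<le> (INF x. aug_lagrangian f g h p x y l b)"
    by (rule INF_greatest) (simp add: aug_lagrangian_eq[OF b] opt_le_stage_obj[OF b])
  have bdd: "bdd_below (stage_obj b (y, l) ` A)"
    using opt_le_stage_obj[OF b] by (intro bdd_belowI) blast
  show "(INF x. aug_lagrangian f g h p x y l b) \<le> ereal (opt b (y, l))"
  proof (rule ereal_le_epsilon2)
    fix e :: real assume e: "0 < e"
    have "\<exists>x\<in>A. stage_obj b (y, l) x < opt b (y, l) + e"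
      using cINF_less_iff[OF _ bdd, of "opt b (y, l) + e"] xs_in e
      unfolding opt_eq_INF_stage_obj[OF b, symmetric] by auto
    then obtain x where x: "x \<in> A" "stage_obj b (y, l) x < opt b (y, l) + e" by blast
    have "(INF x. aug_lagrangian f g h p x y l b) \<le> aug_lagrangian f g h p x y l b"
      by (rule INF_lower) simp
    also have "\<dots> \<le> ereal (opt b (y, l)) + ereal e"
      using x by (simp add: aug_lagrangian_eq[OF b])
    finally show "(INF x. aug_lagrangian f g h p x y l b) \<le> ereal (opt b (y, l)) + ereal e" .
  qed
qed

lemma gap_eq:
  assumes "0 < b"
  shows "gap (\<lambda>z. aug_lagrangian f g h p z y l b) x = (if x \<in> A then ereal (stage_gap b (y, l) x) else \<infinity>)"
  unfolding gap_def INF_aug_lagrangian[OF assms] by (simp add: aug_lagrangian_eq[OF assms] stage_gap_def)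

lemma argm_measurable:
  assumes "0 < b" "X \<in> borel_measurable N" "L \<in> borel_measurable N"
  shows "(\<lambda>\<omega>. argm (p (X \<omega>)) (L \<omega>) b) \<in> borel_measurable N"
proof -
  have "continuous_on UNIV (\<lambda>a. argm (p (fst a)) (snd a) b)"
    by (rule continuous_on_compose2[OF continuous_argm[OF assms(1)], of _ "\<lambda>a. (p (fst a), snd a)", simplified])
      (intro continuous_intros continuous_on_compose2[OF p_continuous]; simp)
  then have "(\<lambda>a. argm (p (fst a)) (snd a) b) \<in> borel_measurable borel"
    by (rule borel_measurable_continuous_onI)
  from measurable_compose[OF borel_measurable_Pair[OF assms(2,3)] this]
  show ?thesis by simp
qed

text \<open>An infimum of uncountably many functions, each continuous in the parameters, is upper
semicontinuous.\<close>

lemma opt_measurable: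
  assumes b: "0 < b"
  shows "opt b \<in> borel_measurable borel"
proof (rule borel_measurableI_less)
  fix c
  have bdd: "bdd_below (stage_obj b w ` A)" for w
    using opt_le_stage_obj[OF b] by (intro bdd_belowI) blast
  have "opt b w < c \<longleftrightarrow> (\<exists>x\<in>A. stage_obj b w x < c)" for w
    unfolding opt_eq_INF_stage_obj[OF b] using xs_in by (intro cINF_less_iff bdd) auto
  then have "{w \<in> space borel. opt b w < c} = (\<Union>x\<in>A. {w. stage_obj b w x < c})"
    by auto
  moreover have "open {w. stage_obj b w x < c}" for x
  proof -
    have "continuous_on UNIV (\<lambda>w. smooth_val (p x) (snd w) b)"
      by (rule continuous_on_compose2[OF continuous_smooth_val[OF b], of _ "\<lambda>w. (p x, snd w)", simplified])
        (intro continuous_intros)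
    then have "continuous_on UNIV (\<lambda>w. stage_obj b w x)"
      unfolding stage_obj_def by (intro continuous_intros)
    then show ?thesis
      by (intro open_Collect_less continuous_on_const)
  qed
  ultimately show "{w \<in> space borel. opt b w < c} \<in> sets borel"
    by (simp add: open_UN borel_open)
qed

lemma stage_gap_measurable:
  assumes b: "0 < b" and X: "X \<in> borel_measurable N" and W: "W \<in> borel_measurable N"
  shows "(\<lambda>\<omega>. indicator A (X \<omega>) * stage_gap b (W \<omega>) (X \<omega>)) \<in> borel_measurable N"
proof -
  have "continuous_on UNIV (\<lambda>a. smooth_val (p (fst a)) (snd (snd a)) b + b / 2 * (norm (fst a - fst (snd a)))\<^sup>2)"
    by (intro continuous_intros continuous_on_compose2[OF continuous_smooth_val[OF b], 
          of _ "\<lambda>a. (p (fst a), snd (snd a))", simplified] continuous_on_compose2[OF p_continuous]; simp)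
  then have "(\<lambda>a. smooth_val (p (fst a)) (snd (snd a)) b + b / 2 * (norm (fst a - fst (snd a)))\<^sup>2) \<in> borel_measurable borel"
    by (rule borel_measurable_continuous_onI)
  from measurable_compose[OF borel_measurable_Pair[OF X W] this]
  have [measurable]: "(\<lambda>\<omega>. smooth_val (p (X \<omega>)) (snd (W \<omega>)) b + b / 2 * (norm (X \<omega> - fst (W \<omega>)))\<^sup>2) \<in> borel_measurable N"
    by simp
  have [measurable]: "(\<lambda>\<omega>. indicator A (X \<omega>) * q (X \<omega>)) \<in> borel_measurable N"
    using measurable_compose[OF X q_measurable] by simp
  have [measurable]: "(\<lambda>\<omega>. opt b (W \<omega>)) \<in> borel_measurable N"
    by (rule measurable_compose[OF W opt_measurable[OF b]])
  note X [measurable]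
  have eq: "indicator A (X \<omega>) * stage_gap b (W \<omega>) (X \<omega>) = indicator A (X \<omega>) * q (X \<omega>)
     + indicator A (X \<omega>) * (smooth_val (p (X \<omega>)) (snd (W \<omega>)) b + b / 2 * (norm (X \<omega> - fst (W \<omega>)))\<^sup>2 - opt b (W \<omega>))" for \<omega>
    by (simp add: stage_gap_def stage_obj_def indicator_def)
  show ?thesis unfolding eq by measurable
qed

end

locale ipalm = stage_problem h1 K Lh A q p1 p2 xs ls f g + prob_space M
  for h1 :: "'d1::euclidean_space \<Rightarrow> real" and K :: "'d2::euclidean_space set" and Lh :: real
    and A :: "'n::euclidean_space set" and q :: "'n \<Rightarrow> real"
    and p1 :: "'n \<Rightarrow> 'd1" and p2 :: "'n \<Rightarrow> 'd2" and xs :: 'n and ls :: "'d1 \<times> 'd2"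
    and f g :: "'n \<Rightarrow> ereal" and M :: "'w measure" +
  fixes \<beta>0 \<rho> \<eta> \<epsilon>0 :: real and m0 :: nat and \<beta> \<epsilon>s :: "nat \<Rightarrow> real"
    and xinit :: 'n and linit :: "'d1 \<times> 'd2"
    and x :: "nat \<Rightarrow> 'w \<Rightarrow> 'n" and lam :: "nat \<Rightarrow> 'w \<Rightarrow> 'd1 \<times> 'd2" and m :: "nat \<Rightarrow> 'w \<Rightarrow> nat"
    and H :: "nat \<Rightarrow> 'w \<Rightarrow> 'n \<Rightarrow> ereal"
    and Alg :: "nat \<Rightarrow> 'n \<Rightarrow> nat \<Rightarrow> ('n \<Rightarrow> ereal) \<Rightarrow> 'w \<Rightarrow> 'n"
    and Kin :: "nat \<Rightarrow> real"
  assumes \<beta>_eq: "\<beta> = (\<lambda>s. \<beta>0 * \<rho> ^ s)" and \<epsilon>s_eq: "\<epsilon>s = (\<lambda>s. \<epsilon>0 * \<eta> ^ s)"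
    and H_eq: "H = sub_obj f g (sep_fun h1 K) (\<lambda>z. (p1 z, p2 z)) \<beta> xinit x lam"
    and pos: "0 < \<beta>0" "1/2 < \<rho>" "\<rho> < 1" "0 < \<eta>" "\<eta> < \<rho>" "0 < \<epsilon>0"
    and xinit_in: "xinit \<in> A"
    and lam_0: "\<And>\<omega>. \<omega> \<in> space M \<Longrightarrow> lam 0 \<omega> = linit"
    and m_0: "\<And>\<omega>. \<omega> \<in> space M \<Longrightarrow> m 0 \<omega> = m0"
    and x_eq: "\<And>\<omega> s. \<omega> \<in> space M \<Longrightarrow> x s \<omega> = Alg s (prev_iter xinit x s \<omega>) (m s \<omega>) (H s \<omega>) \<omega>"
    and gap_0: "AE \<omega> in M. gap (H 0 \<omega>) (x 0 \<omega>) \<le> ereal \<epsilon>0"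
    and lam_Suc: "\<And>\<omega> s. \<omega> \<in> space M \<Longrightarrow>
          lam (Suc s) \<omega> = smooth_argmax (sep_fun h1 K) (p1 (x s \<omega>), p2 (x s \<omega>)) (lam s \<omega>) (\<beta> s)"
    and m_Suc: "\<And>\<omega> s. \<omega> \<in> space M \<Longrightarrow> m (Suc s) \<omega> =
           (LEAST k. 0 < k \<and> 2 * \<epsilon>s s + ipalm_M Lh (sep_fun h1 K) (\<lambda>z. (p1 z, p2 z)) \<beta> xinit x lam s \<omega>
                              \<le> 2 powi \<lfloor>real k / Kin (Suc s)\<rfloor> * \<epsilon>s (Suc s) / 2)"
    and Kin_ge: "\<And>s. 1 \<le> Kin s"
    and rate: "\<And>s. inner_rate M (past_algebra M x lam s) A (H s) (Kin s) (Alg s)"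
begin

lemma \<beta>_pos: "0 < \<beta> s" and \<epsilon>s_pos: "0 < \<epsilon>s s" and \<beta>_Suc: "\<beta> (Suc s) = \<rho> * \<beta> s"
  using pos by (simp_all add: \<beta>_eq \<epsilon>s_eq)

text \<open>The pair of proximal centre and multiplier with which stage \<open>s\<close> starts.\<close>

definition w :: "nat \<Rightarrow> 'w \<Rightarrow> 'n \<times> 'd1 \<times> 'd2" where
  "w s \<omega> = (prev_iter xinit x s \<omega>, lam s \<omega>)"

definition \<delta> :: "nat \<Rightarrow> 'w \<Rightarrow> real" where
  "\<delta> s \<omega> = stage_gap (\<beta> s) (w s \<omega>) (x s \<omega>)"

definition Ms :: "nat \<Rightarrow> 'w \<Rightarrow> real" where
  "Ms s \<omega> = ipalm_M Lh h p \<beta> xinit x lam s \<omega>"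

lemma w_0: "\<omega> \<in> space M \<Longrightarrow> w 0 \<omega> = (xinit, linit)"
  by (simp add: w_def prev_iter_def lam_0)

lemma w_Suc: "\<omega> \<in> space M \<Longrightarrow> w (Suc s) \<omega> = step (\<beta> s) (w s \<omega>) (x s \<omega>)"
  by (simp add: w_def prev_iter_def step_def lam_Suc p_def)

lemma gap_H: "gap (H s \<omega>) y = (if y \<in> A then ereal (stage_gap (\<beta> s) (w s \<omega>) y) else \<infinity>)"
  unfolding H_eq sub_obj_def p_eq w_def by (rule gap_eq[OF \<beta>_pos])

lemma Ms_eq:
  assumes \<omega>: "\<omega> \<in> space M"
  shows "Ms s \<omega> = \<beta> s * (norm (snd (w (Suc s) \<omega>) - snd (w s \<omega>)))\<^sup>2
     + (\<beta> s - \<beta> (Suc s)) / 2 * (norm (argm (p (x s \<omega>)) (snd (w (Suc s) \<omega>)) (\<beta> (Suc s)) - snd (w (Suc s) \<omega>)))\<^sup>2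
     + (\<beta> s)\<^sup>2 / (2 * \<beta> (Suc s) - \<beta> s) * (norm (fst (w s \<omega>) - x s \<omega>))\<^sup>2
     + norm (snd (w (Suc s) \<omega>) - snd (w s \<omega>)) *
          sqrt (((\<beta> s + \<beta> (Suc s)) * Lh + norm (\<beta> s *\<^sub>R fst (lam s \<omega>) - \<beta> (Suc s) *\<^sub>R fst (lam (Suc s) \<omega>)))\<^sup>2
                + (norm (\<beta> s *\<^sub>R snd (lam s \<omega>) - \<beta> (Suc s) *\<^sub>R snd (lam (Suc s) \<omega>)))\<^sup>2)"
  by (simp add: Ms_def ipalm_M_def w_def Let_def)

lemma \<beta>_between: "\<beta> (Suc s) \<le> \<beta> s" "\<beta> s < 2 * \<beta> (Suc s)"
proof -
  have "\<rho> * \<beta> s \<le> 1 * \<beta> s" "1 * \<beta> s < (2 * \<rho>) * \<beta> s"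
    using mult_right_mono[of \<rho> 1 "\<beta> s"] mult_strict_right_mono[of 1 "2 * \<rho>" "\<beta> s"] pos \<beta>_pos[of s]
    by simp_all
  then show "\<beta> (Suc s) \<le> \<beta> s" "\<beta> s < 2 * \<beta> (Suc s)" unfolding \<beta>_Suc by (simp_all only: mult_1 mult.assoc)
qed

lemma Ms_parts_nonneg:
  "0 \<le> \<beta> s * (norm a)\<^sup>2" "0 \<le> (\<beta> s - \<beta> (Suc s)) / 2 * (norm b)\<^sup>2"
  "0 \<le> (\<beta> s)\<^sup>2 / (2 * \<beta> (Suc s) - \<beta> s) * (norm c)\<^sup>2"
  using \<beta>_pos[of s] \<beta>_between[of s] by simp_all

lemma Ms_nonneg: "\<omega> \<in> space M \<Longrightarrow> 0 \<le> Ms s \<omega>"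
  unfolding Ms_eq
  by (intro add_nonneg_nonneg Ms_parts_nonneg mult_nonneg_nonneg) auto

lemma start_gap_le:
  assumes \<omega>: "\<omega> \<in> space M" and x: "x s \<omega> \<in> A"
  shows "stage_gap (\<beta> (Suc s)) (w (Suc s) \<omega>) (x s \<omega>) \<le> 2 * \<delta> s \<omega> + Ms s \<omega>"
  using next_stage_gap[OF \<beta>_pos[of "Suc s"] \<beta>_between[of s] x, of "w s \<omega>"]
  unfolding Ms_eq[OF \<omega>] \<delta>_def w_Suc[OF \<omega>, symmetric] by (rule order_trans) simp

abbreviation Fil :: "nat \<Rightarrow> 'w measure" where "Fil \<equiv> past_algebra M x lam"

lemma space_Fil: "space (Fil s) = space M"
  unfolding past_algebra_def by (rule space_measure_of) auto

lemma sets_Fil: "sets (Fil s) = sigma_sets (space M)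
   ({x t -` B \<inter> space M | t B. t < s \<and> B \<in> sets borel} \<union> {lam t -` B \<inter> space M | t B. t < s \<and> B \<in> sets borel})"
  unfolding past_algebra_def by (rule sets_measure_of) auto

lemma past_measurable:
  assumes "t < s"
  shows "x t \<in> borel_measurable (Fil s)" "lam t \<in> borel_measurable (Fil s)"
proof -
  have "x t -` B \<inter> space (Fil s) \<in> sets (Fil s)" "lam t -` C \<inter> space (Fil s) \<in> sets (Fil s)"
    if "B \<in> sets borel" "C \<in> sets borel" for B C
    unfolding space_Fil sets_Fil using assms that by (auto intro!: sigma_sets.Basic)
  then show "x t \<in> borel_measurable (Fil s)" "lam t \<in> borel_measurable (Fil s)"
    by (auto intro!: measurableI)
qed

lemma subalgebra_Fil:
  assumes "\<And>t. t < s \<Longrightarrow> x t \<in> borel_measurable M" "\<And>t. t < s \<Longrightarrow> lam t \<in> borel_measurable M"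
  shows "subalgebra M (Fil s)"
proof -
  have "sets (Fil s) \<subseteq> sets M"
    unfolding sets_Fil
    by (rule sets.sigma_sets_subset) (use measurable_sets[OF assms(1)] measurable_sets[OF assms(2)] in auto)
  then show ?thesis by (simp add: subalgebra_def space_Fil)
qed

lemma lam_measurable:
  assumes "space N = space M" "\<And>t. t < s \<Longrightarrow> x t \<in> borel_measurable N"
  shows "t \<le> s \<Longrightarrow> lam t \<in> borel_measurable N"
proof (induction t)
  case 0
  have "(\<lambda>_. linit) \<in> borel_measurable N" by simp
  then show ?case using lam_0 assms(1) measurable_cong[of N "lam 0" "\<lambda>_. linit"] by auto
next
  case (Suc t)
  then have "(\<lambda>\<omega>. argm (p (x t \<omega>)) (lam t \<omega>) (\<beta> t)) \<in> borel_measurable N"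
    using assms(2) by (intro argm_measurable \<beta>_pos) auto
  then show ?case
    using lam_Suc assms(1) measurable_cong[of N "lam (Suc t)" "\<lambda>\<omega>. argm (p (x t \<omega>)) (lam t \<omega>) (\<beta> t)"]
    by (auto simp: p_def)
qed

lemma prev_iter_measurable:
  assumes "\<And>t. t < s \<Longrightarrow> x t \<in> borel_measurable N"
  shows "prev_iter xinit x s \<in> borel_measurable N"
proof (cases s)
  case 0
  then have "prev_iter xinit x s = (\<lambda>_. xinit)" by (simp add: fun_eq_iff prev_iter_def)
  then show ?thesis by simp
next
  case (Suc t)
  then have "prev_iter xinit x s = x t" by (simp add: fun_eq_iff prev_iter_def)
  then show ?thesis using assms Suc by simp
qed

text \<open>Stated for an arbitrary \<open>\<sigma>\<close>-algebra that makes the first iterates measurable, since the number of inner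
iterations has to be measurable with respect to the past.\<close>

lemma Ms_measurable:
  assumes "space N = space M" "\<And>t. t < Suc s \<Longrightarrow> x t \<in> borel_measurable N"
  shows "Ms s \<in> borel_measurable N"
proof -
  have lam: "lam s \<in> borel_measurable N" "lam (Suc s) \<in> borel_measurable N"
    using lam_measurable[OF assms, of s] lam_measurable[OF assms, of "Suc s"] by simp_all
  have x: "x s \<in> borel_measurable N" by (rule assms(2)) simp
  have prev: "prev_iter xinit x s \<in> borel_measurable N"
    by (rule prev_iter_measurable) (rule assms(2), simp)
  have argm: "(\<lambda>\<omega>. argm (p (x s \<omega>)) (lam (Suc s) \<omega>) (\<beta> (Suc s))) \<in> borel_measurable N"
    by (rule argm_measurable[OF \<beta>_pos x lam(2)])
  show ?thesis
    unfolding Ms_def[abs_def] ipalm_M_def Let_def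
    by (intro borel_measurable_primitives lam x prev argm)
qed

lemma m_measurable: "m s \<in> measurable (Fil s) (count_space UNIV)"
proof (cases s)
  case 0
  have "(\<lambda>_. m0) \<in> measurable (Fil s) (count_space UNIV)" by simp
  then show ?thesis
    using m_0 0 space_Fil[of s] measurable_cong[of "Fil s" "m s" "\<lambda>_. m0"] by auto
next
  case (Suc t)
  let ?P = "\<lambda>k \<omega>. 0 < k \<and> 2 * \<epsilon>s t + Ms t \<omega> \<le> 2 powi \<lfloor>real k / Kin (Suc t)\<rfloor> * \<epsilon>s (Suc t) / 2"
  have [measurable]: "Ms t \<in> borel_measurable (Fil s)"
    by (intro Ms_measurable space_Fil) (use past_measurable Suc in blast)
  have "(\<lambda>\<omega>. LEAST k. ?P k \<omega>) \<in> measurable (Fil s) (count_space UNIV)"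
    by (rule measurable_Least) measurable
  moreover have "m s \<in> measurable (Fil s) (count_space UNIV)
      \<longleftrightarrow> (\<lambda>\<omega>. LEAST k. ?P k \<omega>) \<in> measurable (Fil s) (count_space UNIV)"
    by (rule measurable_cong) (simp add: space_Fil Suc m_Suc Ms_def p_eq)
  ultimately show ?thesis by blast
qed

lemma two_powi_unbounded:
  assumes "0 < e"
  shows "\<exists>k::nat. 0 < k \<and> (Y::real) \<le> 2 powi \<lfloor>real k / Kin s\<rfloor> * e / 2"
proof -
  obtain j :: nat where j: "2 * Y / e < 2 ^ j" using real_arch_pow[of 2 "2 * Y / e"] by auto
  define k where "k = nat \<lceil>Kin s * real (Suc j)\<rceil>"
  have K: "0 < Kin s" using Kin_ge[of s] by linarith
  have k: "Kin s * real (Suc j) \<le> real k" unfolding k_def by linarith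
  have "0 < Kin s * real (Suc j)" using K by simp
  then have k0: "0 < k" using k by (cases k) auto
  have "real (Suc j) \<le> real k / Kin s" using k K by (simp add: field_simps)
  then have fl: "int j \<le> \<lfloor>real k / Kin s\<rfloor>" by linarith
  have "(2::real) ^ j = 2 powi int j" by simp
  also have "\<dots> \<le> 2 powi \<lfloor>real k / Kin s\<rfloor>" by (rule power_int_increasing[OF fl]) simp
  finally have "2 * Y / e \<le> 2 powi \<lfloor>real k / Kin s\<rfloor>" using j by linarith
  then have "Y \<le> 2 powi \<lfloor>real k / Kin s\<rfloor> * e / 2" using assms by (simp add: field_simps)
  then show ?thesis using k0 by blast
qed

lemma m_sufficient:
  assumes \<omega>: "\<omega> \<in> space M"
  shows "2 * \<epsilon>s s + Ms s \<omega> \<le> 2 powi \<lfloor>real (m (Suc s) \<omega>) / Kin (Suc s)\<rfloor> * \<epsilon>s (Suc s) / 2"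
proof -
  from LeastI_ex[OF two_powi_unbounded[OF \<epsilon>s_pos[of "Suc s"], of "2 * \<epsilon>s s + Ms s \<omega>" "Suc s"]]
  show ?thesis using m_Suc[OF \<omega>, of s] by (simp add: Ms_def p_eq)
qed

text \<open>The contraction factor is at most \<open>\<epsilon>\<^sub>s\<^sub>+\<^sub>1 / 2\<close> divided by \<open>2 \<epsilon>\<^sub>s + M\<^sub>s\<close>, and \<open>2 \<delta> + M\<^sub>s\<close> is at most
\<open>1 + \<delta> / \<epsilon>\<^sub>s\<close> times this denominator. The resulting bound is affine in \<open>\<delta>\<close>, so its expectation is
known.\<close>

lemma contracted_start_gap:
  assumes \<omega>: "\<omega> \<in> space M" and x: "x s \<omega> \<in> A"
  shows "2 powi (- \<lfloor>real (m (Suc s) \<omega>) / Kin (Suc s)\<rfloor>) * stage_gap (\<beta> (Suc s)) (w (Suc s) \<omega>) (x s \<omega>)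
     \<le> \<epsilon>s (Suc s) / 2 + \<epsilon>s (Suc s) / (2 * \<epsilon>s s) * \<delta> s \<omega>"
proof -
  let ?j = "\<lfloor>real (m (Suc s) \<omega>) / Kin (Suc s)\<rfloor>" and ?e = "\<epsilon>s s" and ?e' = "\<epsilon>s (Suc s)"
  have d: "0 \<le> \<delta> s \<omega>" unfolding \<delta>_def by (rule stage_gap_nonneg[OF \<beta>_pos x])
  have M: "0 \<le> Ms s \<omega>" by (rule Ms_nonneg[OF \<omega>])
  have e: "0 < ?e" "0 < ?e'" by (rule \<epsilon>s_pos)+
  have j: "0 < (2::real) powi ?j" by simp
  have "(2 * ?e + Ms s \<omega>) / 2 powi ?j \<le> ?e' / 2"
    using m_sufficient[OF \<omega>, of s] j by (simp add: pos_divide_le_eq mult.commute)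
  then have inv: "2 powi (- ?j) * (2 * ?e + Ms s \<omega>) \<le> ?e' / 2"
    by (simp add: power_int_minus field_simps)
  have "2 powi (- ?j) * stage_gap (\<beta> (Suc s)) (w (Suc s) \<omega>) (x s \<omega>) \<le> 2 powi (- ?j) * (2 * \<delta> s \<omega> + Ms s \<omega>)"
    using start_gap_le[OF \<omega> x] by (intro mult_left_mono) auto
  also have "\<dots> \<le> 2 powi (- ?j) * ((1 + \<delta> s \<omega> / ?e) * (2 * ?e + Ms s \<omega>))"
  proof (intro mult_left_mono)
    have "0 \<le> \<delta> s \<omega> / ?e * Ms s \<omega>" using d M e by simp
    then show "2 * \<delta> s \<omega> + Ms s \<omega> \<le> (1 + \<delta> s \<omega> / ?e) * (2 * ?e + Ms s \<omega>)"
      using e by (simp add: field_simps)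
  qed simp
  also have "\<dots> = (1 + \<delta> s \<omega> / ?e) * (2 powi (- ?j) * (2 * ?e + Ms s \<omega>))" by simp
  also have "\<dots> \<le> (1 + \<delta> s \<omega> / ?e) * (?e' / 2)"
    using inv d e by (intro mult_left_mono) auto
  also have "\<dots> = ?e' / 2 + ?e' / (2 * ?e) * \<delta> s \<omega>" using e by (simp add: field_simps)
  finally show ?thesis .
qed

text \<open>Measurability of the iterates, their membership in the domain and the bound on the expected gap
have to be proved together: the rate assumption yields a measurable output only for a
measurable starting point that lies in the domain almost surely, and the output lies in the domain almost surely
because its gap has a finite expectation.\<close>

lemma expected_gap_induction:
  "(\<forall>t\<le>s. x t \<in> borel_measurable M) \<and> (AE \<omega> in M. x s \<omega> \<in> A) \<and> (\<integral>\<^sup>+ \<omega>. ennreal (\<delta> s \<omega>) \<partial>M) \<le> ennreal (\<epsilon>s s)"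
proof (induction s)
  case 0
  have "(AE \<omega> in M. prev_iter xinit x 0 \<omega> \<in> A)" using xinit_in by (simp add: prev_iter_def)
  moreover have "prev_iter xinit x 0 \<in> borel_measurable (Fil 0)"
    by (rule prev_iter_measurable) simp
  ultimately have "(\<lambda>\<omega>. Alg 0 (prev_iter xinit x 0 \<omega>) (m 0 \<omega>) (H 0 \<omega>) \<omega>) \<in> borel_measurable M"
    using rate[of 0, unfolded inner_rate_def] m_measurable[of 0] by blast
  then have x0: "x 0 \<in> borel_measurable M"
    using measurable_cong[of M "x 0" "\<lambda>\<omega>. Alg 0 (prev_iter xinit x 0 \<omega>) (m 0 \<omega>) (H 0 \<omega>) \<omega>"] x_eq by auto
  have *: "AE \<omega> in M. x 0 \<omega> \<in> A \<and> \<delta> 0 \<omega> \<le> \<epsilon>0"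
    using gap_0 by eventually_elim (auto simp: gap_H \<delta>_def split: if_splits)
  have "(\<integral>\<^sup>+ \<omega>. ennreal (\<delta> 0 \<omega>) \<partial>M) \<le> (\<integral>\<^sup>+ \<omega>. ennreal \<epsilon>0 \<partial>M)"
    using * by (intro nn_integral_mono_AE) (auto intro: ennreal_leI)
  also have "\<dots> = ennreal (\<epsilon>s 0)" by (simp add: emeasure_space_1 \<epsilon>s_eq)
  finally show ?case using x0 * by (auto elim: eventually_mono)
next
  case (Suc s)
  then have xm: "\<And>t. t < Suc s \<Longrightarrow> x t \<in> borel_measurable M"
    and xA: "AE \<omega> in M. x s \<omega> \<in> A" and gap: "(\<integral>\<^sup>+ \<omega>. ennreal (\<delta> s \<omega>) \<partial>M) \<le> ennreal (\<epsilon>s s)"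
    by auto
  let ?S = "Suc s"
  let ?X = "prev_iter xinit x ?S"
  have X: "?X = x s" by (simp add: fun_eq_iff prev_iter_def)
  have lm: "\<And>t. t \<le> ?S \<Longrightarrow> lam t \<in> borel_measurable M"
    by (rule lam_measurable[OF refl xm])
  have XF: "?X \<in> borel_measurable (Fil ?S)"
    by (rule prev_iter_measurable) (use past_measurable in blast)
  have XA: "AE \<omega> in M. ?X \<omega> \<in> A" using xA unfolding X .
  let ?Y = "\<lambda>\<omega>. Alg ?S (?X \<omega>) (m ?S \<omega>) (H ?S \<omega>) \<omega>"
  have Y: "?Y \<in> borel_measurable M"
    and ce: "AE \<omega> in M. nn_cond_exp M (Fil ?S) (\<lambda>\<omega>'. e2ennreal (gap (H ?S \<omega>') (?Y \<omega>'))) \<omega>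
           \<le> ennreal (2 powi (- \<lfloor>real (m ?S \<omega>) / Kin ?S\<rfloor>)) * e2ennreal (gap (H ?S \<omega>) (?X \<omega>))"
    using rate[of ?S, unfolded inner_rate_def] XF XA m_measurable[of ?S] by blast+
  have xS: "x ?S \<in> borel_measurable M"
    using Y measurable_cong[of M "x ?S" ?Y] x_eq by auto
  have sub: "subalgebra M (Fil ?S)" by (rule subalgebra_Fil) (use xm lm in auto)
  interpret sub: finite_measure_subalgebra M "Fil ?S"
    by unfold_locales (rule sub)
  let ?G = "\<lambda>\<omega>. e2ennreal (gap (H ?S \<omega>) (?Y \<omega>))"
  have G_eq: "?G \<omega> = (if x ?S \<omega> \<in> A then ennreal (\<delta> ?S \<omega>) else \<infinity>)" if "\<omega> \<in> space M" for \<omega>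
    using x_eq[OF that, of ?S] by (simp add: gap_H \<delta>_def)
  have wm: "w ?S \<in> borel_measurable M"
    unfolding w_def[abs_def] using lm[of ?S] prev_iter_measurable[OF xm] by (intro borel_measurable_Pair) auto
  have "(\<lambda>\<omega>. if x ?S \<omega> \<in> A then ennreal (indicator A (x ?S \<omega>) * stage_gap (\<beta> ?S) (w ?S \<omega>) (x ?S \<omega>)) else \<infinity>) \<in> borel_measurable M"
    using stage_gap_measurable[OF \<beta>_pos xS wm] xS by measurable
  then have Gm: "?G \<in> borel_measurable M"
    by (subst measurable_cong[OF G_eq]) (simp_all add: \<delta>_def indicator_def cong: if_cong)
  have "(\<integral>\<^sup>+ \<omega>. ?G \<omega> \<partial>M) = (\<integral>\<^sup>+ \<omega>. 1 * ?G \<omega> \<partial>M)" by simp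
  also have "\<dots> = (\<integral>\<^sup>+ \<omega>. 1 * nn_cond_exp M (Fil ?S) ?G \<omega> \<partial>M)"
    by (rule sub.nn_cond_exp_intg[symmetric]) (use Gm in auto)
  also have "\<dots> \<le> (\<integral>\<^sup>+ \<omega>. ennreal (\<epsilon>s ?S / 2) + ennreal (\<epsilon>s ?S / (2 * \<epsilon>s s)) * ennreal (\<delta> s \<omega>) \<partial>M)"
  proof (rule nn_integral_mono_AE)
    show "AE \<omega> in M. 1 * nn_cond_exp M (Fil ?S) ?G \<omega>
        \<le> ennreal (\<epsilon>s ?S / 2) + ennreal (\<epsilon>s ?S / (2 * \<epsilon>s s)) * ennreal (\<delta> s \<omega>)"
      using ce xA AE_space
    proof eventually_elim
      case (elim \<omega>)
      have d: "0 \<le> \<delta> s \<omega>" unfolding \<delta>_def by (rule stage_gap_nonneg[OF \<beta>_pos elim(2)])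
      have "1 * nn_cond_exp M (Fil ?S) ?G \<omega> \<le> ennreal (2 powi (- \<lfloor>real (m ?S \<omega>) / Kin ?S\<rfloor>)) *
           ennreal (stage_gap (\<beta> ?S) (w ?S \<omega>) (x s \<omega>))"
        using elim(1,2) unfolding X by (simp add: gap_H)
      also have "\<dots> = ennreal (2 powi (- \<lfloor>real (m ?S \<omega>) / Kin ?S\<rfloor>) * stage_gap (\<beta> ?S) (w ?S \<omega>) (x s \<omega>))"
        by (simp add: ennreal_mult')
      also have "\<dots> \<le> ennreal (\<epsilon>s ?S / 2 + \<epsilon>s ?S / (2 * \<epsilon>s s) * \<delta> s \<omega>)"
        by (rule ennreal_leI[OF contracted_start_gap[OF elim(3,2)]])
      also have "\<dots> = ennreal (\<epsilon>s ?S / 2) + ennreal (\<epsilon>s ?S / (2 * \<epsilon>s s)) * ennreal (\<delta> s \<omega>)"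
        using d \<epsilon>s_pos[of s] \<epsilon>s_pos[of ?S]
        by (subst ennreal_plus) (simp_all add: ennreal_mult[symmetric] del: times_divide_eq_left)
      finally show ?case .
    qed
  qed
  also have "\<dots> = ennreal (\<epsilon>s ?S / 2) + ennreal (\<epsilon>s ?S / (2 * \<epsilon>s s)) * (\<integral>\<^sup>+ \<omega>. ennreal (\<delta> s \<omega>) \<partial>M)"
  proof -
    have ws: "w s \<in> borel_measurable M"
      unfolding w_def[abs_def] using lm[of s] prev_iter_measurable[of s M] xm by (intro borel_measurable_Pair) auto
    have "(\<lambda>\<omega>. indicator A (x s \<omega>) * stage_gap (\<beta> s) (w s \<omega>) (x s \<omega>)) \<in> borel_measurable M"
      by (rule stage_gap_measurable[OF \<beta>_pos _ ws]) (use xm in auto)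
    then have dm: "(\<lambda>\<omega>. ennreal (indicator A (x s \<omega>) * \<delta> s \<omega>)) \<in> borel_measurable M"
      unfolding \<delta>_def by measurable
    have ae: "AE \<omega> in M. ennreal (\<delta> s \<omega>) = ennreal (indicator A (x s \<omega>) * \<delta> s \<omega>)"
      using xA by eventually_elim simp
    have "(\<integral>\<^sup>+ \<omega>. ennreal (\<epsilon>s ?S / 2) + ennreal (\<epsilon>s ?S / (2 * \<epsilon>s s)) * ennreal (\<delta> s \<omega>) \<partial>M)
      = (\<integral>\<^sup>+ \<omega>. ennreal (\<epsilon>s ?S / 2) + ennreal (\<epsilon>s ?S / (2 * \<epsilon>s s)) * ennreal (indicator A (x s \<omega>) * \<delta> s \<omega>) \<partial>M)"
      using ae by (intro nn_integral_cong_AE) (auto elim: eventually_mono)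
    also have "\<dots> = ennreal (\<epsilon>s ?S / 2) + ennreal (\<epsilon>s ?S / (2 * \<epsilon>s s)) * (\<integral>\<^sup>+ \<omega>. ennreal (indicator A (x s \<omega>) * \<delta> s \<omega>) \<partial>M)"
      using dm by (simp add: nn_integral_add nn_integral_cmult emeasure_space_1)
    also have "(\<integral>\<^sup>+ \<omega>. ennreal (indicator A (x s \<omega>) * \<delta> s \<omega>) \<partial>M) = (\<integral>\<^sup>+ \<omega>. ennreal (\<delta> s \<omega>) \<partial>M)"
      using ae by (intro nn_integral_cong_AE) (auto elim: eventually_mono)
    finally show ?thesis .
  qed
  also have "\<dots> \<le> ennreal (\<epsilon>s ?S / 2) + ennreal (\<epsilon>s ?S / (2 * \<epsilon>s s)) * ennreal (\<epsilon>s s)"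
    using gap by (intro add_left_mono mult_left_mono) auto
  also have "\<dots> = ennreal (\<epsilon>s ?S)"
    using \<epsilon>s_pos[of s] \<epsilon>s_pos[of ?S]
    by (simp add: ennreal_mult'[symmetric] ennreal_plus[symmetric] del: ennreal_plus)
  finally have G_int: "(\<integral>\<^sup>+ \<omega>. ?G \<omega> \<partial>M) \<le> ennreal (\<epsilon>s ?S)" .
  then have "(\<integral>\<^sup>+ \<omega>. ?G \<omega> \<partial>M) \<noteq> \<infinity>" by (auto simp: top_unique)
  from nn_integral_PInf_AE[OF Gm this] AE_space
  have xSA: "AE \<omega> in M. x ?S \<omega> \<in> A"
    by eventually_elim (auto simp: G_eq split: if_splits)
  have "(\<integral>\<^sup>+ \<omega>. ennreal (\<delta> ?S \<omega>) \<partial>M) \<le> (\<integral>\<^sup>+ \<omega>. ?G \<omega> \<partial>M)"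
    using xSA AE_space by (intro nn_integral_mono_AE) (auto simp: G_eq elim: eventually_elim2)
  with G_int have "(\<integral>\<^sup>+ \<omega>. ennreal (\<delta> ?S \<omega>) \<partial>M) \<le> ennreal (\<epsilon>s ?S)" by (rule order_trans[rotated])
  moreover have "\<forall>t\<le>?S. x t \<in> borel_measurable M"
    using xS xm by (auto simp: le_Suc_eq less_Suc_eq_le)
  ultimately show ?case using xSA by blast
qed

end

section \<open>Mean square estimates\<close>

text \<open>Optimising over the weight in Young's inequality gives the product bound, also when one factor is zero.\<close>

lemma le_mult_of_young:
  fixes a b c :: real
  assumes ab: "0 \<le> a" "0 \<le> b" and young: "\<And>t. 0 < t \<Longrightarrow> c \<le> (t * a\<^sup>2 + b\<^sup>2 / t) / 2"
  shows "c \<le> a * b"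
proof -
  have *: "c \<le> (a + e) * (b + e)" if e: "0 < e" for e
  proof -
    have ae: "0 < a + e" and be: "0 < b + e" using ab e by auto
    have "a\<^sup>2 \<le> (a + e)\<^sup>2" "b\<^sup>2 \<le> (b + e)\<^sup>2" using ab e by (auto intro: power_mono)
    then have "(b + e) / (a + e) * a\<^sup>2 \<le> (b + e) / (a + e) * (a + e)\<^sup>2"
      and "b\<^sup>2 / ((b + e) / (a + e)) \<le> (b + e)\<^sup>2 / ((b + e) / (a + e))"
      using ae be by (intro mult_left_mono divide_right_mono; simp)+
    moreover have "(b + e) / (a + e) * (a + e)\<^sup>2 = (a + e) * (b + e)"
      "(b + e)\<^sup>2 / ((b + e) / (a + e)) = (a + e) * (b + e)"
      using ae be by (simp_all add: power2_eq_square)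
    moreover have "c \<le> ((b + e) / (a + e) * a\<^sup>2 + b\<^sup>2 / ((b + e) / (a + e))) / 2"
      using ae be by (intro young) simp
    ultimately show ?thesis by argo
  qed
  have "((\<lambda>e. (a + e) * (b + e)) \<longlongrightarrow> (a + 0) * (b + 0)) (at_right 0)"
    by (intro tendsto_intros)
  then have "c \<le> (a + 0) * (b + 0)"
    by (rule tendsto_lowerbound) (use * in \<open>auto intro!: eventually_at_rightI[of 0 1]\<close>)
  then show ?thesis by simp
qed

context prob_space
begin

text \<open>A bound on the \<open>L\<^sup>2\<close> norm together with what is needed to work with it.\<close>

definition l2_le :: "('a \<Rightarrow> real) \<Rightarrow> real \<Rightarrow> bool" where
  "l2_le X a \<longleftrightarrow> 0 \<le> a \<and> X \<in> borel_measurable M \<and> integrable M (\<lambda>\<omega>. (X \<omega>)\<^sup>2)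
     \<and> (\<integral>\<omega>. (X \<omega>)\<^sup>2 \<partial>M) \<le> a\<^sup>2"

lemma l2_le_mult:
  assumes X: "l2_le X a" and Y: "l2_le Y b"
  shows "integrable M (\<lambda>\<omega>. X \<omega> * Y \<omega>)" and "(\<integral>\<omega>. X \<omega> * Y \<omega> \<partial>M) \<le> a * b"
proof -
  have ab: "0 \<le> a" "0 \<le> b" and [measurable]: "X \<in> borel_measurable M" "Y \<in> borel_measurable M"
    and int: "integrable M (\<lambda>\<omega>. (X \<omega>)\<^sup>2)" "integrable M (\<lambda>\<omega>. (Y \<omega>)\<^sup>2)"
    and le: "(\<integral>\<omega>. (X \<omega>)\<^sup>2 \<partial>M) \<le> a\<^sup>2" "(\<integral>\<omega>. (Y \<omega>)\<^sup>2 \<partial>M) \<le> b\<^sup>2"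
    using X Y by (auto simp: l2_le_def)
  have young: "x * y \<le> (t * x\<^sup>2 + y\<^sup>2 / t) / 2" if t: "0 < t" for x y t :: real
  proof -
    have "0 \<le> (t * x - y)\<^sup>2 / t" using t by simp
    then show ?thesis using t by (simp add: power2_eq_square field_simps)
  qed
  show I: "integrable M (\<lambda>\<omega>. X \<omega> * Y \<omega>)"
  proof (rule Bochner_Integration.integrable_bound)
    show "integrable M (\<lambda>\<omega>. (X \<omega>)\<^sup>2 + (Y \<omega>)\<^sup>2)" using int by (rule Bochner_Integration.integrable_add)
    have "\<bar>x * y\<bar> \<le> x\<^sup>2 + y\<^sup>2" for x y :: real
    proof -
      have "0 \<le> \<bar>x\<bar> * \<bar>y\<bar>" by simp
      then show ?thesis
        using sum_squares_bound[of "\<bar>x\<bar>" "\<bar>y\<bar>"] unfolding abs_mult power2_abs by linarith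
    qed
    then show "AE \<omega> in M. norm (X \<omega> * Y \<omega>) \<le> norm ((X \<omega>)\<^sup>2 + (Y \<omega>)\<^sup>2)"
      by simp
  qed measurable
  show "(\<integral>\<omega>. X \<omega> * Y \<omega> \<partial>M) \<le> a * b"
  proof (rule le_mult_of_young[OF ab])
    fix t :: real assume t: "0 < t"
    have "(\<integral>\<omega>. X \<omega> * Y \<omega> \<partial>M) \<le> (\<integral>\<omega>. (t * (X \<omega>)\<^sup>2 + (Y \<omega>)\<^sup>2 / t) / 2 \<partial>M)"
      using int by (intro integral_mono I young t) auto
    also have "\<dots> = (t * (\<integral>\<omega>. (X \<omega>)\<^sup>2 \<partial>M) + (\<integral>\<omega>. (Y \<omega>)\<^sup>2 \<partial>M) / t) / 2"
      using int by simp
    also have "\<dots> \<le> (t * a\<^sup>2 + b\<^sup>2 / t) / 2"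
      using le t by (intro divide_right_mono add_mono mult_left_mono) auto
    finally show "(\<integral>\<omega>. X \<omega> * Y \<omega> \<partial>M) \<le> (t * a\<^sup>2 + b\<^sup>2 / t) / 2" .
  qed
qed

lemma l2_le_add:
  assumes X: "l2_le X a" and Y: "l2_le Y b"
  shows "l2_le (\<lambda>\<omega>. X \<omega> + Y \<omega>) (a + b)"
proof -
  have ab: "0 \<le> a" "0 \<le> b" and m: "X \<in> borel_measurable M" "Y \<in> borel_measurable M"
    and int: "integrable M (\<lambda>\<omega>. (X \<omega>)\<^sup>2)" "integrable M (\<lambda>\<omega>. (Y \<omega>)\<^sup>2)"
    and le: "(\<integral>\<omega>. (X \<omega>)\<^sup>2 \<partial>M) \<le> a\<^sup>2" "(\<integral>\<omega>. (Y \<omega>)\<^sup>2 \<partial>M) \<le> b\<^sup>2"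
    using X Y by (auto simp: l2_le_def)
  note XY = l2_le_mult[OF X Y]
  have eq: "(X \<omega> + Y \<omega>)\<^sup>2 = (X \<omega>)\<^sup>2 + (Y \<omega>)\<^sup>2 + 2 * (X \<omega> * Y \<omega>)" for \<omega>
    by (simp add: power2_sum)
  have "(\<integral>\<omega>. (X \<omega> + Y \<omega>)\<^sup>2 \<partial>M) = (\<integral>\<omega>. (X \<omega>)\<^sup>2 \<partial>M) + (\<integral>\<omega>. (Y \<omega>)\<^sup>2 \<partial>M) + 2 * (\<integral>\<omega>. X \<omega> * Y \<omega> \<partial>M)"
    unfolding eq using int XY(1) by simp
  also have "\<dots> \<le> a\<^sup>2 + b\<^sup>2 + 2 * (a * b)"
    using le XY(2) by (intro add_mono) auto
  also have "\<dots> = (a + b)\<^sup>2" by (simp add: power2_sum)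
  finally show ?thesis
    using ab m int XY(1) unfolding l2_le_def eq by auto
qed

lemma l2_le_mono:
  assumes Y: "l2_le Y b" and X: "X \<in> borel_measurable M" and le: "AE \<omega> in M. 0 \<le> X \<omega> \<and> X \<omega> \<le> Y \<omega>"
  shows "l2_le X b"
proof -
  have int: "integrable M (\<lambda>\<omega>. (Y \<omega>)\<^sup>2)" using Y by (simp add: l2_le_def)
  have ae: "AE \<omega> in M. (X \<omega>)\<^sup>2 \<le> (Y \<omega>)\<^sup>2"
    using le by eventually_elim (auto intro: power_mono)
  have I: "integrable M (\<lambda>\<omega>. (X \<omega>)\<^sup>2)"
    by (rule Bochner_Integration.integrable_bound[OF int]) (use X ae in auto)
  have "(\<integral>\<omega>. (X \<omega>)\<^sup>2 \<partial>M) \<le> (\<integral>\<omega>. (Y \<omega>)\<^sup>2 \<partial>M)"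
    by (rule integral_mono_AE[OF I int ae])
  then show ?thesis using Y X I by (auto simp: l2_le_def)
qed

lemma l2_le_const: "0 \<le> c \<Longrightarrow> l2_le (\<lambda>_. c) c"
  by (simp add: l2_le_def prob_space)

lemma l2_le_divide:
  assumes "l2_le X a" "0 < c"
  shows "l2_le (\<lambda>\<omega>. X \<omega> / c) (a / c)"
  using assms by (auto simp: l2_le_def power_divide intro: divide_right_mono)

lemma l2_le_expectation:
  assumes "l2_le X a"
  shows "integrable M X" and "(\<integral>\<omega>. X \<omega> \<partial>M) \<le> a"
  using l2_le_mult[OF assms l2_le_const[of 1]] by simp_all

end

context ipalm
begin

lemma x_measurable: "x s \<in> borel_measurable M"
  and x_in_A: "AE \<omega> in M. x s \<omega> \<in> A"
  using expected_gap_induction[of s] by auto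

lemma lam_measurable_M: "lam s \<in> borel_measurable M"
  by (rule lam_measurable[of M s s]) (simp_all add: x_measurable)

lemma w_measurable: "w s \<in> borel_measurable M"
  unfolding w_def[abs_def]
  by (intro borel_measurable_Pair lam_measurable_M prev_iter_measurable x_measurable)

text \<open>Equal to \<open>\<delta>\<close> almost surely, but measurable and nonnegative everywhere.\<close>

definition clipped_gap :: "nat \<Rightarrow> 'w \<Rightarrow> real" where "clipped_gap s \<omega> = indicator A (x s \<omega>) * \<delta> s \<omega>"

lemma clipped_gap_eq: "x s \<omega> \<in> A \<Longrightarrow> clipped_gap s \<omega> = \<delta> s \<omega>"
  by (simp add: clipped_gap_def)

lemma clipped_gap_nonneg: "0 \<le> clipped_gap s \<omega>"
  unfolding clipped_gap_def \<delta>_def using stage_gap_nonneg[OF \<beta>_pos] by (simp add: indicator_def)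

lemma clipped_gap_measurable: "clipped_gap s \<in> borel_measurable M"
  unfolding clipped_gap_def[abs_def] \<delta>_def by (rule stage_gap_measurable[OF \<beta>_pos x_measurable w_measurable])

lemma clipped_gap_integrable: "integrable M (clipped_gap s)" and clipped_gap_expectation: "(\<integral>\<omega>. clipped_gap s \<omega> \<partial>M) \<le> \<epsilon>s s"
proof -
  have "(\<integral>\<^sup>+ \<omega>. ennreal (clipped_gap s \<omega>) \<partial>M) = (\<integral>\<^sup>+ \<omega>. ennreal (\<delta> s \<omega>) \<partial>M)"
    using x_in_A[of s] by (intro nn_integral_cong_AE) (auto simp: clipped_gap_eq elim: eventually_mono)
  then have le: "(\<integral>\<^sup>+ \<omega>. ennreal (clipped_gap s \<omega>) \<partial>M) \<le> ennreal (\<epsilon>s s)"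
    using expected_gap_induction[of s] by simp
  show I: "integrable M (clipped_gap s)"
    using le by (intro integrableI_nonneg clipped_gap_measurable) (auto simp: clipped_gap_nonneg intro: le_less_trans)
  have "ennreal (\<integral>\<omega>. clipped_gap s \<omega> \<partial>M) \<le> ennreal (\<epsilon>s s)"
    using le nn_integral_eq_integral[OF I] clipped_gap_nonneg by simp
  then show "(\<integral>\<omega>. clipped_gap s \<omega> \<partial>M) \<le> \<epsilon>s s"
    using \<epsilon>s_pos[of s] by (simp add: ennreal_le_iff)
qed

definition \<kappa> :: real where "\<kappa> = sqrt (\<epsilon>0 / \<beta>0)"
definition \<theta> :: real where "\<theta> = sqrt (\<eta> / \<rho>)"
definition err_bound :: "nat \<Rightarrow> real" where "err_bound s = sqrt 2 * \<kappa> * \<theta> ^ s"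
definition step_err :: "nat \<Rightarrow> 'w \<Rightarrow> real" where "step_err s \<omega> = sqrt (2 * clipped_gap s \<omega> / \<beta> s)"
text \<open>The bound on the \<open>L\<^sup>2\<close> distance from the solution at the start of stage \<open>s\<close>.\<close>

definition radius :: "nat \<Rightarrow> real" where "radius s = norm ((xinit, linit) - ws) + (\<Sum>t<s. err_bound t)"

lemma \<kappa>_pos: "0 < \<kappa>" and \<theta>_pos: "0 < \<theta>" and \<theta>_less: "\<theta> < 1"
  using pos by (auto simp: \<kappa>_def \<theta>_def real_sqrt_lt_1_iff)

lemma err_bound_nonneg: "0 \<le> err_bound s"
  using \<kappa>_pos \<theta>_pos by (simp add: err_bound_def)

lemma radius_nonneg: "0 \<le> radius s"
  by (simp add: radius_def err_bound_nonneg sum_nonneg)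

lemma gap_ratio: "2 * \<epsilon>s s / \<beta> s = (err_bound s)\<^sup>2" "\<epsilon>s s = \<beta> s * (\<kappa> * \<theta> ^ s)\<^sup>2"
proof -
  have k: "\<kappa>\<^sup>2 = \<epsilon>0 / \<beta>0" and t: "\<theta>\<^sup>2 = \<eta> / \<rho>" using pos by (simp_all add: \<kappa>_def \<theta>_def)
  have ts: "(\<theta> ^ s)\<^sup>2 = \<eta> ^ s / \<rho> ^ s"
    unfolding power_mult[symmetric] mult.commute[of s 2] unfolding power_mult t by (simp add: power_divide)
  show "\<epsilon>s s = \<beta> s * (\<kappa> * \<theta> ^ s)\<^sup>2"
    unfolding power_mult_distrib k ts \<epsilon>s_eq \<beta>_eq using pos by simp
  then show "2 * \<epsilon>s s / \<beta> s = (err_bound s)\<^sup>2"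
    using \<beta>_pos[of s] by (simp add: err_bound_def power_mult_distrib)
qed

lemma step_err_l2: "l2_le (step_err s) (err_bound s)"
proof -
  have sq: "(step_err s \<omega>)\<^sup>2 = 2 / \<beta> s * clipped_gap s \<omega>" for \<omega>
    using clipped_gap_nonneg[of s \<omega>] \<beta>_pos[of s] by (simp add: step_err_def)
  have "step_err s \<in> borel_measurable M"
    unfolding step_err_def[abs_def] using clipped_gap_measurable[of s] by measurable
  moreover have "(\<integral>\<omega>. (step_err s \<omega>)\<^sup>2 \<partial>M) \<le> (err_bound s)\<^sup>2"
    unfolding sq gap_ratio(1)[symmetric] using clipped_gap_expectation[of s] \<beta>_pos[of s]
    by (simp add: divide_right_mono)
  moreover have "integrable M (\<lambda>\<omega>. (step_err s \<omega>)\<^sup>2)"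
    unfolding sq using clipped_gap_integrable[of s] by simp
  ultimately show ?thesis using err_bound_nonneg by (simp add: l2_le_def)
qed

lemma step_error_AE:
  "AE \<omega> in M. norm (w (Suc s) \<omega> - ws) \<le> norm (w s \<omega> - ws) + step_err s \<omega>
     \<and> norm (w (Suc s) \<omega> - w s \<omega>) \<le> norm (w s \<omega> - res (\<beta> s) (w s \<omega>)) + step_err s \<omega>
     \<and> norm (w (Suc s) \<omega> - res (\<beta> s) (w s \<omega>)) \<le> step_err s \<omega>"
  using x_in_A[of s] AE_space
proof eventually_elim
  case (elim \<omega>)
  then show ?case
    using step_error[OF \<beta>_pos[of s] elim(1), of "w s \<omega>"] w_Suc[OF elim(2), of s]
    unfolding step_err_def clipped_gap_eq[OF elim(1)] \<delta>_def by simp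
qed

lemma dist_l2: "l2_le (\<lambda>\<omega>. norm (w s \<omega> - ws)) (radius s)"
proof (induction s)
  case 0
  have "l2_le (\<lambda>\<omega>. norm ((xinit, linit) - ws)) (radius 0)"
    by (simp add: radius_def l2_le_const)
  then show ?case
    by (rule l2_le_mono) (use w_measurable[of 0] AE_space w_0 in \<open>auto elim: eventually_mono\<close>)
next
  case (Suc s)
  have m: "(\<lambda>\<omega>. norm (w (Suc s) \<omega> - ws)) \<in> borel_measurable M"
    using w_measurable[of "Suc s"] by (intro borel_measurable_primitives)
  have "AE \<omega> in M. 0 \<le> norm (w (Suc s) \<omega> - ws) \<and> norm (w (Suc s) \<omega> - ws) \<le> norm (w s \<omega> - ws) + step_err s \<omega>"
    using step_error_AE[of s] by eventually_elim auto
  from l2_le_mono[OF l2_le_add[OF Suc step_err_l2[of s]] m this]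
  show ?case by (simp add: radius_def add.assoc)
qed

lemma step_norm_measurable: "(\<lambda>\<omega>. norm (w (Suc s) \<omega> - w s \<omega>)) \<in> borel_measurable M"
  using w_measurable[of "Suc s"] w_measurable[of s] by (intro borel_measurable_primitives)

text \<open>The step is bounded by the distance to the resolvent plus the error, and the former is at most the distance to the
solution; estimating the two endpoints separately would cost a factor two.\<close>

lemma step_norm_l2: "l2_le (\<lambda>\<omega>. norm (w (Suc s) \<omega> - w s \<omega>)) (radius (Suc s))"
proof -
  have "AE \<omega> in M. 0 \<le> norm (w (Suc s) \<omega> - w s \<omega>) \<and> norm (w (Suc s) \<omega> - w s \<omega>) \<le> norm (w s \<omega> - ws) + step_err s \<omega>"
    using step_error_AE[of s] x_in_A[of s]
  proof eventually_elim
    case (elim \<omega>)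
    then show ?case using step_error(4)[OF \<beta>_pos[of s] elim(2), of "w s \<omega>"] by auto
  qed
  from l2_le_mono[OF l2_le_add[OF dist_l2[of s] step_err_l2[of s]] step_norm_measurable this]
  show ?thesis by (simp add: radius_def add.assoc)
qed

lemma step_norm_l2_two:
  "l2_le (\<lambda>\<omega>. norm (w (Suc (Suc s)) \<omega> - w (Suc s) \<omega>)) (radius s / (1 + \<rho>) + err_bound s + err_bound (Suc s))"
proof -
  have r: "0 < 1 + \<rho>" using pos by simp
  have ratio: "\<beta> (Suc s) / \<beta> s = \<rho>" using \<beta>_pos[of s] by (simp add: \<beta>_Suc)
  have "AE \<omega> in M. 0 \<le> norm (w (Suc (Suc s)) \<omega> - w (Suc s) \<omega>) \<and> norm (w (Suc (Suc s)) \<omega> - w (Suc s) \<omega>)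
     \<le> norm (w s \<omega> - ws) / (1 + \<rho>) + step_err s \<omega> + step_err (Suc s) \<omega>"
    using step_error_AE[of s] step_error_AE[of "Suc s"]
  proof eventually_elim
    case (elim \<omega>)
    have "norm (w (Suc s) \<omega> - res (\<beta> (Suc s)) (w (Suc s) \<omega>))
      \<le> norm (w s \<omega> - ws) / (1 + \<rho>) + norm (w (Suc s) \<omega> - res (\<beta> s) (w s \<omega>))"
      using res_two_steps[OF \<beta>_pos[of s] \<beta>_pos[of "Suc s"], of "w (Suc s) \<omega>" "w s \<omega>"] unfolding ratio .
    then show ?case using elim by auto
  qed
  from l2_le_mono[OF l2_le_add[OF l2_le_add[OF l2_le_divide[OF dist_l2[of s] r] step_err_l2[of s]] step_err_l2[of "Suc s"]]
      step_norm_measurable this]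
  show ?thesis .
qed

definition R :: real where "R = norm ((xinit, linit) - ws) + 2 * \<kappa> / (1 - \<theta>)"

definition C0 :: real where "C0 = 2 * R\<^sup>2 + 2 * (norm ls)\<^sup>2 + 2 * (norm xs)\<^sup>2"

lemma geometric_partial: "(\<Sum>t<s. \<theta> ^ t) + \<theta> ^ s \<le> 1 / (1 - \<theta>)"
proof -
  have "(\<Sum>t<s. \<theta> ^ t) + \<theta> ^ s = (1 - \<theta> ^ Suc s) / (1 - \<theta>)"
    using \<theta>_less sum_gp_strict[of \<theta> "Suc s"] by simp
  also have "\<dots> \<le> 1 / (1 - \<theta>)"
    using \<theta>_less \<theta>_pos by (intro divide_right_mono) auto
  finally show ?thesis .
qed

text \<open>The constant \<open>R\<close> contains \<open>2\<close> where the partial sums contain \<open>sqrt 2\<close>, and it has the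
complete series. The remainder \<open>2 * \<kappa> * \<theta> ^ s\<close> absorbs the expected gap in \<open>excess_upper\<close>.\<close>

lemma radius_le: "radius s + 2 * \<kappa> * \<theta> ^ s \<le> R"
proof -
  have "(\<Sum>t<s. err_bound t) = sqrt 2 * \<kappa> * (\<Sum>t<s. \<theta> ^ t)"
    unfolding err_bound_def by (simp add: sum_distrib_left)
  also have "\<dots> \<le> 2 * \<kappa> * (\<Sum>t<s. \<theta> ^ t)"
    using \<kappa>_pos \<theta>_pos sqrt2_less_2 by (intro mult_right_mono) (auto intro: sum_nonneg)
  finally have "radius s + 2 * \<kappa> * \<theta> ^ s \<le> norm ((xinit, linit) - ws) + 2 * \<kappa> * ((\<Sum>t<s. \<theta> ^ t) + \<theta> ^ s)"
    by (simp add: radius_def algebra_simps)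
  also have "\<dots> \<le> norm ((xinit, linit) - ws) + 2 * \<kappa> * (1 / (1 - \<theta>))"
    using geometric_partial[of s] \<kappa>_pos by (intro add_left_mono mult_left_mono) auto
  finally show ?thesis by (simp add: R_def)
qed

lemma radius_le_R: "radius s \<le> R" and R_pos: "0 < R"
proof -
  have "0 < 2 * \<kappa> * \<theta> ^ s" using \<kappa>_pos \<theta>_pos by simp
  then show "radius s \<le> R" "0 < R" using radius_le[of s] radius_nonneg[of s] by linarith+
qed

text \<open>The gain of a factor \<open>\<rho>\<close>: as \<open>C0\<close> contains \<open>2 * R\<^sup>2\<close>, it suffices that \<open>1 / (1 + \<rho>)\<close> is at most
\<open>sqrt 2 * \<rho>\<close> and that \<open>1\<close> is at most \<open>2 * \<rho>\<close>, which holds for \<open>\<rho> > 1/2\<close>.\<close>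

lemma two_step_radius: "radius s / (1 + \<rho>) + err_bound s + err_bound (Suc s) \<le> \<rho> * sqrt C0"
proof -
  have s2: "sqrt 2 * sqrt 2 = (2::real)" by simp
  have s2': "4 / 3 \<le> sqrt (2::real)" by (rule real_le_rsqrt) (simp add: power2_eq_square)
  have r: "1 \<le> \<rho> * sqrt 2 * (1 + \<rho>)"
  proof -
    have "1/2 * (1 + 1/2) \<le> \<rho> * (1 + \<rho>)" using pos by (intro mult_mono) auto
    then have "(3/4) * (4/3) \<le> (\<rho> * (1 + \<rho>)) * sqrt 2" using s2' by (intro mult_mono) auto
    then show ?thesis by (simp add: algebra_simps)
  qed
  have r': "1 \<le> 2 * \<rho>" "0 < 1 + \<rho>" "1 / (1 + \<rho>) \<le> 1" "0 \<le> \<rho>" using pos by auto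
  let ?a = "norm ((xinit, linit) - ws)" and ?S = "\<Sum>t<s. \<theta> ^ t"
  have S: "0 \<le> ?S" using \<theta>_pos by (auto intro: sum_nonneg)
  have a: "?a / (1 + \<rho>) \<le> \<rho> * sqrt 2 * ?a"
    using mult_right_mono[OF r, of ?a] r' by (simp add: pos_divide_le_eq algebra_simps)
  have "(\<Sum>t<s. err_bound t) / (1 + \<rho>) \<le> (\<Sum>t<s. err_bound t)"
    using r' mult_left_mono[OF r'(3), of "\<Sum>t<s. err_bound t"] err_bound_nonneg by (simp add: sum_nonneg)
  then have "(\<Sum>t<s. err_bound t) / (1 + \<rho>) + err_bound s + err_bound (Suc s) \<le> sqrt 2 * \<kappa> * (?S + \<theta> ^ s + \<theta> ^ Suc s)"
    unfolding err_bound_def by (simp add: sum_distrib_left algebra_simps)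
  also have "?S + \<theta> ^ s + \<theta> ^ Suc s \<le> 1 / (1 - \<theta>)"
    using geometric_partial[of "Suc s"] by simp
  then have "sqrt 2 * \<kappa> * (?S + \<theta> ^ s + \<theta> ^ Suc s) \<le> 1 * (sqrt 2 * \<kappa> * (1 / (1 - \<theta>)))"
    unfolding mult_1 using \<kappa>_pos by (intro mult_left_mono) auto
  also have "\<dots> \<le> (2 * \<rho>) * (sqrt 2 * \<kappa> * (1 / (1 - \<theta>)))"
    using r' \<kappa>_pos \<theta>_less by (intro mult_right_mono) auto
  finally have "radius s / (1 + \<rho>) + err_bound s + err_bound (Suc s) \<le> \<rho> * sqrt 2 * ?a + (2 * \<rho>) * (sqrt 2 * \<kappa> * (1 / (1 - \<theta>)))"
    using a unfolding radius_def add_divide_distrib by linarith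
  also have "\<dots> = \<rho> * (sqrt 2 * R)" by (simp add: R_def algebra_simps)
  also have "\<dots> \<le> \<rho> * sqrt C0"
  proof -
    have "sqrt 2 * R = sqrt (2 * R\<^sup>2)" using R_pos by (simp add: real_sqrt_mult)
    also have "\<dots> \<le> sqrt C0" unfolding C0_def by simp
    finally show ?thesis using r' by (intro mult_left_mono) auto
  qed
  finally show ?thesis .
qed

lemma infdist_measurable: "(\<lambda>\<omega>. infdist (p2 (x s \<omega>)) K) \<in> borel_measurable M"
  by (rule borel_measurable_compose_continuous[OF _ x_measurable])
    (intro continuous_on_infdist p2_continuous)

lemma infdist_AE: "AE \<omega> in M. infdist (p2 (x s \<omega>)) K \<le> \<beta> s * norm (w (Suc s) \<omega> - w s \<omega>)"
  using x_in_A[of s] AE_space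
proof eventually_elim
  case (elim \<omega>)
  then show ?case using infdist_step_le[OF \<beta>_pos[of s] elim(1), of "w s \<omega>"] by (simp add: w_Suc)
qed

lemma infdist_integrable: "integrable M (\<lambda>\<omega>. infdist (p2 (x s \<omega>)) K)"
  and infdist_expectation: "(\<integral>\<omega>. infdist (p2 (x s \<omega>)) K \<partial>M) \<le> \<beta> s * (\<integral>\<omega>. norm (w (Suc s) \<omega> - w s \<omega>) \<partial>M)"
proof -
  have I: "integrable M (\<lambda>\<omega>. \<beta> s * norm (w (Suc s) \<omega> - w s \<omega>))"
    using l2_le_expectation(1)[OF step_norm_l2[of s]] by simp
  show J: "integrable M (\<lambda>\<omega>. infdist (p2 (x s \<omega>)) K)"
    by (rule Bochner_Integration.integrable_bound[OF I infdist_measurable])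
      (use infdist_AE[of s] in \<open>auto simp: infdist_nonneg elim!: eventually_mono\<close>)
  have "(\<integral>\<omega>. infdist (p2 (x s \<omega>)) K \<partial>M) \<le> (\<integral>\<omega>. \<beta> s * norm (w (Suc s) \<omega> - w s \<omega>) \<partial>M)"
    by (rule integral_mono_AE[OF J I infdist_AE])
  then show "(\<integral>\<omega>. infdist (p2 (x s \<omega>)) K \<partial>M) \<le> \<beta> s * (\<integral>\<omega>. norm (w (Suc s) \<omega> - w s \<omega>) \<partial>M)"
    by simp
qed

lemma infdist_bound: "(\<integral>\<omega>. infdist (p2 (x (Suc s) \<omega>)) K \<partial>M) \<le> \<beta> (Suc s) * (\<rho> * sqrt C0)"
proof -
  have "(\<integral>\<omega>. norm (w (Suc (Suc s)) \<omega> - w (Suc s) \<omega>) \<partial>M) \<le> \<rho> * sqrt C0"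
    using l2_le_expectation(2)[OF step_norm_l2_two[of s]] two_step_radius[of s] by linarith
  then have "\<beta> (Suc s) * (\<integral>\<omega>. norm (w (Suc (Suc s)) \<omega> - w (Suc s) \<omega>) \<partial>M) \<le> \<beta> (Suc s) * (\<rho> * sqrt C0)"
    using \<beta>_pos[of "Suc s"] by (intro mult_left_mono) auto
  then show ?thesis using infdist_expectation[of "Suc s"] by linarith
qed

text \<open>The objective error without the infeasibility term. It vanishes outside the domain, in accordance
with the value that \<open>real_of_ereal\<close> gives to \<open>\<infinity>\<close>.\<close>

definition excess :: "nat \<Rightarrow> 'w \<Rightarrow> real" where
  "excess s \<omega> = indicator A (x s \<omega>) * (q (x s \<omega>) + h1 (p1 (x s \<omega>)) - Fs)"

lemma excess_measurable: "excess s \<in> borel_measurable M"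
proof -
  have "(\<lambda>\<omega>. indicator A (x s \<omega>) * q (x s \<omega>)) \<in> borel_measurable M"
    using measurable_compose[OF x_measurable[of s] q_measurable] by simp
  moreover have "(\<lambda>\<omega>. h1 (p1 (x s \<omega>))) \<in> borel_measurable M"
    by (rule borel_measurable_compose_continuous[OF _ x_measurable])
      (rule continuous_on_compose2[OF h1_continuous p1_continuous], simp)
  moreover have "(\<lambda>\<omega>. indicator A (x s \<omega>) :: real) \<in> borel_measurable M"
    using measurable_compose[OF x_measurable[of s] borel_measurable_indicator[OF A_borel]] by simp
  moreover have "excess s \<omega> = indicator A (x s \<omega>) * q (x s \<omega>) + indicator A (x s \<omega>) * (h1 (p1 (x s \<omega>)) - Fs)" for \<omega>
    by (simp add: excess_def algebra_simps)
  ultimately show ?thesis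
    unfolding fun_eq_iff[THEN iffD2, of "excess s", rule_format]
    by (subst measurable_cong[where g = "\<lambda>\<omega>. indicator A (x s \<omega>) * q (x s \<omega>) + indicator A (x s \<omega>) * (h1 (p1 (x s \<omega>)) - Fs)"])
      (auto intro!: borel_measurable_add borel_measurable_times borel_measurable_diff)
qed

lemma excess_bounds_AE:
  "AE \<omega> in M. - (norm (snd ls) * infdist (p2 (x s \<omega>)) K) \<le> excess s \<omega>
     \<and> excess s \<omega> \<le> 2 * clipped_gap s \<omega> + \<beta> s * (Lh\<^sup>2 + (norm (w s \<omega> - ws))\<^sup>2 + (norm ls)\<^sup>2)"
  using x_in_A[of s]
proof eventually_elim
  case (elim \<omega>)
  then show ?case
    using objective_lower[OF elim] objective_upper[OF \<beta>_pos[of s] elim, of "w s \<omega>"]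
    by (simp add: excess_def clipped_gap_eq \<delta>_def)
qed

text \<open>As \<open>C0\<close> contains \<open>2 * R\<^sup>2\<close> and \<open>2 * (norm ls)\<^sup>2\<close>, the expectation of the bound in \<open>objective_upper\<close> is at most half of
\<open>\<beta> s * (\<epsilon>0 / \<beta>0 + 2 * Lh\<^sup>2 + C0)\<close>, and the factor \<open>1/2\<close> is at most \<open>\<rho>\<close>.\<close>

lemma excess_integrable: "integrable M (excess s)"
  and excess_lower: "- (norm (snd ls) * (\<integral>\<omega>. infdist (p2 (x s \<omega>)) K \<partial>M)) \<le> (\<integral>\<omega>. excess s \<omega> \<partial>M)"
  and excess_upper: "(\<integral>\<omega>. excess s \<omega> \<partial>M) \<le> \<rho> * (\<beta> s * (\<epsilon>0 / \<beta>0 + 2 * Lh\<^sup>2 + C0))"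
proof -
  let ?L = "\<lambda>\<omega>. - (norm (snd ls) * infdist (p2 (x s \<omega>)) K)"
  let ?U = "\<lambda>\<omega>. 2 * clipped_gap s \<omega> + \<beta> s * (Lh\<^sup>2 + (norm (w s \<omega> - ws))\<^sup>2 + (norm ls)\<^sup>2)"
  have IL: "integrable M ?L" using infdist_integrable[of s] by simp
  have sq: "integrable M (\<lambda>\<omega>. (norm (w s \<omega> - ws))\<^sup>2)" "(\<integral>\<omega>. (norm (w s \<omega> - ws))\<^sup>2 \<partial>M) \<le> (radius s)\<^sup>2"
    using dist_l2[of s] by (auto simp: l2_le_def)
  have IU: "integrable M ?U" using sq(1) clipped_gap_integrable[of s] by simp
  show I: "integrable M (excess s)"
  proof (rule Bochner_Integration.integrable_bound[OF _ excess_measurable])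
    show "integrable M (\<lambda>\<omega>. \<bar>?L \<omega>\<bar> + \<bar>?U \<omega>\<bar>)" by (rule Bochner_Integration.integrable_add[OF integrable_abs[OF IL] integrable_abs[OF IU]])
    show "AE \<omega> in M. norm (excess s \<omega>) \<le> norm (\<bar>?L \<omega>\<bar> + \<bar>?U \<omega>\<bar>)"
      using excess_bounds_AE[of s] by eventually_elim auto
  qed
  have "(\<integral>\<omega>. ?L \<omega> \<partial>M) \<le> (\<integral>\<omega>. excess s \<omega> \<partial>M)"
    by (rule integral_mono_AE[OF IL I]) (use excess_bounds_AE[of s] in \<open>auto elim: eventually_mono\<close>)
  then show "- (norm (snd ls) * (\<integral>\<omega>. infdist (p2 (x s \<omega>)) K \<partial>M)) \<le> (\<integral>\<omega>. excess s \<omega> \<partial>M)"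
    by simp
  have "(\<integral>\<omega>. excess s \<omega> \<partial>M) \<le> (\<integral>\<omega>. ?U \<omega> \<partial>M)"
    by (rule integral_mono_AE[OF I IU]) (use excess_bounds_AE[of s] in \<open>auto elim: eventually_mono\<close>)
  also have "\<dots> = 2 * (\<integral>\<omega>. clipped_gap s \<omega> \<partial>M) + \<beta> s * (Lh\<^sup>2 + (\<integral>\<omega>. (norm (w s \<omega> - ws))\<^sup>2 \<partial>M) + (norm ls)\<^sup>2)"
    using sq(1) clipped_gap_integrable[of s] by (simp add: prob_space)
  also have "\<dots> \<le> 2 * \<epsilon>s s + \<beta> s * (Lh\<^sup>2 + (radius s)\<^sup>2 + (norm ls)\<^sup>2)"
    using sq(2) clipped_gap_expectation[of s] \<beta>_pos[of s] by (intro add_mono mult_left_mono) auto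
  also have "\<dots> = \<beta> s * (Lh\<^sup>2 + (2 * (\<kappa> * \<theta> ^ s)\<^sup>2 + (radius s)\<^sup>2) + (norm ls)\<^sup>2)"
    unfolding gap_ratio(2) by (simp add: algebra_simps)
  also have "\<dots> \<le> \<beta> s * (Lh\<^sup>2 + R\<^sup>2 + (norm ls)\<^sup>2)"
  proof -
    have "2 * (\<kappa> * \<theta> ^ s)\<^sup>2 + (radius s)\<^sup>2 \<le> (radius s + 2 * \<kappa> * \<theta> ^ s)\<^sup>2"
      using radius_nonneg[of s] \<kappa>_pos \<theta>_pos by (simp add: power2_sum power_mult_distrib)
    also have "\<dots> \<le> R\<^sup>2"
      using radius_le[of s] radius_nonneg[of s] \<kappa>_pos \<theta>_pos by (intro power_mono) auto
    finally show ?thesis using \<beta>_pos[of s] by (intro mult_left_mono add_mono) auto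
  qed
  also have "\<dots> \<le> \<beta> s * (1/2 * (\<epsilon>0 / \<beta>0 + 2 * Lh\<^sup>2 + C0))"
    using \<beta>_pos[of s] pos by (intro mult_left_mono) (auto simp: C0_def)
  also have "\<dots> = 1/2 * (\<beta> s * (\<epsilon>0 / \<beta>0 + 2 * Lh\<^sup>2 + C0))" by simp
  also have "\<dots> \<le> \<rho> * (\<beta> s * (\<epsilon>0 / \<beta>0 + 2 * Lh\<^sup>2 + C0))"
    using \<beta>_pos[of s] pos by (intro mult_right_mono mult_nonneg_nonneg) (auto simp: C0_def)
  finally show "(\<integral>\<omega>. excess s \<omega> \<partial>M) \<le> \<rho> * (\<beta> s * (\<epsilon>0 / \<beta>0 + 2 * Lh\<^sup>2 + C0))" .
qed

text \<open>All displacements are estimated by the full step \<open>w (Suc s) \<omega> - w s \<omega>\<close>, and the current multiplier by its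
distance to \<open>ls\<close>.\<close>

lemma Ms_le:
  assumes \<omega>: "\<omega> \<in> space M"
  shows "Ms s \<omega> \<le> \<beta> s * ((4 + 1 / \<rho>\<^sup>2 + 1 / (2 * \<rho> - 1)) * (norm (w (Suc s) \<omega> - w s \<omega>))\<^sup>2
           + Lh\<^sup>2 + 2 * (norm (w s \<omega> - ws))\<^sup>2 + 2 * (norm ls)\<^sup>2)"
proof -
  let ?b = "\<beta> s" and ?b' = "\<beta> (Suc s)" and ?l = "lam s \<omega>" and ?l' = "lam (Suc s) \<omega>"
  let ?W = "norm (w (Suc s) \<omega> - w s \<omega>)"
  define D where "D = norm (?l' - ?l)"
  have b: "0 < ?b" "0 < ?b'" by (rule \<beta>_pos)+
  have sw: "snd (w s \<omega>) = ?l" "snd (w (Suc s) \<omega>) = ?l'" "fst (w (Suc s) \<omega>) = x s \<omega>"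
    by (simp_all add: w_def prev_iter_def)
  have split: "?W\<^sup>2 = (norm (fst (w s \<omega>) - x s \<omega>))\<^sup>2 + D\<^sup>2"
    unfolding norm_prod_sq[of "w (Suc s) \<omega> - w s \<omega>"] D_def by (simp add: sw norm_minus_commute)
  have DW: "D\<^sup>2 \<le> ?W\<^sup>2" "(norm (fst (w s \<omega>) - x s \<omega>))\<^sup>2 \<le> ?W\<^sup>2" unfolding split by simp_all
  have D0: "0 \<le> D" by (simp add: D_def)
  have T2: "(?b - ?b') / 2 * (norm (argm (p (x s \<omega>)) ?l' ?b' - ?l'))\<^sup>2 \<le> ?b * (1 / \<rho>\<^sup>2 * ?W\<^sup>2)"
  proof -
    have l': "argm (p (x s \<omega>)) ?l ?b = ?l'" using lam_Suc[OF \<omega>, of s] by (simp add: p_def)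
    have "?b' * norm (argm (p (x s \<omega>)) ?l' ?b' - ?l') \<le> ?b * D"
      using argm_step_le[OF b, of "p (x s \<omega>)" ?l] unfolding l' D_def .
    then have "\<rho> * norm (argm (p (x s \<omega>)) ?l' ?b' - ?l') \<le> D"
      using b by (simp add: \<beta>_Suc mult.assoc mult.left_commute[of \<rho>])
    then have "norm (argm (p (x s \<omega>)) ?l' ?b' - ?l') \<le> D / \<rho>"
      using pos by (simp add: pos_le_divide_eq mult.commute)
    then have "(norm (argm (p (x s \<omega>)) ?l' ?b' - ?l'))\<^sup>2 \<le> (D / \<rho>)\<^sup>2"
      by (intro power_mono) auto
    also have "\<dots> \<le> 1 / \<rho>\<^sup>2 * ?W\<^sup>2" using DW by (simp add: power_divide divide_right_mono)
    finally have "(?b - ?b') / 2 * (norm (argm (p (x s \<omega>)) ?l' ?b' - ?l'))\<^sup>2 \<le> ?b * (1 / \<rho>\<^sup>2 * ?W\<^sup>2)"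
      using b \<beta>_between[of s] by (intro mult_mono) auto
    then show ?thesis .
  qed
  have T3: "?b\<^sup>2 / (2 * ?b' - ?b) * (norm (fst (w s \<omega>) - x s \<omega>))\<^sup>2 \<le> ?b * (1 / (2 * \<rho> - 1) * ?W\<^sup>2)"
  proof -
    have "2 * ?b' - ?b = ?b * (2 * \<rho> - 1)" by (simp add: \<beta>_Suc algebra_simps)
    then have "?b\<^sup>2 / (2 * ?b' - ?b) = ?b * (1 / (2 * \<rho> - 1))"
      using b by (simp add: power2_eq_square)
    moreover have "?b * (1 / (2 * \<rho> - 1)) * (norm (fst (w s \<omega>) - x s \<omega>))\<^sup>2 \<le> ?b * (1 / (2 * \<rho> - 1)) * ?W\<^sup>2"
      using DW b pos by (intro mult_left_mono) auto
    ultimately show ?thesis by (simp add: mult.assoc)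
  qed
  have l2: "(norm ?l)\<^sup>2 \<le> 2 * (norm (w s \<omega> - ws))\<^sup>2 + 2 * (norm ls)\<^sup>2"
  proof -
    have "(norm (?l - ls))\<^sup>2 \<le> (norm (w s \<omega> - ws))\<^sup>2"
      unfolding norm_prod_sq[of "w s \<omega> - ws"] by (simp add: sw ws_def)
    then show ?thesis using norm_sq_le_twice[of ?l ls] by linarith
  qed
  have T4: "D * sqrt (((?b + ?b') * Lh + norm (?b *\<^sub>R fst ?l - ?b' *\<^sub>R fst ?l'))\<^sup>2
                + (norm (?b *\<^sub>R snd ?l - ?b' *\<^sub>R snd ?l'))\<^sup>2)
      \<le> ?b * (3 * D\<^sup>2 + Lh\<^sup>2 + (norm ?l)\<^sup>2)"
  proof -
    let ?a = "(?b + ?b') * Lh" and ?v = "?b *\<^sub>R ?l - ?b' *\<^sub>R ?l'"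
    have a: "0 \<le> ?a" using b Lh_nonneg by simp
    have "sqrt ((?a + norm (fst ?v))\<^sup>2 + (norm (snd ?v))\<^sup>2) \<le> ?a + norm ?v"
    proof (rule real_le_lsqrt)
      show "0 \<le> ?a + norm ?v" using a by simp
      have "?a * norm (fst ?v) \<le> ?a * norm ?v" using a norm_fst_le_norm by (intro mult_left_mono)
      then show "(?a + norm (fst ?v))\<^sup>2 + (norm (snd ?v))\<^sup>2 \<le> (?a + norm ?v)\<^sup>2"
        unfolding power2_sum norm_prod_sq[of ?v] by linarith
    qed
    also have "norm ?v \<le> ?b * norm ?l + ?b' * norm ?l'"
      using norm_triangle_ineq4[of "?b *\<^sub>R ?l" "?b' *\<^sub>R ?l'"] b by simp
    also have "?b' * norm ?l' \<le> ?b * (norm ?l + D)"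
      using b \<beta>_between[of s] norm_triangle_ineq[of "?l' - ?l" ?l] unfolding D_def
      by (intro mult_mono) auto
    also have "?a \<le> (2 * ?b) * Lh" using \<beta>_between[of s] Lh_nonneg by (intro mult_right_mono) auto
    finally have "sqrt ((?a + norm (fst ?v))\<^sup>2 + (norm (snd ?v))\<^sup>2) \<le> ?b * (2 * Lh + 2 * norm ?l + D)"
      by (simp add: algebra_simps)
    then have "D * sqrt ((?a + norm (fst ?v))\<^sup>2 + (norm (snd ?v))\<^sup>2) \<le> D * (?b * (2 * Lh + 2 * norm ?l + D))"
      using D0 by (intro mult_left_mono)
    also have "\<dots> = ?b * (2 * D * Lh + 2 * D * norm ?l + D\<^sup>2)" by (simp add: algebra_simps power2_eq_square)
    also have "\<dots> \<le> ?b * ((D\<^sup>2 + Lh\<^sup>2) + (D\<^sup>2 + (norm ?l)\<^sup>2) + D\<^sup>2)"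
      using b sum_squares_bound[of D Lh] sum_squares_bound[of D "norm ?l"] by (intro mult_left_mono add_mono) auto
    finally show ?thesis by (simp add: algebra_simps)
  qed
  have "Ms s \<omega> \<le> ?b * D\<^sup>2 + ?b * (1 / \<rho>\<^sup>2 * ?W\<^sup>2) + ?b * (1 / (2 * \<rho> - 1) * ?W\<^sup>2) + ?b * (3 * D\<^sup>2 + Lh\<^sup>2 + (norm ?l)\<^sup>2)"
    unfolding Ms_eq[OF \<omega>] sw using T2 T3 T4 unfolding D_def[symmetric] by linarith
  also have "\<dots> = ?b * (4 * D\<^sup>2 + 1 / \<rho>\<^sup>2 * ?W\<^sup>2 + 1 / (2 * \<rho> - 1) * ?W\<^sup>2 + Lh\<^sup>2 + (norm ?l)\<^sup>2)"
    by (simp add: algebra_simps)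
  also have "\<dots> \<le> ?b * (4 * ?W\<^sup>2 + 1 / \<rho>\<^sup>2 * ?W\<^sup>2 + 1 / (2 * \<rho> - 1) * ?W\<^sup>2 + Lh\<^sup>2
      + (2 * (norm (w s \<omega> - ws))\<^sup>2 + 2 * (norm ls)\<^sup>2))"
    using b DW l2 pos by (intro mult_left_mono add_mono) auto
  finally show ?thesis by (simp add: distrib_right add.assoc)
qed

text \<open>The factor of \<open>\<beta> s\<close> in the bound of the expectation of \<open>M\<^sub>s\<close>, as it occurs in \<open>c2\<close>.\<close>

definition CM :: real where
  "CM = (11 + 2 / \<rho>\<^sup>2) * (Lh\<^sup>2 + 4 * C0) + 4 / (2 * \<rho> - 1) * C0"

lemma Ms_integrable: "integrable M (Ms s)" and Ms_expectation: "(\<integral>\<omega>. Ms s \<omega> \<partial>M) \<le> \<beta> s * CM"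
proof -
  let ?c = "4 + 1 / \<rho>\<^sup>2 + 1 / (2 * \<rho> - 1)"
  let ?U = "\<lambda>\<omega>. \<beta> s * (?c * (norm (w (Suc s) \<omega> - w s \<omega>))\<^sup>2
           + Lh\<^sup>2 + 2 * (norm (w s \<omega> - ws))\<^sup>2 + 2 * (norm ls)\<^sup>2)"
  have a: "integrable M (\<lambda>\<omega>. (norm (w s \<omega> - ws))\<^sup>2)" "(\<integral>\<omega>. (norm (w s \<omega> - ws))\<^sup>2 \<partial>M) \<le> (radius s)\<^sup>2"
    using dist_l2[of s] by (auto simp: l2_le_def)
  have b: "integrable M (\<lambda>\<omega>. (norm (w (Suc s) \<omega> - w s \<omega>))\<^sup>2)"
    "(\<integral>\<omega>. (norm (w (Suc s) \<omega> - w s \<omega>))\<^sup>2 \<partial>M) \<le> (radius (Suc s))\<^sup>2"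
    using step_norm_l2[of s] by (auto simp: l2_le_def)
  have R2: "(radius t)\<^sup>2 \<le> R\<^sup>2" for t using radius_le_R[of t] radius_nonneg[of t] by (rule power_mono)
  have c: "0 \<le> ?c" using pos by simp
  have IU: "integrable M ?U" using a(1) b(1) by simp
  have m: "Ms s \<in> borel_measurable M" by (rule Ms_measurable[OF refl x_measurable])
  show I: "integrable M (Ms s)"
    by (rule Bochner_Integration.integrable_bound[OF IU m])
      (use Ms_le[of _ s] Ms_nonneg[of _ s] AE_space in \<open>fastforce elim!: eventually_mono\<close>)
  have "(\<integral>\<omega>. Ms s \<omega> \<partial>M) \<le> (\<integral>\<omega>. ?U \<omega> \<partial>M)"
    by (rule integral_mono[OF I IU Ms_le])
  also have "\<dots> = \<beta> s * (?c * (\<integral>\<omega>. (norm (w (Suc s) \<omega> - w s \<omega>))\<^sup>2 \<partial>M) + Lh\<^sup>2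
      + 2 * (\<integral>\<omega>. (norm (w s \<omega> - ws))\<^sup>2 \<partial>M) + 2 * (norm ls)\<^sup>2)"
    using a(1) b(1) by (simp add: prob_space)
  also have "\<dots> \<le> \<beta> s * (?c * R\<^sup>2 + Lh\<^sup>2 + 2 * R\<^sup>2 + 2 * (norm ls)\<^sup>2)"
    using a(2) b(2) R2[of s] R2[of "Suc s"] c \<beta>_pos[of s] by (intro mult_left_mono add_mono) auto
  also have "\<dots> \<le> \<beta> s * CM"
  proof (rule mult_left_mono)
    define u v where "u = 1 / \<rho>\<^sup>2" and "v = 1 / (2 * \<rho> - 1)"
    have uv: "0 \<le> u" "0 \<le> v" using pos by (auto simp: u_def v_def)
    have C: "2 * R\<^sup>2 + 2 * (norm ls)\<^sup>2 \<le> C0" "R\<^sup>2 \<le> C0" "0 \<le> C0" by (auto simp: C0_def)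
    have "?c * R\<^sup>2 \<le> ?c * C0" by (rule mult_left_mono[OF C(2) c])
    also have "\<dots> = 4 * C0 + u * C0 + v * C0" by (simp add: u_def v_def distrib_right)
    finally have "?c * R\<^sup>2 + Lh\<^sup>2 + 2 * R\<^sup>2 + 2 * (norm ls)\<^sup>2 \<le> 5 * C0 + u * C0 + v * C0 + Lh\<^sup>2"
      using C by linarith
    also have "\<dots> \<le> 11 * Lh\<^sup>2 + 44 * C0 + 2 * (u * Lh\<^sup>2) + 8 * (u * C0) + 4 * (v * C0)"
    proof -
      have "0 \<le> u * C0" "0 \<le> v * C0" "0 \<le> u * Lh\<^sup>2" "0 \<le> Lh\<^sup>2" using uv C by auto
      then show ?thesis using C(3) by linarith
    qed
    also have "\<dots> = CM" by (simp add: CM_def u_def v_def algebra_simps)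
    finally show "?c * R\<^sup>2 + Lh\<^sup>2 + 2 * R\<^sup>2 + 2 * (norm ls)\<^sup>2 \<le> CM" .
  qed (use \<beta>_pos[of s] in simp)
  finally show "(\<integral>\<omega>. Ms s \<omega> \<partial>M) \<le> \<beta> s * CM" .
qed

end

section \<open>Iteration counts\<close>

lemma geometric_sum_inverse:
  fixes q :: real
  assumes "0 < q" "q < 1"
  shows "(\<Sum>t<s. 1 / q ^ Suc t) \<le> 1 / q ^ s / (1 - q)"
proof (induction s)
  case (Suc s)
  have "(\<Sum>t<Suc s. 1 / q ^ Suc t) \<le> 1 / q ^ s / (1 - q) + 1 / q ^ Suc s"
    using Suc by simp
  also have "\<dots> = 1 / q ^ Suc s / (1 - q)"
    using assms by (simp add: field_simps)
  finally show ?case .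
qed (use assms in simp)

text \<open>The logarithmic factor \<open>real t * a + b\<close> is at most \<open>s * (a + b)\<close>, and \<open>s\<close> is at most the logarithm of
\<open>c1 / (\<epsilon> * \<rho>)\<close> divided by \<open>ln (1 / \<rho>)\<close>. In the sum of the \<open>k t\<close> the geometric part is dominated by its last
term, where \<open>\<epsilon> < c1 * \<rho> ^ s\<close> is used without loss; the constant part is estimated by
\<open>ln y \<le> y powr l / l\<close>.\<close>

lemma iteration_count_sum:
  fixes \<beta>0 \<rho> \<sigma> w l c1 \<epsilon> a b :: real and k :: "nat \<Rightarrow> real" and e :: "nat \<Rightarrow> real"
  assumes pos: "0 < \<beta>0" "0 < \<rho>" "\<rho> < 1" "0 \<le> \<sigma>" "0 < w" "0 < l" "0 < \<epsilon>" "0 \<le> a" "0 \<le> b"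
    and k: "\<And>t. 0 \<le> k t" "\<And>t. k t \<le> w / (\<beta>0 * \<rho> ^ Suc t) powr l + \<sigma>"
    and e: "\<And>t. e t \<le> k t * (real t * a + b)"
    and s: "1 \<le> s" "\<epsilon> < c1 * \<rho> ^ s"
  shows "(\<Sum>t<s. e t) \<le> (a + b) / ln (1 / \<rho>) * (\<sigma> * c1 powr l / (\<rho> powr l * l * ln (1 / \<rho>))
                 + w * c1 powr l / (\<beta>0 powr l * (1 - \<rho> powr l))) / \<epsilon> powr l * ln (c1 / (\<epsilon> * \<rho>))"
proof -
  define L where "L = ln (1 / \<rho>)"
  define y where "y = c1 / (\<epsilon> * \<rho>)"
  define q where "q = \<rho> powr l"
  define S where "S = \<sigma> * c1 powr l / (\<rho> powr l * l * L) + w * c1 powr l / (\<beta>0 powr l * (1 - \<rho> powr l))"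
  have L: "0 < L" using pos by (simp add: L_def)
  have q: "0 < q" "q < 1" using pos powr_less_mono2[of l \<rho> 1] by (simp_all add: q_def)
  have "0 < c1 * \<rho> ^ s" using s pos by linarith
  then have c1: "0 < c1" using pos by (simp add: zero_less_mult_iff)
  have y: "0 < y" using c1 pos by (simp add: y_def)
  have ratio: "(1 / \<rho>) ^ s < c1 / \<epsilon>"
    using s(2) pos by (simp add: power_one_over field_simps)
  have "c1 / \<epsilon> \<le> y" using pos c1 by (simp add: y_def field_simps)
  with ratio have "(1 / \<rho>) ^ s \<le> y" by linarith
  then have "ln ((1 / \<rho>) ^ s) \<le> ln y" using pos y by (subst ln_le_cancel_iff) auto
  then have sL: "real s * L \<le> ln y" using pos by (simp add: ln_realpow L_def)
  then have s_le: "real s \<le> ln y / L" using L by (simp add: pos_le_divide_eq)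
  have "ln (y powr l) \<le> y powr l - 1" using y by (intro ln_le_minus_one) simp
  then have "l * ln y \<le> y powr l" using y by (simp add: ln_powr)
  then have "ln y \<le> y powr l / l" using pos by (simp add: pos_le_divide_eq mult.commute)
  then have "real s \<le> y powr l / l / L" using s_le L by (meson divide_right_mono less_imp_le order_trans)
  moreover have "y powr l = c1 powr l / (\<epsilon> powr l * \<rho> powr l)"
    using c1 pos by (simp add: y_def powr_divide powr_mult)
  ultimately have "real s \<le> c1 powr l / (\<epsilon> powr l * \<rho> powr l) / l / L" by simp
  from mult_left_mono[OF this pos(4)]
  have sum_\<sigma>: "real s * \<sigma> \<le> \<sigma> * c1 powr l / (\<rho> powr l * l * L) / \<epsilon> powr l"
    by (simp add: mult_ac)
  have "(\<Sum>t<s. w / (\<beta>0 * \<rho> ^ Suc t) powr l) = w / \<beta>0 powr l * (\<Sum>t<s. 1 / q ^ Suc t)"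
  proof -
    have "(\<beta>0 * \<rho> ^ Suc t) powr l = \<beta>0 powr l * q ^ Suc t" for t
    proof -
      have "(\<rho> ^ Suc t) powr l = q ^ Suc t"
        unfolding q_def using pos by (simp add: powr_power powr_realpow[symmetric] powr_powr mult.commute del: power_Suc)
      then show ?thesis using pos by (simp add: powr_mult del: power_Suc)
    qed
    then show ?thesis by (simp add: sum_distrib_left del: power_Suc)
  qed
  also have "\<dots> \<le> w / \<beta>0 powr l * (1 / q ^ s / (1 - q))"
    using geometric_sum_inverse[OF q, of s] pos by (intro mult_left_mono) auto
  also have "\<dots> \<le> w / \<beta>0 powr l * ((c1 / \<epsilon>) powr l / (1 - q))"
  proof -
    have "1 / q ^ s = ((1 / \<rho>) ^ s) powr l"
      unfolding q_def using pos by (simp add: powr_power powr_realpow[symmetric] powr_powr powr_divide mult.commute power_one_over)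
    also have "\<dots> \<le> (c1 / \<epsilon>) powr l" using ratio pos by (intro powr_mono2) auto
    finally show ?thesis using q pos by (intro mult_left_mono divide_right_mono) auto
  qed
  also have "\<dots> = w * c1 powr l / (\<beta>0 powr l * (1 - \<rho> powr l)) / \<epsilon> powr l"
    using c1 pos by (simp add: powr_divide q_def mult_ac)
  finally have sum_w: "(\<Sum>t<s. w / (\<beta>0 * \<rho> ^ Suc t) powr l) \<le> w * c1 powr l / (\<beta>0 powr l * (1 - \<rho> powr l)) / \<epsilon> powr l" .
  have "(\<Sum>t<s. k t) \<le> (\<Sum>t<s. w / (\<beta>0 * \<rho> ^ Suc t) powr l + \<sigma>)"
    by (rule sum_mono) (rule k(2))
  also have "\<dots> = (\<Sum>t<s. w / (\<beta>0 * \<rho> ^ Suc t) powr l) + real s * \<sigma>" by (simp add: sum.distrib)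
  also have "\<dots> \<le> S / \<epsilon> powr l"
    using sum_w sum_\<sigma> unfolding S_def add_divide_distrib by linarith
  finally have sum_k: "(\<Sum>t<s. k t) \<le> S / \<epsilon> powr l" .
  have sum_k0: "0 \<le> (\<Sum>t<s. k t)" by (rule sum_nonneg) (rule k(1))
  have "(\<Sum>t<s. e t) \<le> (\<Sum>t<s. k t * (real s * (a + b)))"
  proof (rule sum_mono)
    fix t assume t: "t \<in> {..<s}"
    have "real t * a \<le> real s * a" using t pos by (intro mult_right_mono) auto
    moreover have "1 * b \<le> real s * b" using s pos by (intro mult_right_mono) auto
    ultimately have "real t * a + b \<le> real s * (a + b)" by (simp add: distrib_left)
    then show "e t \<le> k t * (real s * (a + b))"
      using e[of t] mult_left_mono[OF _ k(1)[of t]] by (meson order_trans)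
  qed
  also have "\<dots> = (\<Sum>t<s. k t) * (real s * (a + b))" by (simp add: sum_distrib_right)
  also have "\<dots> \<le> S / \<epsilon> powr l * (ln y / L * (a + b))"
    using sum_k sum_k0 s_le pos by (intro mult_mono mult_right_mono) auto
  also have "\<dots> = (a + b) / L * S / \<epsilon> powr l * ln y" by (simp add: mult_ac)
  finally show ?thesis unfolding S_def L_def y_def .
qed

context ipalm
begin

text \<open>The witness \<open>k\<close> for the least number of inner iterations is \<open>K\<^sub>s\<close> times a binary logarithm, both rounded up.\<close>

lemma m_le:
  assumes \<omega>: "\<omega> \<in> space M"
  shows "real (m (Suc s) \<omega>) \<le> Kin (Suc s) * (log 2 (4 / \<eta> + 2 * Ms s \<omega> / \<epsilon>s (Suc s)) + 1) + 1"
proof -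
  let ?Y = "4 / \<eta> + 2 * Ms s \<omega> / \<epsilon>s (Suc s)" and ?K = "Kin (Suc s)"
  have e: "0 < \<epsilon>s (Suc s)" by (rule \<epsilon>s_pos)
  have K: "0 < ?K" using Kin_ge[of "Suc s"] by linarith
  have "1 < 4 / \<eta>" using pos by (simp add: field_simps)
  moreover have "0 \<le> 2 * Ms s \<omega> / \<epsilon>s (Suc s)" using Ms_nonneg[OF \<omega>, of s] e by simp
  ultimately have Y: "1 < ?Y" by linarith
  then have lY: "0 < log 2 ?Y" by simp
  define j where "j = nat \<lceil>log 2 ?Y\<rceil>"
  have j: "log 2 ?Y \<le> real j" "real j \<le> log 2 ?Y + 1" "1 \<le> j"
    using lY unfolding j_def by linarith+
  define k where "k = nat \<lceil>?K * real j\<rceil>"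
  have Kj: "0 < ?K * real j" using K j by simp
  have k: "?K * real j \<le> real k" "real k \<le> ?K * real j + 1"
    using Kj unfolding k_def by linarith+
  have k0: "0 < k" using k(1) Kj by (cases k) auto
  have "real j \<le> real k / ?K" using k K by (simp add: pos_le_divide_eq mult.commute)
  then have fl: "int j \<le> \<lfloor>real k / ?K\<rfloor>" by linarith
  have "?Y = 2 powr (log 2 ?Y)" using Y by simp
  also have "\<dots> \<le> 2 powr real j" using j by (intro powr_mono) auto
  also have "\<dots> = 2 powi int j" by (simp add: powr_realpow)
  also have "\<dots> \<le> 2 powi \<lfloor>real k / ?K\<rfloor>" by (rule power_int_increasing[OF fl]) simp
  finally have "?Y \<le> 2 powi \<lfloor>real k / ?K\<rfloor>" .
  then have "?Y * (\<epsilon>s (Suc s) / 2) \<le> 2 powi \<lfloor>real k / ?K\<rfloor> * (\<epsilon>s (Suc s) / 2)"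
    using e by (intro mult_right_mono) auto
  moreover have "?Y * (\<epsilon>s (Suc s) / 2) = 2 * \<epsilon>s s + Ms s \<omega>"
    using e pos by (simp add: distrib_right \<epsilon>s_eq)
  ultimately have "0 < k \<and> 2 * \<epsilon>s s + Ms s \<omega> \<le> 2 powi \<lfloor>real k / ?K\<rfloor> * \<epsilon>s (Suc s) / 2"
    using k0 by simp
  then have "m (Suc s) \<omega> \<le> k"
    unfolding m_Suc[OF \<omega>] Ms_def p_eq by (rule Least_le)
  then have "real (m (Suc s) \<omega>) \<le> real k" by simp
  also have "\<dots> \<le> ?K * (log 2 ?Y + 1) + 1"
    using k(2) mult_left_mono[OF j(2), of ?K] K by linarith
  finally show ?thesis .
qed

lemma m_measurable_M: "(\<lambda>\<omega>. real (m s \<omega>)) \<in> borel_measurable M"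
proof -
  have "subalgebra M (Fil s)"
    by (rule subalgebra_Fil) (rule x_measurable lam_measurable_M)+
  from measurable_from_subalg[OF this m_measurable]
  show ?thesis by (rule measurable_compose) simp
qed

text \<open>Jensen's inequality for the logarithm in the form of the tangent at \<open>y0\<close>, an upper bound of the
expectation of \<open>Y\<close>; the same tangent shows integrability.\<close>

lemma m_integrable_and_expectation:
  defines "X \<equiv> 2 * \<beta>0 * CM / (\<epsilon>0 * \<eta>)"
  shows "integrable M (\<lambda>\<omega>. real (m (Suc s) \<omega>))" (is ?I)
    and "(\<integral>\<omega>. real (m (Suc s) \<omega>) \<partial>M)
      \<le> Kin (Suc s) * (real s * log 2 (\<rho> / \<eta>) + (log 2 (4 / \<eta> + X) + 2))" (is ?E)
proof -
  let ?K = "Kin (Suc s)" and ?r = "(\<rho> / \<eta>) ^ s"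
  define Y where "Y \<omega> = 4 / \<eta> + 2 * Ms s \<omega> / \<epsilon>s (Suc s)" for \<omega>
  define y0 where "y0 = ?r * (4 / \<eta> + X)"
  define G where "G \<omega> = ?K * (log 2 y0 + (Y \<omega> / y0 - 1) / ln 2 + 1) + 1" for \<omega>
  have K: "1 \<le> ?K" by (rule Kin_ge)
  have C0: "0 \<le> C0" by (simp add: C0_def)
  have CM: "0 \<le> CM" using pos C0 unfolding CM_def by (intro add_nonneg_nonneg mult_nonneg_nonneg) auto
  have X: "0 \<le> X" using CM pos by (simp add: X_def)
  have r1: "1 \<le> ?r" using pos by (intro one_le_power) simp
  have base: "0 < 4 / \<eta> + X" using pos X by (simp add: add_pos_nonneg)
  have y0: "0 < y0" using r1 base by (simp add: y0_def)
  have IY: "integrable M Y" unfolding Y_def[abs_def] using Ms_integrable[of s] by simp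
  have EY: "(\<integral>\<omega>. Y \<omega> \<partial>M) \<le> y0"
  proof -
    have "(\<integral>\<omega>. Y \<omega> \<partial>M) = 4 / \<eta> + 2 * (\<integral>\<omega>. Ms s \<omega> \<partial>M) / \<epsilon>s (Suc s)"
      unfolding Y_def using Ms_integrable[of s] by (simp add: prob_space)
    also have "\<dots> \<le> 4 / \<eta> + 2 * (\<beta> s * CM) / \<epsilon>s (Suc s)"
      using Ms_expectation[of s] \<epsilon>s_pos[of "Suc s"] by (intro add_left_mono divide_right_mono) auto
    also have "2 * (\<beta> s * CM) / \<epsilon>s (Suc s) = ?r * X"
      using pos by (simp add: \<beta>_eq \<epsilon>s_eq X_def power_divide mult_ac)
    also have "4 / \<eta> + ?r * X \<le> ?r * (4 / \<eta>) + ?r * X"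
      using mult_right_mono[OF r1, of "4 / \<eta>"] pos by simp
    finally show ?thesis by (simp add: y0_def distrib_left)
  qed
  have mG: "real (m (Suc s) \<omega>) \<le> G \<omega>" if \<omega>: "\<omega> \<in> space M" for \<omega>
  proof -
    have Y: "0 < Y \<omega>"
      using Ms_nonneg[OF \<omega>, of s] \<epsilon>s_pos[of "Suc s"] pos by (simp add: Y_def add_pos_nonneg)
    have "ln (Y \<omega> / y0) \<le> Y \<omega> / y0 - 1" using Y y0 by (intro ln_le_minus_one) simp
    then have "ln (Y \<omega>) \<le> ln y0 + (Y \<omega> / y0 - 1)" using Y y0 by (simp add: ln_div)
    then have "log 2 (Y \<omega>) \<le> log 2 y0 + (Y \<omega> / y0 - 1) / ln 2"
      unfolding log_def add_divide_distrib[symmetric] by (intro divide_right_mono) auto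
    then have "?K * (log 2 (Y \<omega>) + 1) \<le> ?K * (log 2 y0 + (Y \<omega> / y0 - 1) / ln 2 + 1)"
      using K by (intro mult_left_mono) auto
    then show ?thesis using m_le[OF \<omega>, of s] unfolding G_def Y_def by linarith
  qed
  have IG: "integrable M G" unfolding G_def[abs_def] using IY by simp
  show I: ?I
    by (rule Bochner_Integration.integrable_bound[OF IG m_measurable_M])
      (use AE_space mG in \<open>fastforce elim!: eventually_mono\<close>)
  have "(\<integral>\<omega>. real (m (Suc s) \<omega>) \<partial>M) \<le> (\<integral>\<omega>. G \<omega> \<partial>M)"
    by (rule integral_mono[OF I IG mG])
  also have "\<dots> = ?K * (log 2 y0 + ((\<integral>\<omega>. Y \<omega> \<partial>M) / y0 - 1) / ln 2 + 1) + 1"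
    unfolding G_def using IY by (simp add: prob_space)
  also have "\<dots> \<le> ?K * (log 2 y0 + 1) + 1"
  proof -
    have "(\<integral>\<omega>. Y \<omega> \<partial>M) / y0 \<le> 1" using EY y0 by simp
    then have "((\<integral>\<omega>. Y \<omega> \<partial>M) / y0 - 1) / ln 2 \<le> 0" by (simp add: divide_nonpos_pos)
    then show ?thesis using K by (intro add_right_mono mult_left_mono) auto
  qed
  also have "\<dots> \<le> ?K * (log 2 y0 + 2)" using K by (simp add: algebra_simps)
  also have "log 2 y0 = real s * log 2 (\<rho> / \<eta>) + log 2 (4 / \<eta> + X)"
    unfolding y0_def using base pos by (simp add: log_mult log_nat_power)
  finally show ?E by (simp add: add.assoc)
qed

lemma m_0_integrable: "integrable M (\<lambda>\<omega>. real (m 0 \<omega>))"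
  and m_0_expectation: "(\<integral>\<omega>. real (m 0 \<omega>) \<partial>M) = real m0"
proof -
  show "integrable M (\<lambda>\<omega>. real (m 0 \<omega>))"
    using m_0 Bochner_Integration.integrable_cong[of M M "\<lambda>\<omega>. real (m 0 \<omega>)" "\<lambda>_. real m0"] by simp
  have "(\<integral>\<omega>. real (m 0 \<omega>) \<partial>M) = (\<integral>\<omega>. real m0 \<partial>M)"
    by (rule Bochner_Integration.integral_cong) (simp_all add: m_0)
  then show "(\<integral>\<omega>. real (m 0 \<omega>) \<partial>M) = real m0" by (simp add: prob_space)
qed

definition C1 :: real where
  "C1 = max (\<epsilon>0 + 2 * Lh\<^sup>2 * \<beta>0 + C0 * \<beta>0) (max (\<beta>0 * norm (snd ls) * sqrt C0) (\<beta>0 * sqrt C0))"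

text \<open>This makes the stage selected for the accuracy \<open>\<epsilon> \<le> \<epsilon>0\<close> positive, as the two-step estimate requires.\<close>

lemma C1_large: "9 * \<epsilon>0 \<le> C1"
proof -
  have "2 * \<kappa> * 1 \<le> 2 * \<kappa> * (1 / (1 - \<theta>))"
    using \<kappa>_pos \<theta>_pos \<theta>_less by (intro mult_left_mono) (auto simp: field_simps)
  then have "2 * \<kappa> \<le> R" by (simp add: R_def add_increasing)
  then have "(2 * \<kappa>)\<^sup>2 \<le> R\<^sup>2" using \<kappa>_pos by (intro power_mono) auto
  moreover have "\<kappa>\<^sup>2 = \<epsilon>0 / \<beta>0" using pos by (simp add: \<kappa>_def)
  ultimately have "8 * (\<epsilon>0 / \<beta>0) \<le> C0"
    unfolding C0_def power_mult_distrib by (simp add: add_increasing2)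
  then have "8 * (\<epsilon>0 / \<beta>0) * \<beta>0 \<le> C0 * \<beta>0" using pos by (intro mult_right_mono) auto
  then have "8 * \<epsilon>0 \<le> C0 * \<beta>0" using pos by simp
  moreover have "0 \<le> 2 * Lh\<^sup>2 * \<beta>0" using pos by simp
  ultimately show ?thesis unfolding C1_def by linarith
qed

text \<open>Each of the three terms of the maximum \<open>C1\<close> is used for one of the estimates.\<close>

lemma accuracy:
  assumes "1 \<le> s" "C1 * \<rho> ^ Suc s \<le> \<epsilon>"
  shows "\<bar>\<integral>\<omega>. excess s \<omega> \<partial>M\<bar> \<le> \<epsilon>" and "(\<integral>\<omega>. infdist (p2 (x s \<omega>)) K \<partial>M) \<le> \<epsilon>"
proof -
  obtain r where r: "s = Suc r" using assms(1) by (cases s) auto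
  have rs: "0 < \<rho> ^ Suc s" using pos by simp
  have scale: "c * \<rho> ^ Suc s \<le> \<epsilon>" if "c \<le> C1" for c
    using mult_right_mono[OF that less_imp_le[OF rs]] assms(2) by linarith
  have b: "\<beta> s * (\<rho> * c) = (\<beta>0 * c) * \<rho> ^ Suc s" for c by (simp add: \<beta>_eq)
  have D: "(\<integral>\<omega>. infdist (p2 (x s \<omega>)) K \<partial>M) \<le> (\<beta>0 * sqrt C0) * \<rho> ^ Suc s"
    using infdist_bound[of r] unfolding r[symmetric] b .
  also have "\<dots> \<le> \<epsilon>" by (rule scale) (simp add: C1_def)
  finally show "(\<integral>\<omega>. infdist (p2 (x s \<omega>)) K \<partial>M) \<le> \<epsilon>" .
  have "norm (snd ls) * (\<integral>\<omega>. infdist (p2 (x s \<omega>)) K \<partial>M) \<le> norm (snd ls) * ((\<beta>0 * sqrt C0) * \<rho> ^ Suc s)"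
    using D by (intro mult_left_mono) auto
  also have "\<dots> = (\<beta>0 * norm (snd ls) * sqrt C0) * \<rho> ^ Suc s" by simp
  also have "\<dots> \<le> \<epsilon>" by (rule scale) (simp add: C1_def)
  finally have lower: "- \<epsilon> \<le> (\<integral>\<omega>. excess s \<omega> \<partial>M)" using excess_lower[of s] by linarith
  have "(\<integral>\<omega>. excess s \<omega> \<partial>M) \<le> \<beta> s * (\<rho> * (\<epsilon>0 / \<beta>0 + 2 * Lh\<^sup>2 + C0))"
    using excess_upper[of s] by (simp add: mult_ac)
  also have "\<dots> = (\<epsilon>0 + 2 * Lh\<^sup>2 * \<beta>0 + C0 * \<beta>0) * \<rho> ^ Suc s"
    unfolding b using pos by (simp add: distrib_left mult_ac)
  also have "\<dots> \<le> \<epsilon>" by (rule scale) (simp add: C1_def)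
  finally show "\<bar>\<integral>\<omega>. excess s \<omega> \<partial>M\<bar> \<le> \<epsilon>" using lower by linarith
qed

lemma complexity:
  fixes \<sigma> wk l \<epsilon> :: real
  assumes rate: "0 \<le> \<sigma>" "0 < wk" "0 < l" "\<And>s. 1 \<le> s \<Longrightarrow> Kin s \<le> wk / \<beta> s powr l + \<sigma>"
    and eps: "0 < \<epsilon>" "\<epsilon> \<le> \<epsilon>0"
  defines "c2 \<equiv> log 2 (4 / \<eta> + 2 * \<beta>0 * CM / (\<epsilon>0 * \<eta>)) + 1"
  defines "c3 \<equiv> (1 + log 2 (\<rho> / \<eta>) + c2) / ln (1 / \<rho>)
              * (\<sigma> * C1 powr l / (\<rho> powr l * l * ln (1 / \<rho>))
                 + wk * C1 powr l / (\<beta>0 powr l * (1 - \<rho> powr l)))"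
  shows "\<exists>s. \<bar>\<integral>\<omega>. excess s \<omega> \<partial>M\<bar> \<le> \<epsilon> \<and> (\<integral>\<omega>. infdist (p2 (x s \<omega>)) K \<partial>M) \<le> \<epsilon>
     \<and> (\<forall>t\<le>s. integrable M (\<lambda>\<omega>. real (m t \<omega>)))
     \<and> (\<Sum>t\<le>s. \<integral>\<omega>. real (m t \<omega>) \<partial>M) \<le> real m0 + c3 / \<epsilon> powr l * ln (C1 / (\<epsilon> * \<rho>))"
proof -
  have C1: "0 < C1" "9 * \<epsilon> \<le> C1" using C1_large pos eps by linarith+
  \<comment> \<open>By minimality the stage also satisfies \<open>\<epsilon> < C1 * \<rho> ^ s\<close>, which bounds the constants of the inner solver up to it.\<close>
  define s where "s = (LEAST s. C1 * \<rho> ^ Suc s \<le> \<epsilon>)"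
  have "\<exists>n. \<rho> ^ n < \<epsilon> / C1" using pos C1 eps by (intro real_arch_pow_inv) auto
  then obtain n where n: "\<rho> ^ n < \<epsilon> / C1" by blast
  have "\<rho> ^ Suc n \<le> \<rho> ^ n" using pos by (simp add: mult_left_le_one_le)
  then have "C1 * \<rho> ^ Suc n \<le> C1 * \<rho> ^ n" using C1 by (intro mult_left_mono) auto
  moreover have "C1 * \<rho> ^ n < \<epsilon>" using n C1 by (simp add: pos_less_divide_eq mult.commute)
  ultimately have "C1 * \<rho> ^ Suc n \<le> \<epsilon>" by linarith
  then have s: "C1 * \<rho> ^ Suc s \<le> \<epsilon>" unfolding s_def by (rule LeastI)
  have s1: "1 \<le> s"
  proof (rule ccontr)
    assume "\<not> 1 \<le> s"
    then have "C1 * \<rho> \<le> \<epsilon>" using s by (simp add: not_le)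
    moreover have "C1 * (1/2) \<le> C1 * \<rho>" using C1 pos by (intro mult_left_mono) auto
    ultimately show False using C1 eps by linarith
  qed
  have "\<not> C1 * \<rho> ^ Suc (s - 1) \<le> \<epsilon>"
    using not_less_Least[of "s - 1" "\<lambda>s. C1 * \<rho> ^ Suc s \<le> \<epsilon>"] s1 unfolding s_def[symmetric] by simp
  then have s_lower: "\<epsilon> < C1 * \<rho> ^ s" using s1 by simp
  define E where "E t = (\<integral>\<omega>. real (m (Suc t) \<omega>) \<partial>M)" for t
  have "(\<Sum>t<s. E t) \<le> (log 2 (\<rho> / \<eta>) + (c2 + 1)) / ln (1 / \<rho>)
      * (\<sigma> * C1 powr l / (\<rho> powr l * l * ln (1 / \<rho>))
                 + wk * C1 powr l / (\<beta>0 powr l * (1 - \<rho> powr l))) / \<epsilon> powr l * ln (C1 / (\<epsilon> * \<rho>))"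
  proof (rule iteration_count_sum[OF pos(1) _ pos(3) rate(1-3) eps(1), where k = "\<lambda>t. Kin (Suc t)"])
    show "0 < \<rho>" using pos by simp
    show "0 \<le> log 2 (\<rho> / \<eta>)" using pos by simp
    have "0 \<le> CM" using pos unfolding CM_def C0_def by (intro add_nonneg_nonneg mult_nonneg_nonneg) auto
    then have "0 \<le> 2 * \<beta>0 * CM / (\<epsilon>0 * \<eta>)" using pos by simp
    moreover have "1 < 4 / \<eta>" using pos by (simp add: field_simps)
    ultimately have "0 < log 2 (4 / \<eta> + 2 * \<beta>0 * CM / (\<epsilon>0 * \<eta>))" by simp
    then show "0 \<le> c2 + 1" by (simp add: c2_def)
    show "0 \<le> Kin (Suc t)" for t using Kin_ge[of "Suc t"] by linarith
    show "Kin (Suc t) \<le> wk / (\<beta>0 * \<rho> ^ Suc t) powr l + \<sigma>" for t using rate(4)[of "Suc t"] by (simp add: \<beta>_eq)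
    show "E t \<le> Kin (Suc t) * (real t * log 2 (\<rho> / \<eta>) + (c2 + 1))" for t
      using m_integrable_and_expectation(2)[of t] unfolding E_def c2_def by (simp add: add.assoc)
  qed (rule s1, rule s_lower)
  also have "log 2 (\<rho> / \<eta>) + (c2 + 1) = 1 + log 2 (\<rho> / \<eta>) + c2" by simp
  finally have sum_E: "(\<Sum>t<s. E t) \<le> c3 / \<epsilon> powr l * ln (C1 / (\<epsilon> * \<rho>))" unfolding c3_def .
  have "(\<Sum>t\<le>s. \<integral>\<omega>. real (m t \<omega>) \<partial>M) = real m0 + (\<Sum>t<s. E t)"
    unfolding E_def lessThan_Suc_atMost[symmetric] sum.lessThan_Suc_shift by (simp add: m_0_expectation)
  moreover have "integrable M (\<lambda>\<omega>. real (m t \<omega>))" for t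
    by (cases t) (simp_all add: m_0_integrable m_integrable_and_expectation(1))
  ultimately show ?thesis using accuracy[OF s1 s] sum_E by (intro exI[of _ s]) auto
qed

end

lemma convex_on_real_of_econvex:
  fixes f :: "'a::real_vector \<Rightarrow> ereal"
  assumes cv: "econvex f" and fin: "\<And>z. f z \<noteq> - \<infinity>"
  shows "convex_on (edom f) (\<lambda>z. real_of_ereal (f z))"
proof -
  have epi: "(z, real_of_ereal (f z)) \<in> eepi f" if "z \<in> edom f" for z
    using that fin[of z] by (cases "f z") (auto simp: eepi_def edom_def)
  have *: "f ((1 - t) *\<^sub>R a + t *\<^sub>R c) \<le> ereal ((1 - t) * real_of_ereal (f a) + t * real_of_ereal (f c))"
    if "a \<in> edom f" "c \<in> edom f" "0 \<le> t" "t \<le> 1" for a c and t :: real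
    using convexD[OF cv[unfolded econvex_def] epi[OF that(1)] epi[OF that(2)], of "1 - t" t] that
    by (simp add: eepi_def)
  show ?thesis
  proof (rule convex_onI)
    fix t :: real and a c assume t: "0 < t" "t < 1" and ac: "a \<in> edom f" "c \<in> edom f"
    then show "real_of_ereal (f ((1 - t) *\<^sub>R a + t *\<^sub>R c)) \<le> (1 - t) * real_of_ereal (f a) + t * real_of_ereal (f c)"
      using *[of a c t] fin[of "(1 - t) *\<^sub>R a + t *\<^sub>R c"] by (cases "f ((1 - t) *\<^sub>R a + t *\<^sub>R c)") auto
  next
    show "convex (edom f)"
      unfolding convex_alt using * by (force simp: edom_def intro: le_less_trans)
  qed
qed

lemma eclosed_measurable:
  fixes g :: "'a::euclidean_space \<Rightarrow> ereal"
  assumes "eclosed g" and fin: "\<And>z. g z \<noteq> - \<infinity>"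
  shows "g \<in> borel_measurable borel"
proof (rule borel_measurableI_le)
  fix y :: ereal
  show "{z \<in> space borel. g z \<le> y} \<in> sets borel"
  proof (cases y)
    case (real r)
    have "continuous_on UNIV (\<lambda>z::'a. (z, r))" by (intro continuous_intros)
    then have "closed ((\<lambda>z. (z, r)) -` eepi g)"
      using assms(1) unfolding eclosed_def by (intro closed_vimage) (auto simp: continuous_on_eq_continuous_at)
    moreover have "(\<lambda>z. (z, r)) -` eepi g = {z. g z \<le> y}" by (auto simp: eepi_def real)
    ultimately show ?thesis by simp
  next
    case MInf
    then have "{z \<in> space borel. g z \<le> y} = {}" using fin by auto
    then show ?thesis by simp
  qed simp
qed

section \<open>The complexity bound\<close>

text \<open>Arbitrary primal and dual solutions have the same values as the pair for which strong duality is
assumed. The dual value at \<open>ls\<close> is then finite, so the conjugate is finite at \<open>ls\<close> and can be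
removed by the Fenchel-Young inequality.\<close>

lemma (in separable_outer) saddle_of_solutions:
  fixes f g :: "'n \<Rightarrow> ereal" and p1 :: "'n \<Rightarrow> 'd1" and p2 :: "'n \<Rightarrow> 'd2"
    and z xs :: 'n and \<mu> ls :: "'d1 \<times> 'd2"
  assumes f: "\<And>y. f y \<noteq> - \<infinity>" "\<And>y. y \<in> edom g \<Longrightarrow> f y \<noteq> \<infinity>" and g: "\<And>y. g y \<noteq> - \<infinity>"
  defines "pp \<equiv> \<lambda>y. (p1 y, p2 y)" and "q \<equiv> \<lambda>y. real_of_ereal (f y + g y)"
  assumes z: "z \<in> edom g" "p2 z \<in> K" "primal_solution f g h pp z"
    and \<mu>: "dual_obj f g h pp \<mu> = f z + g z + ereal (h1 (p1 z))"
    and xs: "primal_solution f g h pp xs" and ls: "dual_solution f g h pp ls"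
  shows "xs \<in> edom g" and "p2 xs \<in> K"
    and "(INF y. primal_obj f g h pp y) = ereal (q xs + h1 (p1 xs))"
    and "\<And>x y. x \<in> edom g \<Longrightarrow> p2 x - snd y \<in> K \<Longrightarrow>
           q xs + h1 (p1 xs) \<le> q x + h1 (p1 x - fst y) + ls \<bullet> y"
proof -
  have fg: "f y + g y = ereal (q y)" if "y \<in> edom g" for y
    using f(1)[of y] f(2)[OF that] g[of y] that unfolding q_def edom_def
    by (cases "f y"; cases "g y") auto
  have primal: "primal_obj f g h pp y = ereal (q y + h1 (p1 y))" if "y \<in> edom g" "p2 y \<in> K" for y
    using that by (simp add: primal_obj_def fg sep_fun_def convex_indicator_def pp_def)
  have primal_inf: "primal_obj f g h pp y = \<infinity>" if "y \<notin> edom g \<or> p2 y \<notin> K" for y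
    using that f(1)[of y] g[of y] unfolding primal_obj_def sep_fun_def convex_indicator_def pp_def edom_def
    by (cases "f y"; cases "g y") auto
  have "primal_obj f g h pp xs \<le> ereal (q z + h1 (p1 z))"
    using xs[unfolded primal_solution_def, rule_format, of z] primal[OF z(1,2)] by simp
  then have "primal_obj f g h pp xs \<noteq> \<infinity>" by auto
  then show xA: "xs \<in> edom g" and xK: "p2 xs \<in> K"
    using primal_inf[of xs] by blast+
  have "primal_obj f g h pp xs = primal_obj f g h pp z"
    using xs z(3) by (intro antisym) (auto simp: primal_solution_def)
  then have v: "q z + h1 (p1 z) = q xs + h1 (p1 xs)"
    using primal[OF xA xK] primal[OF z(1,2)] by simp
  show "(INF y. primal_obj f g h pp y) = ereal (q xs + h1 (p1 xs))"
  proof (rule antisym)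
    show "(INF y. primal_obj f g h pp y) \<le> ereal (q xs + h1 (p1 xs))"
      by (rule INF_lower2[of xs]) (simp_all add: primal[OF xA xK])
    show "ereal (q xs + h1 (p1 xs)) \<le> (INF y. primal_obj f g h pp y)"
      by (rule INF_greatest) (use xs primal[OF xA xK] in \<open>auto simp: primal_solution_def\<close>)
  qed
  have "ereal (q xs + h1 (p1 xs)) = dual_obj f g h pp \<mu>"
    unfolding \<mu> fg[OF z(1)] v[symmetric] by simp
  also have "\<dots> \<le> dual_obj f g h pp ls" using ls unfolding dual_solution_def by blast
  finally have dual: "ereal (q xs + h1 (p1 xs)) \<le> lagrangian f g h pp x ls" for x
    unfolding dual_obj_def by (rule order_trans) (rule INF_lower, simp)
  have lag: "lagrangian f g h pp x ls = ereal (q x + ls \<bullet> pp x) - fenchel_conj h ls" if "x \<in> edom g" for x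
    by (simp add: lagrangian_def fg[OF that])
  have "fenchel_conj h ls \<noteq> \<infinity>"
    using dual[of xs] unfolding lag[OF xA] by auto
  then have c: "fenchel_conj h ls = ereal (conj_val ls)"
    by (intro fenchel_conj_real) (simp add: edom_def)
  fix x :: 'n and y :: "'d1 \<times> 'd2" assume x: "x \<in> edom g" "p2 x - snd y \<in> K"
  have "q xs + h1 (p1 xs) \<le> q x + ls \<bullet> pp x - conj_val ls"
    using dual[of x] unfolding lag[OF x(1)] c by simp
  moreover have "ls \<bullet> (pp x - y) - h1 (p1 x - fst y) \<le> conj_val ls"
    using fenchel_young[of "pp x - y" ls] x(2) unfolding c by (simp add: pp_def)
  ultimately show "q xs + h1 (p1 xs) \<le> q x + h1 (p1 x - fst y) + ls \<bullet> y"
    by (simp add: inner_diff_right)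
qed

text \<open>Outside its domain of differentiability \<open>f\<close> need not be measurable; the indicator confines it to the domain of
\<open>g\<close>, a Borel set on which \<open>f\<close> is continuous.\<close>

lemma objective_measurable:
  fixes f g :: "'n::euclidean_space \<Rightarrow> ereal"
  assumes g: "eclosed g" "\<And>z. g z \<noteq> - \<infinity>" and f: "\<And>z. f z \<noteq> - \<infinity>"
    and S: "open S" "edom g \<subseteq> S" "\<And>z. z \<in> S \<Longrightarrow> f z \<noteq> \<infinity>"
      "\<And>z. z \<in> S \<Longrightarrow> (\<lambda>y. real_of_ereal (f y)) differentiable (at z)"
  shows "edom g \<in> sets borel"
    and "(\<lambda>z. indicator (edom g) z * real_of_ereal (f z + g z)) \<in> borel_measurable borel"
proof -
  have gm [measurable]: "g \<in> borel_measurable borel" by (rule eclosed_measurable[OF g])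
  have "{z \<in> space borel. g z < \<infinity>} \<in> sets borel" by measurable
  then show A [measurable]: "edom g \<in> sets borel" by (simp add: edom_def)
  have "continuous_on S (\<lambda>y. real_of_ereal (f y))"
    using S(4) by (intro continuous_at_imp_continuous_on) (auto dest: differentiable_imp_continuous_within)
  then have [measurable]: "(\<lambda>z. indicator S z *\<^sub>R real_of_ereal (f z)) \<in> borel_measurable borel"
    by (intro borel_measurable_continuous_on_indicator borel_open S(1))
  have "(\<lambda>z. indicator (edom g) z * (indicator S z *\<^sub>R real_of_ereal (f z)) + indicator (edom g) z * real_of_ereal (g z))
      \<in> borel_measurable borel"
    by measurable
  moreover have "indicator (edom g) z * real_of_ereal (f z + g z)
    = indicator (edom g) z * (indicator S z *\<^sub>R real_of_ereal (f z)) + indicator (edom g) z * real_of_ereal (g z)" for z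
  proof (cases "z \<in> edom g")
    case True
    then have "z \<in> S" using S(2) by auto
    then show ?thesis
      using True S(3)[of z] f[of z] g(2)[of z] by (cases "f z"; cases "g z") (auto simp: edom_def)
  qed simp
  ultimately show "(\<lambda>z. indicator (edom g) z * real_of_ereal (f z + g z)) \<in> borel_measurable borel"
    by simp
qed

theorem theorem2:
  fixes M :: "'w measure"
    and f g :: "'n::euclidean_space \<Rightarrow> ereal"
    and h1 :: "'d1::euclidean_space \<Rightarrow> real"
    and K :: "'d2::euclidean_space set"
    and p1 :: "'n \<Rightarrow> 'd1" and p2 :: "'n \<Rightarrow> 'd2"
    and h :: "'d1 \<times> 'd2 \<Rightarrow> ereal" and p :: "'n \<Rightarrow> 'd1 \<times> 'd2"
    and F :: "'n \<Rightarrow> ereal" and Fstar :: ereal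
    and Lh \<beta>0 \<rho> \<eta> \<epsilon>0 :: real and m0 :: nat
    and \<beta> \<epsilon>s :: "nat \<Rightarrow> real"
    and xinit xstar :: 'n and linit lstar :: "'d1 \<times> 'd2"
    and x :: "nat \<Rightarrow> 'w \<Rightarrow> 'n" and lam :: "nat \<Rightarrow> 'w \<Rightarrow> 'd1 \<times> 'd2" and m :: "nat \<Rightarrow> 'w \<Rightarrow> nat"
    and H :: "nat \<Rightarrow> 'w \<Rightarrow> 'n \<Rightarrow> ereal"
    and Alg :: "nat \<Rightarrow> 'n \<Rightarrow> nat \<Rightarrow> ('n \<Rightarrow> ereal) \<Rightarrow> 'w \<Rightarrow> 'n"
    and Kin :: "nat \<Rightarrow> real"
    and \<sigma> w l \<epsilon> c0 c1 c2 c3 :: real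
  assumes "h = sep_fun h1 K"
    and "p = (\<lambda>z. (p1 z, p2 z))"
    and "F = (\<lambda>z. f z + g z + ereal (h1 (p1 z)))"
    and "Fstar = (INF z. primal_obj f g h p z)"
    and "\<beta> = (\<lambda>s. \<beta>0 * \<rho> ^ s)"
    and "\<epsilon>s = (\<lambda>s. \<epsilon>0 * \<eta> ^ s)"
    and "H = sub_obj f g h p \<beta> xinit x lam"
    and "c0 = 2 * (norm ((xinit, linit) - (xstar, lstar))
                    + 2 * sqrt (\<epsilon>0 / \<beta>0) / (1 - sqrt (\<eta> / \<rho>)))\<^sup>2
              + 2 * (norm lstar)\<^sup>2 + 2 * (norm xstar)\<^sup>2"
    and "c1 = max (\<epsilon>0 + 2 * Lh\<^sup>2 * \<beta>0 + c0 * \<beta>0)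
                (max (\<beta>0 * norm (snd lstar) * sqrt c0) (\<beta>0 * sqrt c0))"
    and "c2 = log 2 (4 / \<eta>
                + 2 * \<beta>0 * ((11 + 2 / \<rho>\<^sup>2) * (Lh\<^sup>2 + 4 * c0) + 4 / (2 * \<rho> - 1) * c0) / (\<epsilon>0 * \<eta>)) + 1"
    and "c3 = (1 + log 2 (\<rho> / \<eta>) + c2) / ln (1 / \<rho>)
              * (\<sigma> * c1 powr l / (\<rho> powr l * l * ln (1 / \<rho>))
                 + w * c1 powr l / (\<beta>0 powr l * (1 - \<rho> powr l)))"
    and "eproper g" "econvex g" "eclosed g"
    and "convex_on UNIV h1"
    and "K \<noteq> {}" "closed K" "convex K"
    and "\<forall>z. f z \<noteq> -\<infinity>" "econvex f"
    and "\<exists>S. open S \<and> edom g \<subseteq> S \<and>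
           (\<forall>z\<in>S. f z \<noteq> \<infinity> \<and> (\<lambda>y. real_of_ereal (f y)) differentiable (at z))"
    and "\<forall>z. p1 differentiable (at z)" "\<forall>z. p2 differentiable (at z)"
    and "Lh-lipschitz_on UNIV h1"
    and "\<forall>z y u v. \<forall>\<alpha>\<in>{0<..<1}.
           h1 (p1 (\<alpha> *\<^sub>R z + (1 - \<alpha>) *\<^sub>R y) - \<alpha> *\<^sub>R u - (1 - \<alpha>) *\<^sub>R v)
           \<le> \<alpha> * h1 (p1 z - u) + (1 - \<alpha>) * h1 (p1 y - v)"
    and "\<forall>z y u v. \<forall>\<alpha>\<in>{0<..<1}. p2 z - u \<in> K \<longrightarrow> p2 y - v \<in> K \<longrightarrow>
           p2 (\<alpha> *\<^sub>R z + (1 - \<alpha>) *\<^sub>R y) - \<alpha> *\<^sub>R u - (1 - \<alpha>) *\<^sub>R v \<in> K"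
    and "\<exists>z\<in>edom g. \<exists>\<mu>\<in>edom (fenchel_conj h).
           primal_solution f g h p z \<and> dual_solution f g h p \<mu> \<and> p2 z \<in> K \<and>
           F z = lagrangian f g h p z \<mu> \<and> lagrangian f g h p z \<mu> = dual_obj f g h p \<mu>"
    and "primal_solution f g h p xstar" "dual_solution f g h p lstar"
    and "prob_space M"
    and "0 < \<beta>0" "1/2 < \<rho>" "\<rho> < 1" "0 < \<eta>" "\<eta> < 1" "0 < m0"
    and "xinit \<in> edom g" "linit \<in> edom (fenchel_conj h)"
    and "\<forall>\<omega>\<in>space M. lam 0 \<omega> = linit"
    and "\<forall>\<omega>\<in>space M. m 0 \<omega> = m0"
    and "\<forall>\<omega>\<in>space M. \<forall>s. x s \<omega> = Alg s (prev_iter xinit x s \<omega>) (m s \<omega>) (H s \<omega>) \<omega>"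
    and "0 < \<epsilon>0" "AE \<omega> in M. gap (H 0 \<omega>) (x 0 \<omega>) \<le> ereal \<epsilon>0"
    and "\<forall>\<omega>\<in>space M. \<forall>s. lam (Suc s) \<omega> = smooth_argmax h (p (x s \<omega>)) (lam s \<omega>) (\<beta> s)"
    and "\<forall>\<omega>\<in>space M. \<forall>s. m (Suc s) \<omega> =
           (LEAST k. 0 < k \<and> 2 * \<epsilon>s s + ipalm_M Lh h p \<beta> xinit x lam s \<omega>
                              \<le> 2 powi \<lfloor>real k / Kin (Suc s)\<rfloor> * \<epsilon>s (Suc s) / 2)"
    and "\<forall>s. 1 \<le> Kin s"
    and "\<forall>s. inner_rate M (past_algebra M x lam s) (edom g) (H s) (Kin s) (Alg s)"
    and "\<eta> < \<rho>"
    and "0 \<le> \<sigma>" "0 < w" "0 < l"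
    and "\<forall>s\<ge>1. Kin s \<le> w / \<beta> s powr l + \<sigma>"
    and "0 < \<epsilon>" "\<epsilon> \<le> \<epsilon>0"
  shows "\<exists>s. ereal_integrable M (\<lambda>\<omega>. F (x s \<omega>) - Fstar)
           \<and> \<bar>\<integral>\<omega>. real_of_ereal (F (x s \<omega>) - Fstar) \<partial>M\<bar> \<le> \<epsilon>
           \<and> integrable M (\<lambda>\<omega>. infdist (p2 (x s \<omega>)) K)
           \<and> (\<integral>\<omega>. infdist (p2 (x s \<omega>)) K \<partial>M) \<le> \<epsilon>
           \<and> (\<forall>t\<le>s. integrable M (\<lambda>\<omega>. real (m t \<omega>)))
           \<and> (\<Sum>t\<le>s. \<integral>\<omega>. real (m t \<omega>) \<partial>M) \<le> real m0 + c3 / \<epsilon> powr l * ln (c1 / (\<epsilon> * \<rho>))"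
proof -
  note h_def = assms(1) and p_def' = assms(2) and F_def = assms(3) and Fstar_def = assms(4)
    and \<beta>_def = assms(5) and \<epsilon>s_def = assms(6) and H_def = assms(7) and c0_def = assms(8)
    and c1_def = assms(9) and c2_def = assms(10) and c3_def = assms(11)
    and g_ass = assms(12-14) and outer_ass = assms(15-18) and f_ass = assms(19-21)
    and p_diff = assms(22,23) and Lip = assms(24) and p_convex = assms(25,26)
    and solutions = assms(27-29) and prob = assms(30) and par = assms(31-36)
    and init = assms(37-40) and x_rec = assms(41) and eps0 = assms(42,43)
    and lam_rec = assms(44) and m_rec = assms(45) and Kin1 = assms(46) and rate = assms(47)
    and \<eta>\<rho> = assms(48) and cons = assms(49-52) and eps = assms(53,54)
  define A where "A = edom g"
  define q where "q = (\<lambda>z. real_of_ereal (f z + g z))"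
  have g_fin: "g z \<noteq> - \<infinity>" for z using g_ass(1) by (simp add: eproper_def)
  have f_fin: "f z \<noteq> - \<infinity>" for z using f_ass(1) by simp
  obtain S where S: "open S" "edom g \<subseteq> S" "\<And>z. z \<in> S \<Longrightarrow> f z \<noteq> \<infinity>"
      "\<And>z. z \<in> S \<Longrightarrow> (\<lambda>y. real_of_ereal (f y)) differentiable (at z)"
    using f_ass(3) by blast
  have f_dom: "f z \<noteq> \<infinity>" if "z \<in> edom g" for z using S that by blast
  interpret O: separable_outer h1 K Lh
    by unfold_locales (use outer_ass Lip in auto)
  obtain z \<mu> where z: "z \<in> edom g" "primal_solution f g h p z" "p2 z \<in> K"
    "F z = lagrangian f g h p z \<mu>" "lagrangian f g h p z \<mu> = dual_obj f g h p \<mu>"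
    using solutions(1) by blast
  have dual: "dual_obj f g h p \<mu> = f z + g z + ereal (h1 (p1 z))"
    using z(4,5) by (simp add: F_def)
  note sad = O.saddle_of_solutions[where f = f and g = g and ?p1.0 = p1 and ?p2.0 = p2 and z = z and \<mu> = \<mu> and xs = xstar and ls = lstar,
      folded h_def p_def' q_def, OF f_fin f_dom g_fin z(1,3,2) dual solutions(2,3)]
  have fg: "f y + g y = ereal (q y)" if "y \<in> A" for y
    using f_fin[of y] f_dom[of y] g_fin[of y] that unfolding q_def A_def edom_def
    by (cases "f y"; cases "g y") auto
  have cvq: "convex_on A q"
  proof -
    have g: "convex_on A (\<lambda>z. real_of_ereal (g z))"
      unfolding A_def by (rule convex_on_real_of_econvex[OF g_ass(2) g_fin])
    have "A \<subseteq> edom f" using f_dom by (auto simp: A_def edom_def less_top[symmetric])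
    then have f: "convex_on A (\<lambda>z. real_of_ereal (f z))"
      using convex_on_subset[OF convex_on_real_of_econvex[OF f_ass(2) f_fin]] convex_on_imp_convex[OF g] by blast
    have "q z = real_of_ereal (f z) + real_of_ereal (g z)" if "z \<in> A" for z
      using f_fin[of z] f_dom[of z] g_fin[of z] that unfolding q_def A_def edom_def
      by (cases "f z"; cases "g z") auto
    then show ?thesis
      using convex_on_add[OF f g] convex_on_imp_convex[OF g] by (simp add: convex_on_def convex_def)
  qed
  have cont: "continuous_on UNIV p1" "continuous_on UNIV p2"
    using p_diff by (auto intro!: continuous_at_imp_continuous_on dest: differentiable_imp_continuous_within)
  interpret P: prob_space M by (rule prob)
  interpret I: ipalm h1 K Lh A q p1 p2 xstar lstar f g M \<beta>0 \<rho> \<eta> \<epsilon>0 m0 \<beta> \<epsilon>s xinit linit x lam m H Alg Kin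
  proof unfold_locales
    show "convex_on A q" by (rule cvq)
    show "h1 (p1 (t *\<^sub>R x + (1 - t) *\<^sub>R y) - t *\<^sub>R u - (1 - t) *\<^sub>R v)
           \<le> t * h1 (p1 x - u) + (1 - t) * h1 (p1 y - v)" if "0 < t" "t < 1" for x y u v t
      using p_convex(1) that by simp
    show "p2 (t *\<^sub>R x + (1 - t) *\<^sub>R y) - t *\<^sub>R u - (1 - t) *\<^sub>R v \<in> K"
      if "0 < t" "t < 1" "p2 x - u \<in> K" "p2 y - v \<in> K" for x y u v t
      using p_convex(2) that by simp
    show "xstar \<in> A" "p2 xstar \<in> K" using sad(1,2) by (simp_all add: A_def)
    show "q xstar + h1 (p1 xstar) \<le> q x + h1 (p1 x - fst z) + lstar \<bullet> z"
      if "x \<in> A" "p2 x - snd z \<in> K" for x z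
      using sad(4)[of x z] that unfolding A_def q_def by simp
    show "f x + g x = ereal (q x)" if "x \<in> A" for x by (rule fg[OF that])
    show "f x + g x = \<infinity>" if "x \<notin> A" for x
      using that f_fin[of x] by (simp add: A_def edom_def)
    show "A \<in> sets borel"
      unfolding A_def by (rule objective_measurable(1)[OF g_ass(3) g_fin f_fin S])
    show "(\<lambda>x. indicator A x * q x) \<in> borel_measurable borel"
      unfolding A_def q_def by (rule objective_measurable(2)[OF g_ass(3) g_fin f_fin S])
    show "continuous_on UNIV p1" "continuous_on UNIV p2" by (rule cont)+
    show "\<beta> = (\<lambda>s. \<beta>0 * \<rho> ^ s)" "\<epsilon>s = (\<lambda>s. \<epsilon>0 * \<eta> ^ s)" by (rule \<beta>_def, rule \<epsilon>s_def)
    show "H = sub_obj f g (sep_fun h1 K) (\<lambda>z. (p1 z, p2 z)) \<beta> xinit x lam"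
      unfolding H_def h_def p_def' ..
    show "0 < \<beta>0" "1 / 2 < \<rho>" "\<rho> < 1" "0 < \<eta>" "\<eta> < \<rho>" "0 < \<epsilon>0" using par \<eta>\<rho> eps0 by auto
    show "xinit \<in> A" using init by (simp add: A_def)
    show "lam 0 \<omega> = linit" if "\<omega> \<in> space M" for \<omega> using init that by simp
    show "m 0 \<omega> = m0" if "\<omega> \<in> space M" for \<omega> using init that by simp
    show "x s \<omega> = Alg s (prev_iter xinit x s \<omega>) (m s \<omega>) (H s \<omega>) \<omega>" if "\<omega> \<in> space M" for \<omega> s
      using x_rec that by simp
    show "AE \<omega> in M. gap (H 0 \<omega>) (x 0 \<omega>) \<le> ereal \<epsilon>0" by (rule eps0(2))
    show "lam (Suc s) \<omega> = smooth_argmax (sep_fun h1 K) (p1 (x s \<omega>), p2 (x s \<omega>)) (lam s \<omega>) (\<beta> s)"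
      if "\<omega> \<in> space M" for \<omega> s
      using lam_rec that unfolding h_def p_def' by simp
    show "m (Suc s) \<omega> = (LEAST k. 0 < k \<and> 2 * \<epsilon>s s + ipalm_M Lh (sep_fun h1 K) (\<lambda>z. (p1 z, p2 z)) \<beta> xinit x lam s \<omega>
                              \<le> 2 powi \<lfloor>real k / Kin (Suc s)\<rfloor> * \<epsilon>s (Suc s) / 2)"
      if "\<omega> \<in> space M" for \<omega> s
      using m_rec that unfolding h_def p_def' by simp
    show "1 \<le> Kin s" for s using Kin1 by simp
    show "inner_rate M (past_algebra M x lam s) A (H s) (Kin s) (Alg s)" for s
      using rate by (simp add: A_def)
  qed
  have C0: "I.C0 = c0"
    unfolding c0_def I.C0_def I.R_def I.\<kappa>_def I.\<theta>_def I.ws_def ..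
  have C1: "I.C1 = c1" unfolding c1_def I.C1_def C0 ..
  have c2: "c2 = log 2 (4 / \<eta> + 2 * \<beta>0 * I.CM / (\<epsilon>0 * \<eta>)) + 1"
    unfolding c2_def I.CM_def C0 ..
  obtain s where s: "\<bar>\<integral>\<omega>. I.excess s \<omega> \<partial>M\<bar> \<le> \<epsilon>" "(\<integral>\<omega>. infdist (p2 (x s \<omega>)) K \<partial>M) \<le> \<epsilon>"
     "\<forall>t\<le>s. integrable M (\<lambda>\<omega>. real (m t \<omega>))"
     "(\<Sum>t\<le>s. \<integral>\<omega>. real (m t \<omega>) \<partial>M) \<le> real m0 + c3 / \<epsilon> powr l * ln (c1 / (\<epsilon> * \<rho>))"
    using I.complexity[OF cons(1-3) _ eps, folded c2, unfolded C1, folded c3_def] cons(4) by blast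
  have "Fstar = ereal (q xstar + h1 (p1 xstar))" using sad(3) unfolding Fstar_def q_def .
  then have Fstar: "Fstar = ereal I.Fs" unfolding I.Fs_def .
  have F_in: "F (x s \<omega>) - Fstar = ereal (I.excess s \<omega>)" if "x s \<omega> \<in> A" for \<omega>
    using that by (simp add: F_def fg I.excess_def Fstar)
  have F_real: "real_of_ereal (F (x s \<omega>) - Fstar) = I.excess s \<omega>" for \<omega>
  proof (cases "x s \<omega> \<in> A")
    case False
    then show ?thesis by (simp add: F_def I.fg_out I.excess_def Fstar)
  qed (simp add: F_in)
  have "AE \<omega> in M. \<bar>F (x s \<omega>) - Fstar\<bar> \<noteq> \<infinity>"
    using I.x_in_A[of s] by eventually_elim (simp add: F_in)
  then have "ereal_integrable M (\<lambda>\<omega>. F (x s \<omega>) - Fstar)"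
    unfolding ereal_integrable_def F_real using I.excess_integrable by blast
  moreover have "\<bar>\<integral>\<omega>. real_of_ereal (F (x s \<omega>) - Fstar) \<partial>M\<bar> \<le> \<epsilon>"
    using s(1) by (simp only: F_real)
  ultimately show ?thesis
    using s(2-4) I.infdist_integrable[of s] by (intro exI[of _ s] conjI)
qed

end
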